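(* Let $\mathcal L$ be a finite distributive lattice with poset of join-irreducible elements $(P,<)$, let $K=\overline{C(I^h,I^m)}\subset\mathbb R^{\mathcal L}$, let $F$ be a face of $K$ and let $w$ be a point in the relative interior of $F$. Then the regular subdivision $\Theta(w)$ of the order polytope $O(P,<)$ is independent of the choice of $w$ in the relative interior of $F$, and every part in this subdivision is the order polytope $O(P,<')$ of some order relation $<'$ on $P$. The irreducible components of the variety $Y^F$ are the toric varieties associated with the parts of the subdivision $\Theta(w)$ (and are, therefore, themselves Hibi varieties).
   Context: Lattice and order polytopes. $(\mathcal L,\vee,\wedge)$ is a finite distributive lattice with induced order $<$. $P$ is the set of join-irreducible elements of $\mathcal L$ (non-minimal $a$ such that $a=b\vee c$ implies $a=b$ or $a=c$), with the induced order $<$. For a partial order $<'$ on $P$, $\mathcal J(P,<')$ is the set of order ideals (lower sets) of $(P,<')$. The map $\iota:\mathcal L\to\mathcal J(P,<)$, $\iota(a)=\{p\in P: p\le a\}$, is a lattice isomorphism (Birkhoff). Put $v_a=\mathbf 1_{\iota(a)}\in\mathbb R^P$ (indicator function). The order polytope $O(P,<')\subset\mathbb R^P$ consists of $x$ with $0\le x_p\le 1$ for all $p$ and $x_p\le x_q$ whenever $p>'q$; its vertices are the indicator functions of the order ideals of $(P,<')$, so the vertices of $O(P,<)$ are the points $v_a$, $a\in\mathcal L$. Initial ideals. $R=\mathbb C[\{X_a,a\in\mathcal L\}]$. For $w\in\mathbb R^{\mathcal L}$ let $\mathrm{grad}_w$ be the $\mathbb R$-grading on $R$ with $\mathrm{grad}_w(X_a)=w_a$;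 for nonzero $p\in R$, $\mathrm{in}_w p$ is the nonzero $\mathrm{grad}_w$-homogeneous component of $p$ of least grading, and for an ideal $I$, $\mathrm{in}_w I$ is the linear span of $\{\mathrm{in}_w p: p\in I\}$ (an ideal). $C(I,J)=\{w\in\mathbb R^{\mathcal L}:\mathrm{in}_w I=J\}$. The Hibi ideal $I^h\subset R$ is generated by all $X_aX_b-X_{a\vee b}X_{a\wedge b}$, $a,b\in\mathcal L$; $I^m\subset R$ is generated by all $X_aX_b$ with $a,b$ incomparable. $K=\overline{C(I^h,I^m)}$ is a full-dimensional polyhedral cone (a maximal cone of the Gröbner fan of $I^h$). Faces of $K$ include $K$ itself and the minimal face. For each face $F$ of $K$, $\mathrm{in}_w I^h$ is the same for all $w$ in the relative interior of $F$; this ideal is denoted $I^F$. $Y^F\subset\mathbb P(\mathbb C^{\mathcal L})$ is the zero set of $I^F$. The Hibi variety of a finite distributive lattice is the subvariety of the corresponding projective space cut out by its Hibi ideal. Regular subdivisions. For an $n$-dimensional convex polytope $Q\subset \mathbb R^n$ with vertex set $V$ and $c\in\mathbb R^V$, let $T\subset\mathbb R^n\times\mathbb R$ be the convex hull of the union of the rays $\{v\}\times\{x\le c_v\}$, $v\in V$. The projections to $\mathbb R^n$ of the bounded facets of $T$ form a polyhedral subdivision $\Theta_Q(c)$ of $Q$, called a regular subdivision; its elements are called its parts. For $w\in\mathbb R^{\mathcal L}$, $\Theta(w)$ denotes $\Theta_{O(P,<)}(c)$ with $c_{v_a}=w_a$. *)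

theory Defs
  imports "HOL-Analysis.Analysis" "HOL-Library.Poly_Mapping"
begin

definition join_irreducibles :: "'a::distrib_lattice set" where
  "join_irreducibles = {a. (\<exists>b. b < a) \<and> (\<forall>b c. a = sup b c \<longrightarrow> a = b \<or> a = c)}"

definition is_order_on :: "'a set \<Rightarrow> ('a \<Rightarrow> 'a \<Rightarrow> bool) \<Rightarrow> bool" where
  "is_order_on P lt \<longleftrightarrow> irreflp_on P lt \<and> transp_on P lt"

definition order_ideals :: "'a set \<Rightarrow> ('a \<Rightarrow> 'a \<Rightarrow> bool) \<Rightarrow> 'a set set" where
  "order_ideals P lt = {D. D \<subseteq> P \<and> (\<forall>p\<in>D. \<forall>q\<in>P. lt q p \<longrightarrow> q \<in> D)}"

definition birkhoff :: "'a::distrib_lattice \<Rightarrow> 'a set" where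
  "birkhoff a = {p \<in> join_irreducibles. p \<le> a}"

text \<open>For \<open>P \<subseteq> UNIV :: 'a set\<close>, the space of real functions on \<open>P\<close> is the coordinate subspace of
  \<open>real ^ 'a\<close> of the vectors vanishing outside \<open>P\<close>.\<close>

definition order_polytope :: "'a::finite set \<Rightarrow> ('a \<Rightarrow> 'a \<Rightarrow> bool) \<Rightarrow> (real ^ 'a) set" where
  "order_polytope P lt =
    {x. (\<forall>p. p \<notin> P \<longrightarrow> x $ p = 0) \<and> (\<forall>p\<in>P. 0 \<le> x $ p \<and> x $ p \<le> 1) \<and>
        (\<forall>p\<in>P. \<forall>q\<in>P. lt q p \<longrightarrow> x $ p \<le> x $ q)}"

definition lattice_vertex :: "'a \<Rightarrow> real ^ 'a::{finite,distrib_lattice}" where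
  "lattice_vertex a = (\<chi> p. of_bool (p \<in> birkhoff a))"

definition regular_subdivision ::
  "'v::euclidean_space set \<Rightarrow> ('v \<Rightarrow> real) \<Rightarrow> 'v set set" where
  "regular_subdivision Q c =
    (let T = convex hull (\<Union>v\<in>{v. v extreme_point_of Q}. {v} \<times> {..c v})
     in {fst ` G | G. G facet_of T \<and> bounded G})"

definition hibi_subdivision :: "real ^ 'a::{finite,distrib_lattice} \<Rightarrow> (real, 'a) vec set set" where
  "hibi_subdivision w =
    regular_subdivision (order_polytope join_irreducibles (<)) (\<lambda>v. w $ inv lattice_vertex v)"

type_synonym 'b cpoly = "('b \<Rightarrow>\<^sub>0 nat) \<Rightarrow>\<^sub>0 complex"

definition Xvar :: "'b \<Rightarrow> 'b cpoly" where
  "Xvar a = Poly_Mapping.single (Poly_Mapping.single a 1) 1"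

definition cpoly_eval :: "'b cpoly \<Rightarrow> ('b \<Rightarrow> complex) \<Rightarrow> complex" where
  "cpoly_eval p x =
    (\<Sum>m\<in>Poly_Mapping.keys p. Poly_Mapping.lookup p m *
      (\<Prod>i\<in>Poly_Mapping.keys m. x i ^ Poly_Mapping.lookup m i))"

definition ideal_generated :: "'r::comm_ring_1 set \<Rightarrow> 'r set" where
  "ideal_generated = module.span (*)"

definition complex_span :: "'b cpoly set \<Rightarrow> 'b cpoly set" where
  "complex_span = module.span (\<lambda>c p. Poly_Mapping.single 0 c * p)"

definition grad :: "real ^ 'b::finite \<Rightarrow> ('b \<Rightarrow>\<^sub>0 nat) \<Rightarrow> real" where
  "grad w m = (\<Sum>a\<in>UNIV. real (Poly_Mapping.lookup m a) * w $ a)"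

definition initial_form :: "real ^ 'b::finite \<Rightarrow> 'b cpoly \<Rightarrow> 'b cpoly" where
  "initial_form w p =
    (\<Sum>m\<in>{m \<in> Poly_Mapping.keys p. grad w m = Min (grad w ` Poly_Mapping.keys p)}.
      Poly_Mapping.single m (Poly_Mapping.lookup p m))"

definition initial_ideal :: "real ^ 'b::finite \<Rightarrow> 'b cpoly set \<Rightarrow> 'b cpoly set" where
  "initial_ideal w I = complex_span (initial_form w ` (I - {0}))"

definition initial_cone :: "'b::finite cpoly set \<Rightarrow> 'b cpoly set \<Rightarrow> (real ^ 'b) set" where
  "initial_cone I J = {w. initial_ideal w I = J}"

text \<open>The Hibi ideal of a finite distributive lattice given as a sublattice \<open>M\<close> of a type. Variables
  outside \<open>M\<close> play no role in the zero set below, where the corresponding coordinates are \<open>0\<close>.\<close>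

definition hibi_ideal :: "'b::distrib_lattice set \<Rightarrow> 'b cpoly set" where
  "hibi_ideal M = ideal_generated {Xvar a * Xvar b - Xvar (sup a b) * Xvar (inf a b) | a b. a \<in> M \<and> b \<in> M}"

definition hibi_monomial_ideal :: "'a::distrib_lattice cpoly set" where
  "hibi_monomial_ideal = ideal_generated {Xvar a * Xvar b | a b. \<not> a \<le> b \<and> \<not> b \<le> a}"

definition hibi_cone :: "(real ^ 'a::{finite,distrib_lattice}) set" where
  "hibi_cone = closure (initial_cone (hibi_ideal UNIV) hibi_monomial_ideal)"

definition face_ideal :: "(real ^ 'a::{finite,distrib_lattice}) set \<Rightarrow> 'a cpoly set" where
  "face_ideal F = (THE J. \<forall>w\<in>rel_interior F. initial_ideal w (hibi_ideal UNIV) = J)"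

text \<open>A point of the projective space with homogeneous coordinates indexed by \<open>A\<close> is a line through
  the origin in the space of the functions \<open>'b \<Rightarrow> complex\<close> that vanish outside \<open>A\<close>.\<close>

type_synonym 'b ppoint = "('b \<Rightarrow> complex) set"

definition proj_point :: "('b \<Rightarrow> complex) \<Rightarrow> 'b ppoint" where
  "proj_point x = range (\<lambda>c i. c * x i)"

definition proj_space :: "'b set \<Rightarrow> 'b ppoint set" where
  "proj_space A = {proj_point x | x. (\<forall>i. i \<notin> A \<longrightarrow> x i = 0) \<and> (\<exists>i. x i \<noteq> 0)}"

text \<open>A polynomial vanishes on a whole line iff each of its homogeneous components vanishes at a
  spanning vector, so this is the usual zero set also for polynomials that are not homogeneous.\<close>

definition proj_zeros :: "'b set \<Rightarrow> 'b cpoly set \<Rightarrow> 'b ppoint set" where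
  "proj_zeros A S = {l \<in> proj_space A. \<forall>p\<in>S. \<forall>x\<in>l. cpoly_eval p x = 0}"

definition zariski_closed :: "'b set \<Rightarrow> 'b ppoint set \<Rightarrow> bool" where
  "zariski_closed A Z \<longleftrightarrow> (\<exists>S. Z = proj_zeros A S)"

definition zariski_closure :: "'b set \<Rightarrow> 'b ppoint set \<Rightarrow> 'b ppoint set" where
  "zariski_closure A Z = \<Inter>{C. zariski_closed A C \<and> Z \<subseteq> C}"

definition zariski_irreducible :: "'b set \<Rightarrow> 'b ppoint set \<Rightarrow> bool" where
  "zariski_irreducible A Z \<longleftrightarrow> Z \<noteq> {} \<and>
    (\<forall>C D. zariski_closed A C \<longrightarrow> zariski_closed A D \<longrightarrow> Z \<subseteq> C \<union> D \<longrightarrow> Z \<subseteq> C \<or> Z \<subseteq> D)"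

definition irreducible_components :: "'b set \<Rightarrow> 'b ppoint set \<Rightarrow> 'b ppoint set set" where
  "irreducible_components A Y =
    {Z. Z \<subseteq> Y \<and> zariski_irreducible A Z \<and>
        (\<forall>Z'. Z \<subseteq> Z' \<longrightarrow> Z' \<subseteq> Y \<longrightarrow> zariski_irreducible A Z' \<longrightarrow> Z' = Z)}"

text \<open>For an injective \<open>g :: 'a \<Rightarrow> 'b\<close> and \<open>B \<subseteq> range g\<close> this embeds \<open>proj_space B\<close> into
  \<open>proj_space UNIV\<close> as a coordinate subspace: coordinate \<open>g a\<close> becomes coordinate \<open>a\<close>, and the
  coordinates \<open>a\<close> with \<open>g a \<notin> B\<close> are \<open>0\<close>.\<close>

definition coord_embed :: "('a \<Rightarrow> 'b) \<Rightarrow> 'b ppoint \<Rightarrow> 'a ppoint" where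
  "coord_embed g l = (\<lambda>x. x \<circ> g) ` l"

definition hibi_variety :: "'b::distrib_lattice set \<Rightarrow> 'b ppoint set" where
  "hibi_variety M = proj_zeros M (hibi_ideal M)"

definition face_variety :: "(real ^ 'a::{finite,distrib_lattice}) set \<Rightarrow> 'a ppoint set" where
  "face_variety F = proj_zeros UNIV (face_ideal F)"

definition lattice_points :: "(real ^ 'a::finite) set \<Rightarrow> (real ^ 'a) set" where
  "lattice_points Q = {m \<in> Q. \<forall>i. m $ i \<in> \<int>}"

text \<open>The toric variety of a lattice polytope \<open>Q\<close>, embedded by the characters given by the lattice
  points of \<open>Q\<close>. It is the toric variety of the normal fan of \<open>Q\<close> when \<open>Q\<close> is very ample, as order
  polytopes are. Coordinates \<open>i\<close> in which \<open>Q\<close> is identically \<open>0\<close> do not contribute.\<close>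

definition toric_variety :: "(real ^ 'a::finite) set \<Rightarrow> (real ^ 'a) ppoint set" where
  "toric_variety Q = zariski_closure (lattice_points Q)
    {proj_point (\<lambda>m. if m \<in> lattice_points Q then \<Prod>i\<in>UNIV. t i powi \<lfloor>m $ i\<rfloor> else 0) | t.
      \<forall>i. t i \<noteq> 0}"

end

theory Submission
  imports Defs "HOL-Computational_Algebra.Polynomial"
begin

text \<open>
  The cone \<open>K\<close> is the cone of supermodular functions \<open>w\<close>.  A linear extension of the join-irreducibles is a
  maximal chain of the lattice, and the affine function that agrees with \<open>w\<close> on this chain dominates
  \<open>w\<close> everywhere, by supermodularity.  Hence these affine functions cut out the bounded facets of the
  polyhedron defining \<open>\<Theta>(w)\<close>, and the part given by a chain is the hull of the vertices \<open>v\<^sub>a\<close> for \<open>a\<close> in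
  the \<open>cell\<close> where \<open>w\<close> equals the affine function.  A cell is a sublattice containing a maximal chain,
  hence the lattice of ideals of an order on the join-irreducibles.

  Every monomial straightens to a unique chain monomial with the same toric image, and its weight does not
  decrease on the way if \<open>w\<close> lies in \<open>K\<close>.  Call a monomial tight if the weight does not change.  Then
  the initial ideal is spanned by the monomials that are not tight and by the differences of tight
  monomials and their straightenings.  A point of its zero set has its support in a cell and satisfies the Hibi
  relations there, so the zero set is the union of the Hibi varieties of the cells.

  Both the cells and the set of tight monomials are described by equality in linear inequalities that
  are valid on \<open>K\<close>, and are therefore constant on the relative interior of a face.
\<close>

section \<open>Birkhoff duality and straightening of monomials\<close>

text \<open>Ideal membership is turned into linear algebra. A polynomial lies in the Hibi ideal iff
  its coefficients sum to zero over every fibre of the toric parametrisation, and for a supermodular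
  weight the initial ideal is cut out by the same sums restricted to tight monomials.

  The squared rank \<open>(card (birkhoff a))\<^sup>2\<close> is strictly supermodular. It appears
  twice: as the potential that makes straightening stop, and as the perturbation that puts every
  supermodular function into the closure defining the cone.

  Irreducibility of a Hibi variety is reduced to one variable: for two polynomials, neither
  vanishing on the whole variety, a substitution \<open>t p = z ^ N p\<close> turns both into
  nonzero polynomials in \<open>z\<close>, which have a common non-root. The same argument gives
  density of the torus.

  That the pieces are maximal is read off from supports: a Hibi variety contains a point whose
  support is the whole cell, and no cell properly contains another, because an affine function is
  determined by its values on one maximal chain.\<close>

lemma less_finite_induct [case_names less]:
  fixes a :: "'a::{finite,order}"
  assumes "\<And>a. (\<And>b. b < a \<Longrightarrow> P b) \<Longrightarrow> P a"
  shows "P a"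
proof (induction "card {x. x < a}" arbitrary: a rule: less_induct)
  case less
  show ?case
  proof (rule assms)
    fix b assume "b < a"
    then have "{x. x < b} \<subset> {x. x < a}" by auto
    then show "P b" by (intro less psubset_card_mono) auto
  qed
qed

section \<open>Join primes and Birkhoff's representation\<close>

definition least_elem :: "'a::{finite,distrib_lattice}" where
  "least_elem = Inf_fin UNIV"

lemma least_elem_le [simp]: "least_elem \<le> a"
  by (simp add: least_elem_def Inf_fin.coboundedI)

text \<open>The least element is join prime although it is not join-irreducible. Keeping it among
  the primes supplies the homogenising coordinate: the degree of a monomial becomes one more height,
  and the overall scalar of a projective point one more torus parameter.\<close>

definition join_primes :: "'a::distrib_lattice set" where
  "join_primes = {p. \<forall>a b. p \<le> sup a b \<longrightarrow> p \<le> a \<or> p \<le> b}"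

lemma join_irreducibles_subset: "join_irreducibles \<subseteq> join_primes"
proof
  fix p :: 'a assume p: "p \<in> join_irreducibles"
  have "p \<le> a \<or> p \<le> b" if "p \<le> sup a b" for a b
  proof -
    have "p = sup (inf p a) (inf p b)" using that by (simp add: inf_absorb1 flip: inf_sup_distrib1)
    then have "p = inf p a \<or> p = inf p b" using p unfolding join_irreducibles_def by blast
    then show ?thesis by (metis inf.cobounded2)
  qed
  then show "p \<in> join_primes" unfolding join_primes_def by blast
qed

lemma least_elem_join_prime: "least_elem \<in> join_primes"
  by (simp add: join_primes_def)

lemma join_primes_eq:
  "join_primes = insert least_elem (join_irreducibles :: 'a::{finite,distrib_lattice} set)"
proof -
  have "p = least_elem \<or> p \<in> join_irreducibles" if "p \<in> join_primes" for p :: 'a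
  proof (cases "\<exists>b. b < p")
    case False
    then show ?thesis by (metis least_elem_le order_le_less)
  next
    case True
    have "p = b \<or> p = c" if "p = sup b c" for b c
      using \<open>p \<in> join_primes\<close> that unfolding join_primes_def
      by (metis (no_types, lifting) mem_Collect_eq order.antisym order.refl sup.cobounded1 sup.cobounded2)
    then show ?thesis using True unfolding join_irreducibles_def by blast
  qed
  then show ?thesis
    using join_irreducibles_subset least_elem_join_prime by blast
qed

lemma least_elem_not_join_irreducible:
  "(least_elem :: 'a::{finite,distrib_lattice}) \<notin> join_irreducibles"
  unfolding join_irreducibles_def using least_elem_le by (auto simp: less_le_not_le)

lemma le_sup_iff_join_prime: "p \<in> join_primes \<Longrightarrow> p \<le> sup a b \<longleftrightarrow> p \<le> a \<or> p \<le> b"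
  unfolding join_primes_def by (auto intro: le_supI1 le_supI2)

lemma birkhoff_sup: "birkhoff (sup a b) = birkhoff a \<union> birkhoff b"
  unfolding birkhoff_def using le_sup_iff_join_prime join_irreducibles_subset by blast

lemma birkhoff_inf: "birkhoff (inf a b) = birkhoff a \<inter> birkhoff b"
  unfolding birkhoff_def by auto

lemma birkhoff_least: "birkhoff (least_elem :: 'a::{finite,distrib_lattice}) = {}"
  unfolding birkhoff_def using least_elem_not_join_irreducible
  by (auto dest: order.antisym[OF least_elem_le])

text \<open>An element that is not join prime is the join of two strictly smaller elements: if
  \<open>a \<le> sup c d\<close> but \<open>a\<close> is below neither, distributivity gives
  \<open>a = sup (inf a c) (inf a d)\<close>. Induction thus reduces the claim to join primes, and
  these belong to their own ideal unless they are the least element.\<close>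

lemma birkhoff_subset_iff:
  "birkhoff a \<subseteq> birkhoff b \<longleftrightarrow> a \<le> (b :: 'a::{finite,distrib_lattice})"
proof
  assume "birkhoff a \<subseteq> birkhoff b"
  then show "a \<le> b"
  proof (induction a rule: less_finite_induct)
    case (less a)
    consider "a = least_elem" | "a \<in> join_irreducibles" | "a \<notin> join_primes"
      using join_primes_eq by blast
    then show ?case
    proof cases
      case 1 then show ?thesis by simp
    next
      case 2 then show ?thesis using less.prems by (auto simp: birkhoff_def)
    next
      case 3
      then obtain c d where cd: "a \<le> sup c d" "\<not> a \<le> c" "\<not> a \<le> d"
        by (auto simp: join_primes_def)
      have a: "a = sup (inf a c) (inf a d)"
        using cd(1) by (simp add: inf_absorb1 flip: inf_sup_distrib1)
      have lt: "inf a c < a" "inf a d < a"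
        using cd by (auto simp: less_le) (metis inf.cobounded2)+
      have "birkhoff (inf a c) \<subseteq> birkhoff b" "birkhoff (inf a d) \<subseteq> birkhoff b"
        using less.prems by (auto simp: birkhoff_inf)
      then have "inf a c \<le> b" "inf a d \<le> b" using less.IH lt by blast+
      then show ?thesis using a by (metis le_sup_iff)
    qed
  qed
qed (auto simp: birkhoff_def)

lemma inj_birkhoff: "inj (birkhoff :: 'a::{finite,distrib_lattice} \<Rightarrow> _)"
  by (rule injI) (metis birkhoff_subset_iff order.antisym order.refl)

lemma birkhoff_subset: "birkhoff a \<subseteq> join_irreducibles"
  by (auto simp: birkhoff_def)

lemma birkhoff_order_ideal: "birkhoff a \<in> order_ideals join_irreducibles (<)"
  by (auto simp: birkhoff_def order_ideals_def)

text \<open>\<open>D\<close> is represented by its join: a join-irreducible below the join lies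
  below a member, hence in \<open>D\<close>.\<close>

lemma order_ideal_birkhoff:
  assumes "D \<in> order_ideals (join_irreducibles :: 'a::{finite,distrib_lattice} set) (<)"
  shows "\<exists>a. birkhoff a = D"
proof -
  have "\<exists>a. birkhoff a = {p \<in> join_irreducibles. \<exists>d\<in>D. p \<le> d}" if "finite D" for D :: "'a set"
    using that
  proof induction
    case empty
    then show ?case using birkhoff_least by auto
  next
    case (insert d D)
    then obtain a where "birkhoff a = {p \<in> join_irreducibles. \<exists>d\<in>D. p \<le> d}" by blast
    then have "birkhoff (sup d a) = {p \<in> join_irreducibles. \<exists>d\<in>insert d D. p \<le> d}"
      by (auto simp: birkhoff_sup) (auto simp: birkhoff_def)
    then show ?case by blast
  qed
  from this[of D] obtain a where "birkhoff a = {p \<in> join_irreducibles. \<exists>d\<in>D. p \<le> d}" by auto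
  also have "\<dots> = D" using assms by (auto simp: order_ideals_def order.order_iff_strict)
  finally show ?thesis by blast
qed

text \<open>With \<open>x\<close>, \<open>y\<close>, \<open>z\<close> the sizes of the two
  differences and of the intersection, the sides differ by \<open>2 * x * y\<close>, and
  incomparability makes \<open>x\<close> and \<open>y\<close> positive.\<close>

lemma card_birkhoff_supermodular:
  fixes a b :: "'a::{finite,distrib_lattice}"
  assumes "\<not> a \<le> b" "\<not> b \<le> a"
  shows "(card (birkhoff a))\<^sup>2 + (card (birkhoff b))\<^sup>2
    < (card (birkhoff (sup a b)))\<^sup>2 + (card (birkhoff (inf a b)))\<^sup>2"
proof -
  let ?A = "birkhoff a" and ?B = "birkhoff b"
  define x y z where "x = card (?A - ?B)" "y = card (?B - ?A)" "z = card (?A \<inter> ?B)"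
  have "card ?A = x + z" "card ?B = y + z"
    using card_Int_Diff[of ?A ?B] card_Int_Diff[of ?B ?A]
    by (auto simp: x_y_z_def Int_commute)
  moreover have "card (?A \<union> ?B) = x + y + z"
    using card_Un_Int[of ?A ?B] calculation by (auto simp: x_y_z_def)
  moreover have "x > 0" "y > 0"
    using assms birkhoff_subset_iff[of a b] birkhoff_subset_iff[of b a]
    unfolding x_y_z_def card_gt_0_iff by auto
  ultimately show ?thesis
    by (simp add: birkhoff_sup birkhoff_inf flip: x_y_z_def(3)) (simp add: power2_eq_square algebra_simps)
qed

text \<open>Monomials are the exponent vectors \<open>'a \<Rightarrow>\<^sub>0 nat\<close>.  Two monomials have the same image under the toric
  parametrisation \<open>X\<^sub>a \<mapsto> \<Prod> {t\<^sub>p | p \<le> a}\<close> iff all their \<open>height\<close>s at join primes agree; the height at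
  the least element is the degree.\<close>

definition height :: "('a::{finite,distrib_lattice} \<Rightarrow>\<^sub>0 nat) \<Rightarrow> 'a \<Rightarrow> nat" where
  "height m p = (\<Sum>a | p \<le> a. Poly_Mapping.lookup m a)"

abbreviation mvar :: "'b \<Rightarrow> 'b \<Rightarrow>\<^sub>0 nat" where
  "mvar a \<equiv> Poly_Mapping.single a (Suc 0)"

definition same_fiber :: "('a::{finite,distrib_lattice} \<Rightarrow>\<^sub>0 nat) \<Rightarrow> ('a \<Rightarrow>\<^sub>0 nat) \<Rightarrow> bool" where
  "same_fiber m n \<longleftrightarrow> (\<forall>p\<in>join_primes. height m p = height n p)"

section \<open>Straightening to chain monomials\<close>

definition chain_monomial :: "('a::{finite,distrib_lattice} \<Rightarrow>\<^sub>0 nat) \<Rightarrow> bool" where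
  "chain_monomial m \<longleftrightarrow> (\<forall>a\<in>Poly_Mapping.keys m. \<forall>b\<in>Poly_Mapping.keys m. a \<le> b \<or> b \<le> a)"

text \<open>The Hibi binomials oriented towards the comparable pair, with \<open>k\<close> as the
  untouched cofactor. Comparable pairs are excluded, since for them the step would change nothing
  and rewriting would not terminate.\<close>

inductive swap :: "('a::{finite,distrib_lattice} \<Rightarrow>\<^sub>0 nat) \<Rightarrow> ('a \<Rightarrow>\<^sub>0 nat) \<Rightarrow> bool" where
  "\<not> a \<le> b \<Longrightarrow> \<not> b \<le> a \<Longrightarrow> swap (k + mvar a + mvar b) (k + mvar (sup a b) + mvar (inf a b))"

lemma height_add [simp]: "height (m + n) p = height m p + height n p"
  by (simp add: height_def lookup_add sum.distrib)

lemma height_mvar [simp]: "height (mvar a) p = of_bool (p \<le> a)"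
  by (simp add: height_def lookup_single when_def)

lemma height_pos_iff: "0 < height m p \<longleftrightarrow> (\<exists>a\<in>Poly_Mapping.keys m. p \<le> a)"
  unfolding height_def neq0_conv[symmetric] by (auto simp: in_keys_iff)

lemma swap_same_fiber: "swap m n \<Longrightarrow> same_fiber m n"
  by (induction rule: swap.induct) (auto simp: same_fiber_def le_sup_iff_join_prime)

lemma mvar_factor2:
  fixes m :: "'b \<Rightarrow>\<^sub>0 nat"
  assumes "a \<in> Poly_Mapping.keys m" "b \<in> Poly_Mapping.keys m" "a \<noteq> b"
  shows "\<exists>k. m = k + mvar a + mvar b"
  by (rule exI[of _ "m - mvar a - mvar b"], rule poly_mapping_eqI)
    (use assms in \<open>auto simp: lookup_add lookup_minus lookup_single when_def in_keys_iff\<close>)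

lemma ex_swap: "\<not> chain_monomial m \<Longrightarrow> \<exists>n. swap m n"
  unfolding chain_monomial_def using mvar_factor2 swap.intros by (metis order.refl)

lemma straightening: "\<exists>n. swap\<^sup>*\<^sup>* m n \<and> chain_monomial n"
proof -
  define N where "N = card (UNIV :: 'a set)"
  \<comment> \<open>The squared rank grows under a swap. Subtracting it from the bound
    \<open>N\<^sup>2\<close> gives a natural number for each variable, so that the total
    \<open>f\<close> falls.\<close>
  define q where "q = (\<lambda>a::'a. N\<^sup>2 - (card (birkhoff a))\<^sup>2)"
  define f where "f = (\<lambda>m. \<Sum>a\<in>UNIV. Poly_Mapping.lookup m a * q a)"
  have f_add: "f (m + n) = f m + f n" for m n
    by (simp add: f_def lookup_add sum.distrib algebra_simps)
  have f_mvar: "f (mvar a) = q a" for a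
    by (simp add: f_def lookup_single when_def if_distrib[where f = "\<lambda>x. x * _"] cong: if_cong)
  have "f n < f m" if "swap m n" for m n
    using that
  proof induction
    case (1 a b k)
    have le: "(card (birkhoff x))\<^sup>2 \<le> N\<^sup>2" for x :: 'a
      by (simp add: N_def card_mono)
    have "q (sup a b) + q (inf a b) < q a + q b"
      using card_birkhoff_supermodular[OF 1] le[of a] le[of b] le[of "sup a b"] le[of "inf a b"]
      unfolding q_def by linarith
    then show ?case by (simp add: f_add f_mvar)
  qed
  then show ?thesis
  proof (induction "f m" arbitrary: m rule: less_induct)
    case less
    show ?case
    proof (cases "chain_monomial m")
      case False
      then obtain m' where "swap m m'" using ex_swap by blast
      with less show ?thesis by (meson converse_rtranclp_into_rtranclp)
    qed blast
  qed
qed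

text \<open>The largest variable of a chain monomial can be read off from the heights: its ideal
  consists of the join-irreducibles of positive height. Both monomials therefore share it, and
  cancelling it lowers the degree, which is the height at \<open>least_elem\<close>.\<close>

lemma chain_monomial_unique:
  assumes "chain_monomial m" "chain_monomial n" "same_fiber m n"
  shows "m = n"
  using assms
proof (induction "height m least_elem" arbitrary: m n rule: less_induct)
  case less
  have deg: "height m least_elem = height n least_elem"
    using less.prems(3) least_elem_join_prime by (auto simp: same_fiber_def)
  have zero: "k = 0" if "height k least_elem = 0" for k :: "'a \<Rightarrow>\<^sub>0 nat"
    using that by (intro poly_mapping_eqI) (simp add: height_def)
  have top: "\<exists>a\<in>Poly_Mapping.keys k. birkhoff a = {p\<in>join_irreducibles. height k p > 0}"
    if "chain_monomial k" "k \<noteq> 0" for k :: "'a \<Rightarrow>\<^sub>0 nat"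
  proof -
    have "finite (Poly_Mapping.keys k)" "Poly_Mapping.keys k \<noteq> {}" using that by auto
    then obtain a where a: "a \<in> Poly_Mapping.keys k" "\<And>b. b \<in> Poly_Mapping.keys k \<Longrightarrow> a \<le> b \<Longrightarrow> a = b"
      using finite_has_maximal by metis
    then have "b \<le> a" if "b \<in> Poly_Mapping.keys k" for b
      using \<open>chain_monomial k\<close> that unfolding chain_monomial_def by blast
    then have "birkhoff a = {p\<in>join_irreducibles. height k p > 0}"
      using a(1) by (auto simp: birkhoff_def height_pos_iff intro: order.trans)
    with a show ?thesis by blast
  qed
  show ?case
  proof (cases "m = 0")
    case True
    then show ?thesis using zero[of n] deg by (simp add: height_def)
  next
    case False
    then have "n \<noteq> 0" using zero[of m] deg by (auto simp: height_def)
    obtain a b where a: "a \<in> Poly_Mapping.keys m" "birkhoff a = {p\<in>join_irreducibles. height m p > 0}"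
      and b: "b \<in> Poly_Mapping.keys n" "birkhoff b = {p\<in>join_irreducibles. height n p > 0}"
      using top[OF less.prems(1) False] top[OF less.prems(2) \<open>n \<noteq> 0\<close>] by blast
    have "birkhoff a = birkhoff b"
      unfolding a(2) b(2) using less.prems(3) join_irreducibles_subset
      by (auto simp: same_fiber_def subset_iff)
    then have [simp]: "b = a" using injD[OF inj_birkhoff] by metis
    define m' n' where mn': "m' = m - mvar a" "n' = n - mvar a"
    have mn: "m = m' + mvar a" "n = n' + mvar a"
      using a(1) b(1) unfolding mn'
      by (auto intro!: poly_mapping_eqI simp: lookup_add lookup_minus lookup_single when_def in_keys_iff)
    have "Poly_Mapping.keys m' \<subseteq> Poly_Mapping.keys m" "Poly_Mapping.keys n' \<subseteq> Poly_Mapping.keys n"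
      unfolding mn' by (auto simp: in_keys_iff lookup_minus)
    then have "chain_monomial m'" "chain_monomial n'"
      using less.prems unfolding chain_monomial_def by blast+
    moreover have "same_fiber m' n'" using less.prems(3) unfolding mn by (simp add: same_fiber_def)
    moreover have "height m' least_elem < height m least_elem" unfolding mn by simp
    ultimately have "m' = n'" using less.hyps by blast
    then show ?thesis using mn by simp
  qed
qed

text \<open>The choice is immaterial: swaps preserve the fibre, and a fibre contains only one chain
  monomial. So this is the normal form of the whole fibre.\<close>

definition std :: "('a::{finite,distrib_lattice} \<Rightarrow>\<^sub>0 nat) \<Rightarrow> ('a \<Rightarrow>\<^sub>0 nat)" where
  "std m = (SOME n. swap\<^sup>*\<^sup>* m n \<and> chain_monomial n)"

lemma swap_std: "swap\<^sup>*\<^sup>* m (std m)" and chain_std: "chain_monomial (std m)"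
  using someI_ex[OF straightening[of m]] unfolding std_def by blast+

lemma same_fiber_std: "same_fiber m (std m)"
proof -
  have "same_fiber m n" if "swap\<^sup>*\<^sup>* m n" for n
    using that by induction (use swap_same_fiber in \<open>fastforce simp: same_fiber_def\<close>)+
  then show ?thesis using swap_std by blast
qed

lemma std_eq_iff: "std m = std n \<longleftrightarrow> same_fiber m n"
proof
  assume "same_fiber m n"
  then have "same_fiber (std m) (std n)"
    using same_fiber_std[of m] same_fiber_std[of n] by (auto simp: same_fiber_def)
  then show "std m = std n" using chain_monomial_unique chain_std by blast
qed (use same_fiber_std[of m] same_fiber_std[of n] in \<open>auto simp: same_fiber_def\<close>)

lemma std_chain: "chain_monomial m \<Longrightarrow> std m = m"
  using chain_monomial_unique chain_std same_fiber_std by metis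

lemma std_std [simp]: "std (std m) = std m"
  by (simp add: std_chain chain_std)

lemma std_pair: "std (mvar a + mvar b) = mvar (sup a b) + mvar (inf a b)"
proof -
  have "x = sup a b \<or> x = inf a b" if "x \<in> Poly_Mapping.keys (mvar (sup a b) + mvar (inf a b))" for x
    using that keys_add[of "mvar (sup a b)" "mvar (inf a b)"] by auto
  moreover have "inf a b \<le> sup a b" by (rule le_infI1) simp
  ultimately have "chain_monomial (mvar (sup a b) + mvar (inf a b))"
    unfolding chain_monomial_def by (metis order.refl)
  moreover have "same_fiber (mvar a + mvar b) (mvar (sup a b) + mvar (inf a b))"
    by (auto simp: same_fiber_def le_sup_iff_join_prime)
  ultimately show ?thesis using std_eq_iff std_chain by metis
qed

section \<open>Initial ideals of the Hibi ideal\<close>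

definition mon :: "('b \<Rightarrow> complex) \<Rightarrow> ('b \<Rightarrow>\<^sub>0 nat) \<Rightarrow> complex" where
  "mon x m = (\<Prod>i\<in>Poly_Mapping.keys m. x i ^ Poly_Mapping.lookup m i)"

text \<open>The linear functional with prescribed values \<open>h\<close> on monomials. Two kinds
  matter most: \<open>h = mon x\<close> is evaluation at \<open>x\<close>, and an indicator function
  sums the coefficients over a set of monomials, such as a fibre.\<close>

definition lin :: "('m \<Rightarrow> complex) \<Rightarrow> ('m \<Rightarrow>\<^sub>0 complex) \<Rightarrow> complex" where
  "lin h f = (\<Sum>m\<in>Poly_Mapping.keys f. Poly_Mapping.lookup f m * h m)"

lemma lin_superset:
  "finite A \<Longrightarrow> Poly_Mapping.keys f \<subseteq> A \<Longrightarrow> lin h f = (\<Sum>m\<in>A. Poly_Mapping.lookup f m * h m)"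
  unfolding lin_def by (rule sum.mono_neutral_left) (auto simp: in_keys_iff)

lemma lin_zero [simp]: "lin h 0 = 0"
  by (simp add: lin_def)

lemma lin_single [simp]: "lin h (Poly_Mapping.single m c) = c * h m"
  by (simp add: lin_def)

lemma lin_add [simp]: "lin h (f + g) = lin h f + lin h g"
proof -
  let ?A = "Poly_Mapping.keys f \<union> Poly_Mapping.keys g"
  have "lin h (f + g) = (\<Sum>m\<in>?A. Poly_Mapping.lookup (f + g) m * h m)"
    by (rule lin_superset) (use keys_add[of f g] in auto)
  also have "\<dots> = (\<Sum>m\<in>?A. Poly_Mapping.lookup f m * h m) + (\<Sum>m\<in>?A. Poly_Mapping.lookup g m * h m)"
    by (simp add: lookup_add algebra_simps sum.distrib)
  also have "\<dots> = lin h f + lin h g"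
    by (intro arg_cong2[where f = "(+)"] lin_superset[symmetric]) auto
  finally show ?thesis .
qed

lemma lin_diff [simp]: "lin h (f - g) = lin h f - lin h g"
proof -
  have "lin h f = lin h ((f - g) + g)" by simp
  then show ?thesis unfolding lin_add by simp
qed

lemma lin_sum: "lin h (\<Sum>i\<in>A. f i) = (\<Sum>i\<in>A. lin h (f i))"
  by (induction A rule: infinite_finite_induct) auto

lemma sum_singles: "(\<Sum>m\<in>Poly_Mapping.keys f. Poly_Mapping.single m (Poly_Mapping.lookup f m)) = f"
  by (rule poly_mapping_eqI) (auto simp: lookup_sum lookup_single when_def in_keys_iff)

lemma lin_single_mult:
  fixes f :: "'m::monoid_add \<Rightarrow>\<^sub>0 complex"
  shows "lin h (Poly_Mapping.single k c * f) = c * lin (\<lambda>m. h (k + m)) f"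
proof -
  have "lin h (Poly_Mapping.single k c * f)
      = lin h (\<Sum>m\<in>Poly_Mapping.keys f. Poly_Mapping.single (k + m) (c * Poly_Mapping.lookup f m))"
    by (subst (1) sum_singles[of f, symmetric]) (simp add: sum_distrib_left mult_single)
  also have "\<dots> = c * lin (\<lambda>m. h (k + m)) f"
    unfolding lin_sum lin_single by (simp add: lin_def sum_distrib_left algebra_simps)
  finally show ?thesis .
qed

lemma mon_superset:
  "finite A \<Longrightarrow> Poly_Mapping.keys m \<subseteq> A \<Longrightarrow> mon x m = (\<Prod>i\<in>A. x i ^ Poly_Mapping.lookup m i)"
  unfolding mon_def by (rule prod.mono_neutral_left) (auto simp: in_keys_iff)

lemma mon_zero [simp]: "mon x 0 = 1"
  by (simp add: mon_def)

lemma mon_mvar [simp]: "mon x (mvar a) = x a"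
  by (simp add: mon_def)

lemma mon_add [simp]: "mon x (m + n) = mon x m * mon x n"
proof -
  let ?A = "Poly_Mapping.keys m \<union> Poly_Mapping.keys n"
  have "mon x (m + n) = (\<Prod>i\<in>?A. x i ^ Poly_Mapping.lookup (m + n) i)"
    by (rule mon_superset) (use keys_add[of m n] in auto)
  also have "\<dots> = (\<Prod>i\<in>?A. x i ^ Poly_Mapping.lookup m i) * (\<Prod>i\<in>?A. x i ^ Poly_Mapping.lookup n i)"
    by (simp add: lookup_add power_add prod.distrib)
  also have "\<dots> = mon x m * mon x n"
    by (intro arg_cong2[where f = "(*)"] mon_superset[symmetric]) auto
  finally show ?thesis .
qed

lemma cpoly_eval_lin: "cpoly_eval p x = lin (mon x) p"
  by (simp add: cpoly_eval_def lin_def mon_def)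

lemma cpoly_eval_zero [simp]: "cpoly_eval 0 x = 0"
  and cpoly_eval_add [simp]: "cpoly_eval (p + q) x = cpoly_eval p x + cpoly_eval q x"
  and cpoly_eval_diff [simp]: "cpoly_eval (p - q) x = cpoly_eval p x - cpoly_eval q x"
  and cpoly_eval_single [simp]: "cpoly_eval (Poly_Mapping.single m c) x = c * mon x m"
  and cpoly_eval_sum [simp]: "cpoly_eval (\<Sum>i\<in>A. f i) x = (\<Sum>i\<in>A. cpoly_eval (f i) x)"
  by (simp_all add: cpoly_eval_lin lin_sum)

lemma cpoly_eval_Xvar [simp]: "cpoly_eval (Xvar a) x = x a"
  by (simp add: Xvar_def)

lemma cpoly_eval_one [simp]: "cpoly_eval 1 x = 1"
  using cpoly_eval_single[of 0 1 x] by simp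

lemma cpoly_eval_mult [simp]: "cpoly_eval (p * q) x = cpoly_eval p x * cpoly_eval q x"
proof -
  have "cpoly_eval (p * q) x
      = (\<Sum>m\<in>Poly_Mapping.keys p. cpoly_eval (Poly_Mapping.single m (Poly_Mapping.lookup p m) * q) x)"
    by (subst (1) sum_singles[of p, symmetric]) (simp add: sum_distrib_right)
  also have "\<dots> = (\<Sum>m\<in>Poly_Mapping.keys p. Poly_Mapping.lookup p m * mon x m * cpoly_eval q x)"
    by (simp add: cpoly_eval_lin lin_single_mult) (simp add: lin_def sum_distrib_left algebra_simps)
  also have "\<dots> = cpoly_eval p x * cpoly_eval q x"
    by (simp add: cpoly_eval_lin lin_def sum_distrib_right)
  finally show ?thesis .
qed

lemma cpoly_eval_prod [simp]: "cpoly_eval (\<Prod>i\<in>A. f i) x = (\<Prod>i\<in>A. cpoly_eval (f i) x)"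
  by (induction A rule: infinite_finite_induct) auto

lemma cpoly_eval_power [simp]: "cpoly_eval (p ^ n) x = cpoly_eval p x ^ n"
  by (induction n) auto

lemma module_mult: "module ((*) :: 'r::comm_ring_1 \<Rightarrow> 'r \<Rightarrow> 'r)"
  by unfold_locales (auto simp: algebra_simps)

lemma module_const_mult: "module (\<lambda>c (p :: 'b cpoly). Poly_Mapping.single 0 c * p)"
  by unfold_locales (auto simp: algebra_simps single_add mult_single)

text \<open>Modulo \<open>V\<close>, a monomial outside \<open>T\<close> is zero and one inside
  equals \<open>s m\<close>, so \<open>f\<close> is congruent to a combination of normal forms whose
  coefficients are exactly the functionals assumed to vanish. Multiplication is asked of
  \<open>V\<close> for constants only, so that the lemma serves ideals, linear spans of initial
  forms and kernels of evaluations alike.\<close>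

lemma fiber_sum_decomposition:
  fixes f :: "'b cpoly"
  assumes zero: "0 \<in> V" and add: "\<And>f g. f \<in> V \<Longrightarrow> g \<in> V \<Longrightarrow> f + g \<in> V"
    and scale: "\<And>c f. f \<in> V \<Longrightarrow> Poly_Mapping.single 0 c * f \<in> V"
    and out: "\<And>m. \<not> T m \<Longrightarrow> Poly_Mapping.single m 1 \<in> V"
    and inside: "\<And>m. T m \<Longrightarrow> Poly_Mapping.single m 1 - Poly_Mapping.single (s m) 1 \<in> V"
    and f: "\<And>n. lin (\<lambda>m. of_bool (T m \<and> s m = n)) f = 0"
  shows "f \<in> V"
proof -
  let ?c = "Poly_Mapping.lookup f" and ?K = "Poly_Mapping.keys f"
  let ?b = "\<lambda>m. Poly_Mapping.single 0 (?c m) *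
    (Poly_Mapping.single m 1 - (if T m then Poly_Mapping.single (s m) 1 else 0))"
  have sumV: "(\<Sum>i\<in>A. g i) \<in> V" if "\<And>i. i \<in> A \<Longrightarrow> g i \<in> V" for A and g :: "_ \<Rightarrow> 'b cpoly"
    using that by (induction A rule: infinite_finite_induct) (auto intro: zero add)
  have "(\<Sum>m\<in>?K. if T m then Poly_Mapping.single (s m) (?c m) else 0) = 0" (is "?r = 0")
  proof (rule poly_mapping_eqI)
    fix n
    have "Poly_Mapping.lookup ?r n = lin (\<lambda>m. of_bool (T m \<and> s m = n)) f"
      unfolding lin_def lookup_sum by (rule sum.cong) (auto simp: lookup_single when_def)
    then show "Poly_Mapping.lookup ?r n = Poly_Mapping.lookup 0 n" using f by simp
  qed
  then have "f = (\<Sum>m\<in>?K. Poly_Mapping.single m (?c m)) - ?r"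
    using sum_singles[of f] by simp
  also have "\<dots> = (\<Sum>m\<in>?K. ?b m)"
    unfolding sum_subtractf[symmetric] by (rule sum.cong) (auto simp: mult_single algebra_simps)
  also have "\<dots> \<in> V"
    by (rule sumV, rule scale) (auto intro: out inside)
  finally show ?thesis .
qed

section \<open>The Hibi ideal as a toric ideal\<close>

lemma Xvar_mult: "Xvar a * Xvar b = Poly_Mapping.single (mvar a + mvar b) 1"
  by (simp add: Xvar_def mult_single)

lemma single_diff_mem_hibi_ideal:
  "Poly_Mapping.single m 1 - Poly_Mapping.single (std m) 1 \<in> hibi_ideal UNIV"
proof -
  interpret module "(*) :: 'a cpoly \<Rightarrow> 'a cpoly \<Rightarrow> 'a cpoly" by (rule module_mult)
  have *: "Poly_Mapping.single m 1 - Poly_Mapping.single n 1 \<in> hibi_ideal UNIV"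
    if "swap m n" for m n :: "'a \<Rightarrow>\<^sub>0 nat"
    using that
  proof induction
    case (1 a b k)
    have "Xvar a * Xvar b - Xvar (sup a b) * Xvar (inf a b) \<in> hibi_ideal UNIV"
      unfolding hibi_ideal_def ideal_generated_def by (rule span_base) blast
    then have "Poly_Mapping.single k 1 * (Xvar a * Xvar b - Xvar (sup a b) * Xvar (inf a b))
        \<in> hibi_ideal UNIV"
      unfolding hibi_ideal_def ideal_generated_def by (rule span_scale)
    then show ?case by (simp add: Xvar_mult right_diff_distrib mult_single add.assoc)
  qed
  have "Poly_Mapping.single m 1 - Poly_Mapping.single n 1 \<in> hibi_ideal UNIV" if "swap\<^sup>*\<^sup>* m n" for n
    using that
  proof induction
    case base
    show ?case unfolding hibi_ideal_def ideal_generated_def by (simp add: span_zero)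
  next
    case (step n n')
    have "(Poly_Mapping.single m 1 - Poly_Mapping.single n 1)
        + (Poly_Mapping.single n 1 - Poly_Mapping.single n' 1) \<in> hibi_ideal UNIV"
      using step.IH *[OF step.hyps(2)] unfolding hibi_ideal_def ideal_generated_def by (rule span_add)
    then show ?case by simp
  qed
  then show ?thesis using swap_std by blast
qed

lemma hibi_ideal_lin:
  assumes "f \<in> hibi_ideal UNIV" and h: "\<And>m. h (std m) = h m"
  shows "lin h f = 0"
proof -
  interpret module "(*) :: 'a cpoly \<Rightarrow> 'a cpoly \<Rightarrow> 'a cpoly" by (rule module_mult)
  \<comment> \<open>All fibre-constant \<open>h\<close> are treated at once: multiplying by a
    monomial \<open>k\<close> replaces \<open>h\<close> by \<open>\<lambda>m. h (k + m)\<close>,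
    which is again fibre-constant, so \<open>V\<close> is closed under multiplication.\<close>
  define V :: "'a cpoly set" where "V = {f. \<forall>h. (\<forall>m. h (std m) = h m) \<longrightarrow> lin h f = 0}"
  have gen: "Xvar a * Xvar b - Xvar (sup a b) * Xvar (inf a b) \<in> V" for a b
    unfolding V_def
  proof (safe)
    fix h :: "('a \<Rightarrow>\<^sub>0 nat) \<Rightarrow> complex" assume h: "\<forall>m. h (std m) = h m"
    have "same_fiber (mvar a + mvar b) (mvar (sup a b) + mvar (inf a b))"
      by (auto simp: same_fiber_def le_sup_iff_join_prime)
    then have "h (mvar a + mvar b) = h (mvar (sup a b) + mvar (inf a b))"
      using h std_eq_iff by metis
    then show "lin h (Xvar a * Xvar b - Xvar (sup a b) * Xvar (inf a b)) = 0"
      unfolding Xvar_mult by simp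
  qed
  have mult: "c * f \<in> V" if "f \<in> V" for c f
    unfolding V_def
  proof (safe)
    fix h :: "('a \<Rightarrow>\<^sub>0 nat) \<Rightarrow> complex" assume h: "\<forall>m. h (std m) = h m"
    have "lin (\<lambda>m. h (k + m)) f = 0" for k
    proof -
      have "h (k + std m) = h (k + m)" for m
      proof -
        have "same_fiber (k + std m) (k + m)"
          using same_fiber_std[of m] by (auto simp: same_fiber_def)
        then show ?thesis using h std_eq_iff by metis
      qed
      then show ?thesis using that unfolding V_def by simp
    qed
    then have "lin h (\<Sum>k\<in>Poly_Mapping.keys c. Poly_Mapping.single k (Poly_Mapping.lookup c k) * f) = 0"
      by (simp add: lin_sum lin_single_mult)
    then show "lin h (c * f) = 0"
      by (simp add: sum_singles flip: sum_distrib_right)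
  qed
  have "subspace V"
    unfolding subspace_def using mult by (simp add: V_def)
  then have "hibi_ideal UNIV \<subseteq> V"
    unfolding hibi_ideal_def ideal_generated_def using gen by (intro span_minimal) auto
  then show ?thesis using assms unfolding V_def by blast
qed

text \<open>Monomials share a normal form iff they share their toric image. The condition therefore
  says that the toric parametrisation kills \<open>f\<close>: the Hibi ideal is its kernel.\<close>

lemma hibi_ideal_iff:
  "f \<in> hibi_ideal UNIV \<longleftrightarrow> (\<forall>n. lin (\<lambda>m. of_bool (std m = n)) f = 0)"
proof
  interpret module "(*) :: 'a cpoly \<Rightarrow> 'a cpoly \<Rightarrow> 'a cpoly" by (rule module_mult)
  assume *: "\<forall>n. lin (\<lambda>m. of_bool (std m = n)) f = 0"
  show "f \<in> hibi_ideal UNIV"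
  proof (rule fiber_sum_decomposition[where T = "\<lambda>_. True" and s = std])
    show "Poly_Mapping.single m 1 - Poly_Mapping.single (std m) 1 \<in> hibi_ideal UNIV" for m :: "'a \<Rightarrow>\<^sub>0 nat"
      by (rule single_diff_mem_hibi_ideal)
  qed (use * in \<open>auto simp: hibi_ideal_def ideal_generated_def span_zero span_add span_scale\<close>)
qed (auto intro: hibi_ideal_lin)

section \<open>Supermodular weights and their initial ideals\<close>

definition supermodular :: "real ^ 'a::{finite,distrib_lattice} \<Rightarrow> bool" where
  "supermodular w \<longleftrightarrow> (\<forall>a b. w $ a + w $ b \<le> w $ sup a b + w $ inf a b)"

definition strictly_supermodular :: "real ^ 'a::{finite,distrib_lattice} \<Rightarrow> bool" where
  "strictly_supermodular w \<longleftrightarrow>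
    (\<forall>a b. \<not> a \<le> b \<longrightarrow> \<not> b \<le> a \<longrightarrow> w $ a + w $ b < w $ sup a b + w $ inf a b)"

lemma strictly_supermodular_imp: "strictly_supermodular w \<Longrightarrow> supermodular w"
  unfolding supermodular_def strictly_supermodular_def
  by (metis add.commute inf.absorb1 inf.absorb2 less_eq_real_def order.refl sup.absorb1 sup.absorb2)

lemma grad_add [simp]: "grad w (m + n) = grad w m + grad w n"
  by (simp add: grad_def lookup_add sum.distrib algebra_simps)

lemma grad_mvar [simp]: "grad w (mvar a) = w $ a"
  by (simp add: grad_def lookup_single when_def if_distrib[where f = "\<lambda>x. real x * _"] cong: if_cong)

lemma grad_swap: "supermodular w \<Longrightarrow> swap m n \<Longrightarrow> grad w m \<le> grad w n"
  by (erule swap.cases) (auto simp: supermodular_def)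

lemma grad_swaps: "swap\<^sup>*\<^sup>* m n \<Longrightarrow> supermodular w \<Longrightarrow> grad w m \<le> grad w n"
  by (induction rule: rtranclp_induct) (auto dest: grad_swap)

lemma grad_std_le: "supermodular w \<Longrightarrow> grad w m \<le> grad w (std m)"
  using grad_swaps swap_std by blast

definition tight :: "real ^ 'a::{finite,distrib_lattice} \<Rightarrow> ('a \<Rightarrow>\<^sub>0 nat) \<Rightarrow> bool" where
  "tight w m \<longleftrightarrow> grad w m = grad w (std m)"

text \<open>A monomial that is not a chain monomial needs at least one swap. Under a strict weight
  this step already raises the weight, and later ones cannot lower it.\<close>

lemma tight_iff_chain:
  assumes "strictly_supermodular w"
  shows "tight w m \<longleftrightarrow> chain_monomial m"
proof
  assume "tight w m"
  show "chain_monomial m"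
  proof (rule ccontr)
    assume "\<not> chain_monomial m"
    then have "m \<noteq> std m" using chain_std[of m] by auto
    with swap_std obtain n where n: "swap m n" "swap\<^sup>*\<^sup>* n (std m)"
      by (metis converse_rtranclpE)
    have "grad w m < grad w n"
      using n(1) assms by cases (auto simp: strictly_supermodular_def)
    with grad_swaps[OF n(2) strictly_supermodular_imp[OF assms]] \<open>tight w m\<close> show False
      by (simp add: tight_def)
  qed
qed (simp add: tight_def std_chain)

text \<open>Given by equations instead of spanning elements, so that the dependence on
  \<open>w\<close> is visibly through \<open>tight w\<close> alone.\<close>

definition tight_ideal :: "real ^ 'a::{finite,distrib_lattice} \<Rightarrow> 'a cpoly set" where
  "tight_ideal w = {f. \<forall>n. lin (\<lambda>m. of_bool (tight w m \<and> std m = n)) f = 0}"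

lemma lin_initial_form:
  "lin h (initial_form w p) =
    (\<Sum>m\<in>{m \<in> Poly_Mapping.keys p. grad w m = Min (grad w ` Poly_Mapping.keys p)}.
      Poly_Mapping.lookup p m * h m)"
  by (simp add: initial_form_def lin_sum)

lemma single_eq_single_iff: "Poly_Mapping.single m (1::complex) = Poly_Mapping.single n 1 \<longleftrightarrow> m = n"
  by (metis keys_single one_neq_zero singleton_inject)

lemma initial_form_binomial:
  assumes "m \<noteq> n"
  shows "grad w m < grad w n \<Longrightarrow>
      initial_form w (Poly_Mapping.single m 1 - Poly_Mapping.single n 1) = Poly_Mapping.single m 1"
    and "grad w m = grad w n \<Longrightarrow> initial_form w (Poly_Mapping.single m 1 - Poly_Mapping.single n 1)
      = Poly_Mapping.single m 1 - Poly_Mapping.single n 1"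
proof -
  let ?p = "Poly_Mapping.single m 1 - Poly_Mapping.single n (1::complex)"
  have keys: "Poly_Mapping.keys ?p = {m, n}"
    using assms by (auto simp: in_keys_iff lookup_minus lookup_single when_def split: if_splits)
  have look: "Poly_Mapping.lookup ?p m = 1" "Poly_Mapping.lookup ?p n = -1"
    using assms by (auto simp: lookup_minus lookup_single when_def)
  show "initial_form w ?p = Poly_Mapping.single m 1" if "grad w m < grad w n"
  proof -
    have "{k \<in> Poly_Mapping.keys ?p. grad w k = Min (grad w ` Poly_Mapping.keys ?p)} = {m}"
      using that unfolding keys by auto
    then show ?thesis unfolding initial_form_def using look by simp
  qed
  show "initial_form w ?p = ?p" if "grad w m = grad w n"
  proof -
    have "{k \<in> Poly_Mapping.keys ?p. grad w k = Min (grad w ` Poly_Mapping.keys ?p)}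
        = Poly_Mapping.keys ?p"
      using that unfolding keys by auto
    then show ?thesis unfolding initial_form_def by (simp only: sum_singles)
  qed
qed

text \<open>Within the fibre of \<open>n\<close> no weight exceeds that of \<open>n\<close>. If the
  least weight in \<open>f\<close> is the weight of \<open>n\<close>, all terms of \<open>f\<close>
  in this fibre are tight and survive in the initial form, so their coefficients sum to zero as they
  do for \<open>f\<close>; otherwise no tight term over \<open>n\<close> survives. For the converse,
  the binomials of \<open>m\<close> and \<open>std m\<close> suffice: the initial form is
  \<open>m\<close> or the whole binomial, according to tightness of \<open>m\<close>.\<close>

lemma initial_ideal_hibi:
  assumes w: "supermodular w"
  shows "initial_ideal w (hibi_ideal UNIV) = tight_ideal w"
proof
  interpret module "\<lambda>c (p :: 'a cpoly). Poly_Mapping.single 0 c * p" by (rule module_const_mult)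
  have "subspace (tight_ideal w)"
    unfolding subspace_def tight_ideal_def by (auto simp: lin_single_mult)
  moreover have "initial_form w f \<in> tight_ideal w" if f: "f \<in> hibi_ideal UNIV" for f
    unfolding tight_ideal_def
  proof (safe)
    fix n
    let ?K = "Poly_Mapping.keys f" and ?c = "Poly_Mapping.lookup f"
    define g where "g = Min (grad w ` ?K)"
    have eq: "lin (\<lambda>m. of_bool (tight w m \<and> std m = n)) (initial_form w f)
      = (\<Sum>m\<in>{m \<in> ?K. grad w m = g}. ?c m * of_bool (tight w m \<and> std m = n))"
      unfolding lin_initial_form g_def ..
    show "lin (\<lambda>m. of_bool (tight w m \<and> std m = n)) (initial_form w f) = 0"
    proof (cases "g = grad w n")
      case False
      then show ?thesis unfolding eq by (intro sum.neutral) (auto simp: tight_def)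
    next
      case True
      have "g \<le> grad w m" if "m \<in> ?K" for m using that by (simp add: g_def)
      then have gm: "grad w m = g" if "m \<in> ?K" "std m = n" for m
        using that grad_std_le[OF w, of m] True by fastforce
      have "(\<Sum>m\<in>{m \<in> ?K. grad w m = g}. ?c m * of_bool (tight w m \<and> std m = n))
          = (\<Sum>m\<in>?K. ?c m * of_bool (std m = n))"
        by (rule sum.mono_neutral_cong_left) (use gm True in \<open>auto simp: tight_def\<close>)
      also have "\<dots> = 0" using f unfolding hibi_ideal_iff lin_def by blast
      finally show ?thesis unfolding eq .
    qed
  qed
  ultimately show "initial_ideal w (hibi_ideal UNIV) \<subseteq> tight_ideal w"
    unfolding initial_ideal_def complex_span_def by (intro span_minimal) auto
  have base: "initial_form w f \<in> initial_ideal w (hibi_ideal UNIV)"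
    if "f \<in> hibi_ideal UNIV" "f \<noteq> 0" for f
    unfolding initial_ideal_def complex_span_def using that by (intro span_base) auto
  have mem: "initial_form w (Poly_Mapping.single m 1 - Poly_Mapping.single (std m) 1)
      \<in> initial_ideal w (hibi_ideal UNIV)" if "m \<noteq> std m" for m
    using that by (intro base single_diff_mem_hibi_ideal) (simp add: single_eq_single_iff)
  show "tight_ideal w \<subseteq> initial_ideal w (hibi_ideal UNIV)"
  proof
    fix f assume f: "f \<in> tight_ideal w"
    show "f \<in> initial_ideal w (hibi_ideal UNIV)"
    proof (rule fiber_sum_decomposition[where T = "tight w" and s = std])
      show "0 \<in> initial_ideal w (hibi_ideal UNIV)"
        unfolding initial_ideal_def complex_span_def by (rule span_zero)
      show "Poly_Mapping.single m 1 \<in> initial_ideal w (hibi_ideal UNIV)" if "\<not> tight w m" for m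
      proof -
        have "grad w m < grad w (std m)" using that grad_std_le[OF w, of m] by (simp add: tight_def)
        then show ?thesis using mem[of m] initial_form_binomial(1)[of m "std m" w] by fastforce
      qed
      show "Poly_Mapping.single m 1 - Poly_Mapping.single (std m) 1
          \<in> initial_ideal w (hibi_ideal UNIV)" if "tight w m" for m
      proof (cases "m = std m")
        case True
        then show ?thesis unfolding initial_ideal_def complex_span_def by (simp add: span_zero)
      next
        case False
        then show ?thesis
          using that mem[of m] initial_form_binomial(2)[of m "std m" w] by (simp add: tight_def)
      qed
    qed (use f in \<open>auto simp: initial_ideal_def complex_span_def tight_ideal_def span_add span_scale\<close>)
  qed
qed

lemma chain_monomial_add: "chain_monomial (k + m) \<Longrightarrow> chain_monomial m"
  unfolding chain_monomial_def by (auto simp: in_keys_iff lookup_add)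

lemma not_chain_monomial_pair: "\<not> a \<le> b \<Longrightarrow> \<not> b \<le> a \<Longrightarrow> \<not> chain_monomial (mvar a + mvar b)"
  unfolding chain_monomial_def
  by (intro notI) (drule bspec[of _ _ a], simp add: in_keys_iff lookup_add,
    drule bspec[of _ _ b], simp_all add: in_keys_iff lookup_add)

lemma hibi_monomial_ideal_eq:
  "hibi_monomial_ideal = {f. \<forall>m\<in>Poly_Mapping.keys f. \<not> chain_monomial (m :: 'a::{finite,distrib_lattice} \<Rightarrow>\<^sub>0 nat)}"
    (is "_ = ?R")
proof
  interpret module "(*) :: 'a cpoly \<Rightarrow> 'a cpoly \<Rightarrow> 'a cpoly" by (rule module_mult)
  have "subspace ?R"
    unfolding subspace_def
  proof (safe; simp?)
    fix f g :: "'a cpoly" and m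
    assume "m \<in> Poly_Mapping.keys (f + g)" "chain_monomial m"
      "\<forall>m\<in>Poly_Mapping.keys f. \<not> chain_monomial m" "\<forall>m\<in>Poly_Mapping.keys g. \<not> chain_monomial m"
    then show False using keys_add[of f g] by blast
  next
    fix c f :: "'a cpoly" and m
    assume "m \<in> Poly_Mapping.keys (c * f)" "chain_monomial m"
      "\<forall>m\<in>Poly_Mapping.keys f. \<not> chain_monomial m"
    then show False using keys_mult[of c f] chain_monomial_add by blast
  qed
  then show "hibi_monomial_ideal \<subseteq> ?R"
    unfolding hibi_monomial_ideal_def ideal_generated_def
    by (intro span_minimal) (auto simp: Xvar_mult not_chain_monomial_pair)
  show "?R \<subseteq> hibi_monomial_ideal"
  proof
    fix f :: "'a cpoly" assume f: "f \<in> ?R"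
    have "(\<Sum>m\<in>Poly_Mapping.keys f. Poly_Mapping.single m (Poly_Mapping.lookup f m)) \<in> hibi_monomial_ideal"
      unfolding hibi_monomial_ideal_def ideal_generated_def
    proof (rule span_sum)
      fix m assume "m \<in> Poly_Mapping.keys f"
      then have "\<not> chain_monomial m" using f by blast
      then obtain a b where ab: "a \<in> Poly_Mapping.keys m" "b \<in> Poly_Mapping.keys m" "\<not> a \<le> b" "\<not> b \<le> a"
        unfolding chain_monomial_def by blast
      then obtain k where k: "m = k + mvar a + mvar b" using mvar_factor2 by (metis order.refl)
      have "Poly_Mapping.single k (Poly_Mapping.lookup f m) * (Xvar a * Xvar b)
          \<in> span {Xvar a * Xvar b | a b. \<not> a \<le> b \<and> \<not> b \<le> a}"
        using ab by (intro span_scale span_base) blast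
      then show "Poly_Mapping.single m (Poly_Mapping.lookup f m)
          \<in> span {Xvar a * Xvar b | a b. \<not> a \<le> b \<and> \<not> b \<le> a}"
        unfolding Xvar_mult mult_single using k by (simp add: add.assoc)
    qed
    then show "f \<in> hibi_monomial_ideal" by (simp add: sum_singles)
  qed
qed

text \<open>For strict weights the only tight monomial in a fibre is its normal form, so the
  functional at a chain monomial reads off a single coefficient.\<close>

lemma tight_ideal_strict:
  assumes "strictly_supermodular w"
  shows "tight_ideal w = hibi_monomial_ideal"
proof -
  have "lin (\<lambda>m. of_bool (tight w m \<and> std m = n)) f = (if chain_monomial n then Poly_Mapping.lookup f n else 0)"
    for f n
  proof -
    have "lin (\<lambda>m. of_bool (tight w m \<and> std m = n)) f
        = (\<Sum>m\<in>Poly_Mapping.keys f. if m = n then if chain_monomial n then Poly_Mapping.lookup f n else 0 else 0)"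
      unfolding lin_def by (rule sum.cong) (auto simp: tight_iff_chain[OF assms] std_chain)
    then show ?thesis by (auto simp: in_keys_iff)
  qed
  then show ?thesis
    unfolding tight_ideal_def hibi_monomial_ideal_eq by (auto simp: in_keys_iff)
qed

text \<open>The Hibi binomial of an incomparable pair tests the inequality: if it failed, the chain
  monomial \<open>?n\<close> would occur in the initial form, but no element of the monomial ideal
  contains a chain monomial.\<close>

lemma initial_cone_supermodular:
  assumes "w \<in> initial_cone (hibi_ideal UNIV) hibi_monomial_ideal"
  shows "strictly_supermodular w"
  unfolding strictly_supermodular_def
proof (intro allI impI)
  fix a b :: 'a assume ab: "\<not> a \<le> b" "\<not> b \<le> a"
  let ?m = "mvar a + mvar b" and ?n = "mvar (sup a b) + mvar (inf a b)"
  have n: "chain_monomial ?n" using chain_std[of ?m] by (simp add: std_pair)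
  have std: "std ?m = ?n" "?m \<noteq> ?n" using not_chain_monomial_pair[OF ab] n by (auto simp: std_pair)
  let ?p = "Poly_Mapping.single ?m 1 - Poly_Mapping.single ?n (1::complex)"
  have "?p \<in> hibi_ideal UNIV" using single_diff_mem_hibi_ideal[of ?m] std by simp
  moreover have "?p \<noteq> 0" using std by (simp add: single_eq_single_iff)
  ultimately have "initial_form w ?p \<in> initial_ideal w (hibi_ideal UNIV)"
    unfolding initial_ideal_def complex_span_def
    by (intro module.span_base[OF module_const_mult]) auto
  then have "initial_form w ?p \<in> hibi_monomial_ideal" using assms by (simp add: initial_cone_def)
  then have no: "?n \<notin> Poly_Mapping.keys (initial_form w ?p)" using n by (auto simp: hibi_monomial_ideal_eq)
  have "grad w ?m < grad w ?n"
  proof (rule ccontr)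
    assume "\<not> ?thesis"
    then consider "grad w ?n < grad w ?m" | "grad w ?m = grad w ?n" by linarith
    then show False
    proof cases
      case 1
      have "Poly_Mapping.keys ?p = {?m, ?n}"
        using std by (auto simp: in_keys_iff lookup_minus lookup_single when_def split: if_splits)
      then have "{k \<in> Poly_Mapping.keys ?p. grad w k = Min (grad w ` Poly_Mapping.keys ?p)} = {?n}"
        using 1 by auto
      then have "initial_form w ?p = Poly_Mapping.single ?n (Poly_Mapping.lookup ?p ?n)"
        unfolding initial_form_def by simp
      then show False using no std by (auto simp: in_keys_iff lookup_minus lookup_single when_def)
    next
      case 2
      then show False using no initial_form_binomial(2)[OF std(2)] std(2)
        by (auto simp: in_keys_iff lookup_minus lookup_single when_def)
    qed
  qed
  then show "w $ a + w $ b < w $ sup a b + w $ inf a b" by simp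
qed

lemma closed_supermodular: "closed (Collect supermodular)"
  unfolding supermodular_def
  by (intro closed_Collect_all closed_Collect_le continuous_intros)

lemma hibi_cone_eq: "hibi_cone = Collect (supermodular :: real ^ 'a::{finite,distrib_lattice} \<Rightarrow> bool)"
proof
  have C: "initial_cone (hibi_ideal UNIV) hibi_monomial_ideal
      = Collect (strictly_supermodular :: (real, 'a) vec \<Rightarrow> bool)"
    using initial_cone_supermodular
    by (auto simp: initial_cone_def initial_ideal_hibi tight_ideal_strict strictly_supermodular_imp)
  show "hibi_cone \<subseteq> Collect (supermodular :: (real, 'a) vec \<Rightarrow> bool)"
    unfolding hibi_cone_def C
    by (rule closure_minimal[OF _ closed_supermodular]) (auto intro: strictly_supermodular_imp)
  show "Collect supermodular \<subseteq> (hibi_cone :: ((real, 'a) vec) set)"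
  proof
    fix w :: "(real, 'a) vec" assume "w \<in> Collect supermodular"
    \<comment> \<open>The squared rank points into the interior: adding any small positive multiple
      makes a supermodular weight strict.\<close>
    define w0 :: "(real, 'a) vec" where "w0 = (\<chi> a. real ((card (birkhoff a))\<^sup>2))"
    have w0: "w0 $ a + w0 $ b < w0 $ sup a b + w0 $ inf a b" if "\<not> a \<le> b" "\<not> b \<le> a" for a b
      using card_birkhoff_supermodular[OF that] unfolding w0_def by (simp flip: of_nat_add of_nat_power)
    have "strictly_supermodular (w + (1 / real (Suc n)) *\<^sub>R w0)" for n
      unfolding strictly_supermodular_def
    proof (intro allI impI)
      fix a b :: 'a assume "\<not> a \<le> b" "\<not> b \<le> a"
      then have "(1 / real (Suc n)) * (w0 $ a + w0 $ b) < (1 / real (Suc n)) * (w0 $ sup a b + w0 $ inf a b)"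
        using w0 by (intro mult_strict_left_mono) auto
      moreover have "w $ a + w $ b \<le> w $ sup a b + w $ inf a b"
        using \<open>w \<in> _\<close> by (auto simp: supermodular_def)
      ultimately show "(w + (1 / real (Suc n)) *\<^sub>R w0) $ a + (w + (1 / real (Suc n)) *\<^sub>R w0) $ b
          < (w + (1 / real (Suc n)) *\<^sub>R w0) $ sup a b + (w + (1 / real (Suc n)) *\<^sub>R w0) $ inf a b"
        by (simp add: algebra_simps)
    qed
    moreover have "(\<lambda>n. w + (1 / real (Suc n)) *\<^sub>R w0) \<longlonglongrightarrow> w + 0 *\<^sub>R w0"
      by (intro tendsto_intros LIMSEQ_Suc[OF lim_1_over_n])
    ultimately show "w \<in> hibi_cone"
      unfolding hibi_cone_def C closure_sequential by (auto intro!: exI)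
  qed
qed

text \<open>The segment from \<open>w'\<close> to \<open>w\<close> can be prolonged beyond
  \<open>w\<close> inside \<open>F\<close>. As \<open>L\<close> is zero at \<open>w\<close>, a
  positive value at \<open>w'\<close> would make it negative on the prolongation.\<close>

lemma rel_interior_valid_inequality:
  fixes F :: "'v::euclidean_space set"
  assumes "convex F" "w \<in> rel_interior F" "w' \<in> F" "linear L" "\<And>u. u \<in> F \<Longrightarrow> 0 \<le> L u" "L w = (0::real)"
  shows "L w' = 0"
proof -
  have "\<forall>x\<in>F. \<exists>e>1. (1 - e) *\<^sub>R x + e *\<^sub>R w \<in> F"
    using assms(1,2) convex_rel_interior_iff[of F w] by blast
  then obtain e where e: "e > 1" "(1 - e) *\<^sub>R w' + e *\<^sub>R w \<in> F" using assms(3) by blast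
  have "0 \<le> L ((1 - e) *\<^sub>R w' + e *\<^sub>R w)" using assms(5) e(2) by blast
  also have "\<dots> = (1 - e) * L w'"
    using assms(4,6) by (simp add: linear_add linear_scale)
  finally have "L w' \<le> 0" using e(1) by (simp add: zero_le_mult_iff)
  then show ?thesis using assms(3,5) by force
qed

section \<open>Regular subdivisions of the order polytope\<close>

definition ind_vec :: "'a::finite set \<Rightarrow> real ^ 'a" where
  "ind_vec D = (\<chi> p. of_bool (p \<in> D))"

lemma ind_vec_nth [simp]: "ind_vec D $ p = of_bool (p \<in> D)"
  by (simp add: ind_vec_def)

lemma lattice_vertex_eq: "lattice_vertex a = ind_vec (birkhoff a)"
  by (simp add: lattice_vertex_def ind_vec_def)

lemma lattice_vertex_nth [simp]: "lattice_vertex a $ p = of_bool (p \<in> birkhoff a)"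
  by (simp add: lattice_vertex_eq)

lemma inj_lattice_vertex: "inj lattice_vertex"
proof (rule injI)
  fix a b :: 'a assume "lattice_vertex a = lattice_vertex b"
  then have "(lattice_vertex a :: (real, 'a) vec) $ p = lattice_vertex b $ p" for p by simp
  then have "p \<in> birkhoff a \<longleftrightarrow> p \<in> birkhoff b" for p unfolding lattice_vertex_nth of_bool_eq_iff .
  then have "birkhoff a = birkhoff b" by blast
  then show "a = b" by (rule injD[OF inj_birkhoff])
qed

lemma lattice_vertex_sup_inf:
  "lattice_vertex (sup a b) + lattice_vertex (inf a b) = lattice_vertex a + lattice_vertex b"
  by (simp add: vec_eq_iff birkhoff_sup birkhoff_inf)

text \<open>The last entry is an element of least \<open>x\<close>-value that is maximal for
  \<open>lt\<close> among these. Since \<open>x\<close> weakly decreases along \<open>lt\<close>, it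
  is maximal in all of \<open>P\<close>, so removing it leaves an order ideal and the induction
  applies.\<close>

lemma ex_linear_extension:
  fixes x :: "'a \<Rightarrow> real"
  assumes "finite P" "is_order_on P lt" "\<And>p q. p \<in> P \<Longrightarrow> q \<in> P \<Longrightarrow> lt q p \<Longrightarrow> x p \<le> x q"
  shows "\<exists>ps. distinct ps \<and> set ps = P \<and> (\<forall>i. set (take i ps) \<in> order_ideals P lt) \<and>
    sorted_wrt (\<lambda>p q. x q \<le> x p) ps"
  using assms
proof (induction "card P" arbitrary: P)
  case 0
  then show ?case by (auto simp: order_ideals_def)
next
  case (Suc n)
  define A where "A = {p \<in> P. x p = Min (x ` P)}"
  have "P \<noteq> {}" using Suc.hyps(2) by auto
  then have "Min (x ` P) \<in> x ` P" using \<open>finite P\<close> by (intro Min_in) auto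
  then have A: "finite A" "A \<noteq> {}" using \<open>finite P\<close> by (auto simp: A_def)
  have lt: "irreflp_on P lt" "transp_on P lt" using Suc.prems(2) by (auto simp: is_order_on_def)
  have tr: "transp_on A lt" using lt(2) by (auto simp: A_def transp_on_def)
  have "asymp_on A lt" using lt unfolding A_def asymp_on_def irreflp_on_def transp_on_def by blast
  from Finite_Set.bex_max_element[OF A(1) this tr A(2)]
  obtain p where p: "p \<in> A" "\<And>q. q \<in> A \<Longrightarrow> q \<noteq> p \<Longrightarrow> \<not> lt p q" by blast
  have pP: "p \<in> P" and xp: "\<And>q. q \<in> P \<Longrightarrow> x p \<le> x q" using p(1) \<open>finite P\<close> by (auto simp: A_def)
  have max: "\<not> lt p q" if "q \<in> P" for q
  proof
    assume "lt p q"
    then have "x q = x p" using Suc.prems(3) pP that xp by force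
    then have "q \<in> A" using p(1) that by (auto simp: A_def)
    moreover have "q \<noteq> p" using \<open>lt p q\<close> lt(1) pP by (auto simp: irreflp_on_def)
    ultimately show False using p(2) \<open>lt p q\<close> by blast
  qed
  have "\<exists>ps. distinct ps \<and> set ps = P - {p} \<and> (\<forall>i. set (take i ps) \<in> order_ideals (P - {p}) lt) \<and>
    sorted_wrt (\<lambda>p q. x q \<le> x p) ps"
  proof (rule Suc.hyps(1))
    show "n = card (P - {p})" using Suc.hyps(2) pP \<open>finite P\<close> by simp
    show "is_order_on (P - {p}) lt" using lt by (auto simp: is_order_on_def irreflp_on_def transp_on_def)
  qed (use Suc.prems in auto)
  then obtain ps where ps: "distinct ps" "set ps = P - {p}"
    "\<And>i. set (take i ps) \<in> order_ideals (P - {p}) lt" "sorted_wrt (\<lambda>p q. x q \<le> x p) ps" by blast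
  have "set (take i (ps @ [p])) \<in> order_ideals P lt" for i
  proof (cases "i \<le> length ps")
    case True
    then have "set (take i (ps @ [p])) = set (take i ps)" by simp
    moreover have "set (take i ps) \<in> order_ideals P lt"
      using ps(3)[of i] max unfolding order_ideals_def by blast
    ultimately show ?thesis by simp
  next
    case False
    then have "set (take i (ps @ [p])) = P" using ps(2) pP by auto
    then show ?thesis by (auto simp: order_ideals_def)
  qed
  then show ?case
    using ps pP xp by (intro exI[of _ "ps @ [p]"]) (auto simp: sorted_wrt_append)
qed

lemma mem_set_take_iff:
  assumes "distinct ps" "j < length ps"
  shows "ps ! j \<in> set (take i ps) \<longleftrightarrow> j < i"
proof
  assume "ps ! j \<in> set (take i ps)"
  then obtain k where "k < i" "k < length ps" "ps ! k = ps ! j" by (auto simp: in_set_conv_nth)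
  then show "j < i" using assms by (simp add: nth_eq_iff_index_eq)
next
  assume "j < i"
  then have "take i ps ! j = ps ! j" "j < length (take i ps)" using assms by auto
  then show "ps ! j \<in> set (take i ps)" by (metis nth_mem)
qed

lemma mem_hull_prefixes:
  fixes x :: "real ^ 'a::finite"
  assumes ps: "distinct ps" and x: "\<And>p. p \<notin> set ps \<Longrightarrow> x $ p = 0" "\<And>p. 0 \<le> x $ p \<and> x $ p \<le> 1"
    and sorted: "sorted_wrt (\<lambda>p q. x $ q \<le> x $ p) ps"
  shows "x \<in> convex hull ((\<lambda>i. ind_vec (set (take i ps))) ` {..length ps})"
proof -
  let ?n = "length ps" and ?y = "\<lambda>i. ind_vec (set (take i ps))"
  \<comment> \<open>The coordinates in sorted order, shifted by one and framed by 1 at index 0 and 0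
    beyond the end. Their successive differences \<open>l\<close> are the barycentric coordinates of
    \<open>x\<close> in the simplex of the prefixes; the frame makes them sum to 1.\<close>
  define X where "X = (\<lambda>i. if i = 0 then 1 else if i \<le> ?n then x $ (ps ! (i - 1)) else 0)"
  define l where "l = (\<lambda>i. X i - X (Suc i))"
  have tele: "(\<Sum>i=k..?n. l i) = X k" if "k \<le> ?n" for k
  proof -
    have "(\<Sum>i=k..?n. l i) = - (\<Sum>i=k..?n. X (Suc i) - X i)"
      by (simp add: l_def flip: sum_negf)
    also have "\<dots> = X k - X (Suc ?n)" using that by (subst sum_Suc_diff) auto
    finally show ?thesis by (simp add: X_def)
  qed
  have nonneg: "0 \<le> l i" if i: "i \<in> {..?n}" for i
  proof -
    consider "i = 0" | "i = ?n" | "0 < i" "i < ?n" using i by fastforce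
    then show ?thesis
    proof cases
      case 3
      then have "x $ (ps ! i) \<le> x $ (ps ! (i - 1))"
        using sorted by (intro sorted_wrt_nth_less[OF sorted]) auto
      then show ?thesis using 3 by (simp add: l_def X_def)
    qed (use x(2) in \<open>auto simp: l_def X_def\<close>)
  qed
  have "x $ p = (\<Sum>i\<le>?n. l i * of_bool (p \<in> set (take i ps)))" for p
  proof (cases "p \<in> set ps")
    case False
    then have "p \<notin> set (take i ps)" for i using in_set_takeD by fast
    then show ?thesis using x(1) False by simp
  next
    case True
    then obtain j where j: "j < ?n" "p = ps ! j" by (auto simp: in_set_conv_nth)
    have "(\<Sum>i\<le>?n. l i * of_bool (p \<in> set (take i ps))) = (\<Sum>i=Suc j..?n. l i)"
      using j by (intro sum.mono_neutral_cong_right) (auto simp: mem_set_take_iff[OF ps] Suc_le_eq)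
    then show ?thesis using tele[of "Suc j"] j by (simp add: X_def)
  qed
  then have "x = (\<Sum>i\<le>?n. l i *\<^sub>R ?y i)" by (simp add: vec_eq_iff)
  also have "\<dots> \<in> convex hull (?y ` {..?n})"
  proof (rule convex_sum)
    show "(\<Sum>i\<in>{..?n}. l i) = 1" using tele[of 0] by (simp add: X_def atMost_atLeast0)
  qed (use nonneg in \<open>auto intro: hull_inc\<close>)
  finally show ?thesis .
qed

lemma convex_order_polytope: "convex (order_polytope P lt)"
  unfolding convex_def order_polytope_def
proof (safe; simp)
  fix x y :: "real ^ 'a" and u v :: real and p
  assume "0 \<le> u" "0 \<le> v" "u + v = 1" "p \<in> P"
    and "\<forall>p\<in>P. 0 \<le> x $ p \<and> x $ p \<le> 1" "\<forall>p\<in>P. 0 \<le> y $ p \<and> y $ p \<le> 1"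
  then show "u * x $ p + v * y $ p \<le> 1" by (simp add: convex_bound_le)
next
  fix x y :: "real ^ 'a" and u v :: real and p q
  assume "0 \<le> u" "0 \<le> v" "p \<in> P" "q \<in> P" "lt q p"
    and "\<forall>p\<in>P. \<forall>q\<in>P. lt q p \<longrightarrow> x $ p \<le> x $ q" "\<forall>p\<in>P. \<forall>q\<in>P. lt q p \<longrightarrow> y $ p \<le> y $ q"
  then show "u * x $ p + v * y $ p \<le> u * x $ q + v * y $ q" by (intro add_mono mult_left_mono) auto
qed

lemma ind_vec_mem_order_polytope: "D \<in> order_ideals P lt \<Longrightarrow> ind_vec D \<in> order_polytope P lt"
  unfolding order_polytope_def order_ideals_def by (auto split: if_splits)

text \<open>Sorting the coordinates of a point compatibly with the order selects a simplex of the
  canonical triangulation that contains it, namely one spanned by a maximal chain of ideals.\<close>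

lemma order_polytope_prefixes:
  assumes "is_order_on P lt" "x \<in> order_polytope P lt"
  shows "\<exists>ps. distinct ps \<and> set ps = P \<and> (\<forall>i. set (take i ps) \<in> order_ideals P lt) \<and>
    x \<in> convex hull ((\<lambda>i. ind_vec (set (take i ps))) ` {..length ps})"
proof -
  have x: "\<And>p. p \<notin> P \<Longrightarrow> x $ p = 0" "\<And>p. p \<in> P \<Longrightarrow> 0 \<le> x $ p \<and> x $ p \<le> 1"
    "\<And>p q. p \<in> P \<Longrightarrow> q \<in> P \<Longrightarrow> lt q p \<Longrightarrow> x $ p \<le> x $ q"
    using assms(2) by (auto simp: order_polytope_def)
  obtain ps where ps: "distinct ps" "set ps = P" "\<forall>i. set (take i ps) \<in> order_ideals P lt"
    "sorted_wrt (\<lambda>p q. x $ q \<le> x $ p) ps"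
    using ex_linear_extension[of P lt "\<lambda>p. x $ p"] assms(1) x(3) by auto
  moreover have "0 \<le> x $ p \<and> x $ p \<le> 1" for p using x(1,2)[of p] by (cases "p \<in> P") auto
  ultimately show ?thesis using mem_hull_prefixes[OF ps(1), of x] x(1) by blast
qed

lemma order_polytope_hull:
  assumes "is_order_on P lt"
  shows "order_polytope P lt = convex hull (ind_vec ` order_ideals P lt)"
proof
  show "order_polytope P lt \<subseteq> convex hull (ind_vec ` order_ideals P lt)"
  proof
    fix x assume "x \<in> order_polytope P lt"
    from order_polytope_prefixes[OF assms this] obtain ps :: "'a list"
      where ps: "\<forall>i. set (take i ps) \<in> order_ideals P lt"
        "x \<in> convex hull ((\<lambda>i. ind_vec (set (take i ps))) ` {..length ps})" by blast
    have "(\<lambda>i. ind_vec (set (take i ps))) ` {..length ps} \<subseteq> ind_vec ` order_ideals P lt"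
      using ps(1) by auto
    then show "x \<in> convex hull (ind_vec ` order_ideals P lt)" using ps(2) hull_mono by blast
  qed
  show "convex hull (ind_vec ` order_ideals P lt) \<subseteq> order_polytope P lt"
    by (rule hull_minimal) (auto intro: convex_order_polytope ind_vec_mem_order_polytope)
qed

lemma lattice_points_order_polytope: "lattice_points (order_polytope P lt) = ind_vec ` order_ideals P lt"
proof
  show "lattice_points (order_polytope P lt) \<subseteq> ind_vec ` order_ideals P lt"
  proof
    fix m assume "m \<in> lattice_points (order_polytope P lt)"
    then have m: "\<And>p. p \<notin> P \<Longrightarrow> m $ p = 0" "\<And>p. p \<in> P \<Longrightarrow> 0 \<le> m $ p \<and> m $ p \<le> 1"
      "\<And>p q. p \<in> P \<Longrightarrow> q \<in> P \<Longrightarrow> lt q p \<Longrightarrow> m $ p \<le> m $ q" "\<And>p. m $ p \<in> \<int>"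
      by (auto simp: lattice_points_def order_polytope_def)
    have 01: "m $ p = 0 \<or> m $ p = 1" for p
    proof -
      obtain k :: int where "m $ p = of_int k" using m(4) Ints_cases by blast
      then show ?thesis using m(1,2)[of p] by (cases "p \<in> P") auto
    qed
    define D where "D = {p. m $ p = 1}"
    have "D \<in> order_ideals P lt"
      unfolding order_ideals_def D_def
    proof (safe)
      fix p assume "m $ p = 1" then show "p \<in> P" using m(1)[of p] by auto
    next
      fix p q assume "m $ p = 1" "q \<in> P" "lt q p"
      then show "m $ q = 1" using m(1)[of p] m(3)[of p q] 01[of q] by (cases "p \<in> P") auto
    qed
    moreover have "m = ind_vec D" using 01 by (auto simp: vec_eq_iff D_def)
    ultimately show "m \<in> ind_vec ` order_ideals P lt" by blast
  qed
  show "ind_vec ` order_ideals P lt \<subseteq> lattice_points (order_polytope P lt)"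
    by (auto simp: lattice_points_def ind_vec_mem_order_polytope)
qed

lemma is_order_on_less: "is_order_on P ((<) :: 'a::order \<Rightarrow> _)"
  by (auto simp: is_order_on_def irreflp_on_def transp_on_def)

lemma order_ideals_eq_range: "order_ideals join_irreducibles (<) = range (birkhoff :: 'a::{finite,distrib_lattice} \<Rightarrow> _)"
  using birkhoff_order_ideal order_ideal_birkhoff by blast

lemma order_polytope_eq_hull: "order_polytope join_irreducibles (<) = convex hull (range lattice_vertex)"
  unfolding order_polytope_hull[OF is_order_on_less] order_ideals_eq_range
  by (simp add: image_image lattice_vertex_eq)

lemma extreme_points_order_polytope:
  "{v. v extreme_point_of order_polytope join_irreducibles (<)} = range (lattice_vertex :: 'a::{finite,distrib_lattice} \<Rightarrow> _)" (is "?L = ?R")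
proof
  show "?L \<subseteq> ?R"
    unfolding order_polytope_eq_hull using extreme_point_of_convex_hull by blast
  have "lattice_vertex a extreme_point_of order_polytope join_irreducibles (<)" for a :: 'a
    unfolding extreme_point_of_def
  proof (intro conjI ballI notI)
    show "lattice_vertex a \<in> order_polytope join_irreducibles (<)"
      unfolding order_polytope_eq_hull by (simp add: hull_inc)
    fix x y :: "(real, 'a) vec"
    assume xy: "x \<in> order_polytope join_irreducibles (<)" "y \<in> order_polytope join_irreducibles (<)"
      and "lattice_vertex a \<in> open_segment x y"
    then obtain u where u: "x \<noteq> y" "0 < u" "u < 1" "lattice_vertex a = (1 - u) *\<^sub>R x + u *\<^sub>R y"
      by (auto simp: in_segment)
    \<comment> \<open>Each coordinate of a vertex is 0 or 1, an end of the interval to which both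
      \<open>x $ p\<close> and \<open>y $ p\<close> are confined.\<close>
    have "x $ p = y $ p" for p
    proof -
      have b: "0 \<le> x $ p" "x $ p \<le> 1" "0 \<le> y $ p" "y $ p \<le> 1"
        using xy by (cases "p \<in> join_irreducibles"; auto simp: order_polytope_def)+
      have "of_bool (p \<in> birkhoff a) = (lattice_vertex a :: (real, 'a) vec) $ p" by simp
      also have "\<dots> = (1 - u) * x $ p + u * y $ p" unfolding u(4) by simp
      finally have e: "of_bool (p \<in> birkhoff a) = (1 - u) * x $ p + u * y $ p" .
      show ?thesis
      proof (cases "p \<in> birkhoff a")
        case False
        then have "(1 - u) * x $ p = 0" "u * y $ p = 0"
          using e u b by (simp_all add: add_nonneg_eq_0_iff)
        then show ?thesis using u by simp
      next
        case True
        then have "(1 - u) * (1 - x $ p) + u * (1 - y $ p) = 0" using e by (simp add: algebra_simps)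
        then have "(1 - u) * (1 - x $ p) = 0" "u * (1 - y $ p) = 0"
          using u b by (simp_all add: add_nonneg_eq_0_iff)
        then show ?thesis using u by simp
      qed
    qed
    then show False using u(1) by (simp add: vec_eq_iff)
  qed
  then show "?R \<subseteq> ?L" by blast
qed

section \<open>Maximal chains, their affine functions and cells\<close>

definition linext :: "'a::{finite,distrib_lattice} list \<Rightarrow> bool" where
  "linext ps \<longleftrightarrow> distinct ps \<and> set ps = join_irreducibles \<and>
    (\<forall>i. set (take i ps) \<in> order_ideals join_irreducibles (<))"

definition chain_elem :: "'a::{finite,distrib_lattice} list \<Rightarrow> nat \<Rightarrow> 'a" where
  "chain_elem ps i = inv birkhoff (set (take i ps))"

text \<open>A gradient: the step from prefix \<open>i\<close> to prefix \<open>Suc i\<close> changes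
  only the coordinate \<open>ps ! i\<close>, by one, so the slope there has to be the increment of
  \<open>w\<close>.\<close>

definition chain_vec :: "real ^ 'a::{finite,distrib_lattice} \<Rightarrow> 'a list \<Rightarrow> (real, 'a) vec" where
  "chain_vec w ps =
    (\<Sum>i<length ps. (w $ chain_elem ps (Suc i) - w $ chain_elem ps i) *\<^sub>R axis (ps ! i) 1)"

text \<open>If \<open>ps\<close> is a linear extension, then \<open>chain_affine w ps\<close> is the affine function on the order polytope that
  agrees with \<open>w\<close> on the maximal chain of the prefixes of \<open>ps\<close>.\<close>

definition chain_affine :: "real ^ 'a::{finite,distrib_lattice} \<Rightarrow> 'a list \<Rightarrow> (real, 'a) vec \<Rightarrow> real" where
  "chain_affine w ps x = w $ least_elem + chain_vec w ps \<bullet> x"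

definition cell :: "real ^ 'a::{finite,distrib_lattice} \<Rightarrow> 'a list \<Rightarrow> 'a set" where
  "cell w ps = {a. w $ a = chain_affine w ps (lattice_vertex a)}"

lemma birkhoff_chain_elem: "linext ps \<Longrightarrow> birkhoff (chain_elem ps i) = set (take i ps)"
  unfolding chain_elem_def linext_def using order_ideal_birkhoff f_inv_into_f[of _ birkhoff UNIV]
  by (metis UNIV_I image_eqI)

lemma eq_birkhoff: "birkhoff a = birkhoff b \<Longrightarrow> a = (b :: 'a::{finite,distrib_lattice})"
  by (rule injD[OF inj_birkhoff])

lemma chain_elem_0: "linext ps \<Longrightarrow> chain_elem ps 0 = least_elem"
  by (rule eq_birkhoff) (simp add: birkhoff_chain_elem birkhoff_least)

lemma le_chain_elem_length: "linext ps \<Longrightarrow> a \<le> chain_elem ps (length ps)"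
  using birkhoff_subset[of a] birkhoff_subset_iff[of a "chain_elem ps (length ps)"]
  by (simp add: birkhoff_chain_elem) (simp add: linext_def)

lemma chain_affine_vertex:
  "chain_affine w ps (lattice_vertex a) = w $ least_elem +
    (\<Sum>i<length ps. of_bool (ps ! i \<in> birkhoff a) * (w $ chain_elem ps (Suc i) - w $ chain_elem ps i))"
  by (simp add: chain_affine_def chain_vec_def inner_sum_left inner_axis' mult.commute)

lemma chain_affine_modular:
  "chain_affine w ps (lattice_vertex (sup a b)) + chain_affine w ps (lattice_vertex (inf a b))
    = chain_affine w ps (lattice_vertex a) + chain_affine w ps (lattice_vertex b)"
  using arg_cong[OF lattice_vertex_sup_inf[of a b], of "\<lambda>x. chain_vec w ps \<bullet> x"]
  by (simp add: chain_affine_def inner_add_right)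

lemma set_take_Suc: "i < length ps \<Longrightarrow> set (take (Suc i) ps) = insert (ps ! i) (set (take i ps))"
  by (simp add: take_Suc_conv_app_nth)

text \<open>Intersect the chain with \<open>a\<close> and compare increments. If
  \<open>ps ! i\<close> is below \<open>a\<close>, then \<open>inf a (?c (Suc i))\<close> and
  \<open>?c i\<close> have join \<open>?c (Suc i)\<close> and meet \<open>inf a (?c i)\<close>, so
  by supermodularity \<open>w\<close> grows on the intersected chain at most as much as on the chain
  itself. At all other steps the intersection does not move.\<close>

lemma chain_affine_ge:
  assumes w: "supermodular w" and ps: "linext ps"
  shows "w $ a \<le> chain_affine w ps (lattice_vertex a)"
proof -
  let ?c = "chain_elem ps" and ?n = "length ps"
  define f where "f = (\<lambda>i. w $ inf a (?c i))"
  have "f (Suc i) - f i \<le> of_bool (ps ! i \<in> birkhoff a) * (w $ ?c (Suc i) - w $ ?c i)" if "i < ?n" for i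
  proof (cases "ps ! i \<in> birkhoff a")
    case False
    then have "birkhoff (inf a (?c (Suc i))) = birkhoff (inf a (?c i))"
      by (auto simp: birkhoff_inf birkhoff_chain_elem[OF ps] set_take_Suc[OF that])
    then have "inf a (?c (Suc i)) = inf a (?c i)" by (rule eq_birkhoff)
    then show ?thesis using False by (simp add: f_def)
  next
    case True
    have "ps ! i \<notin> set (take i ps)" using mem_set_take_iff[of ps i i] ps that by (simp add: linext_def)
    then have eq: "birkhoff (sup (inf a (?c (Suc i))) (?c i)) = birkhoff (?c (Suc i))"
      "birkhoff (inf (inf a (?c (Suc i))) (?c i)) = birkhoff (inf a (?c i))"
      using True unfolding birkhoff_inf birkhoff_sup birkhoff_chain_elem[OF ps] set_take_Suc[OF that]
      by blast+
    show ?thesis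
      using True eq_birkhoff[OF eq(1)] eq_birkhoff[OF eq(2)] w[unfolded supermodular_def, rule_format, of "inf a (?c (Suc i))" "?c i"]
      by (simp add: f_def)
  qed
  then have "(\<Sum>i<?n. f (Suc i) - f i)
      \<le> (\<Sum>i<?n. of_bool (ps ! i \<in> birkhoff a) * (w $ ?c (Suc i) - w $ ?c i))"
    by (intro sum_mono) auto
  moreover have "(\<Sum>i<?n. f (Suc i) - f i) = f ?n - f 0" by (rule sum_lessThan_telescope)
  moreover have "f ?n = w $ a" "f 0 = w $ least_elem"
    using le_chain_elem_length[OF ps] chain_elem_0[OF ps] by (auto simp: f_def inf_absorb1 inf_absorb2)
  ultimately show ?thesis unfolding chain_affine_vertex by simp
qed

lemma chain_elem_mem_cell:
  assumes ps: "linext ps" and "k \<le> length ps"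
  shows "chain_elem ps k \<in> cell w ps"
proof -
  let ?c = "chain_elem ps"
  have "distinct ps" using ps by (simp add: linext_def)
  then have "(\<Sum>i<length ps. of_bool (ps ! i \<in> birkhoff (?c k)) * (w $ ?c (Suc i) - w $ ?c i))
      = (\<Sum>i<k. w $ ?c (Suc i) - w $ ?c i)"
    using assms(2)
    by (intro sum.mono_neutral_cong_right) (auto simp: birkhoff_chain_elem[OF ps] mem_set_take_iff)
  also have "\<dots> = w $ ?c k - w $ ?c 0" by (rule sum_lessThan_telescope)
  finally show ?thesis unfolding cell_def by (simp add: chain_affine_vertex chain_elem_0[OF ps])
qed

text \<open>The affine function is modular and dominates \<open>w\<close>, while \<open>w\<close> is
  supermodular. Equality at \<open>a\<close> and \<open>b\<close> squeezes the inequalities at the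
  join and the meet into equalities.\<close>

lemma cell_sublattice:
  assumes w: "supermodular w" and ps: "linext ps" and ab: "a \<in> cell w ps" "b \<in> cell w ps"
  shows "sup a b \<in> cell w ps" "inf a b \<in> cell w ps" "w $ a + w $ b = w $ sup a b + w $ inf a b"
  using ab w[unfolded supermodular_def, rule_format, of a b] chain_affine_modular[of w ps a b]
    chain_affine_ge[OF w ps, of "sup a b"] chain_affine_ge[OF w ps, of "inf a b"]
  unfolding cell_def by simp_all

section \<open>The polyhedron of the subdivision and its bounded facets\<close>

definition undergraph :: "real ^ 'a::{finite,distrib_lattice} \<Rightarrow> ((real, 'a) vec \<times> real) set" where
  "undergraph w = convex hull (\<Union>a. {lattice_vertex a} \<times> {..w $ a})"

lemma hibi_subdivision_undergraph:
  "hibi_subdivision w = {fst ` G | G. G facet_of undergraph w \<and> bounded G}"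
  unfolding hibi_subdivision_def regular_subdivision_def Let_def extreme_points_order_polytope undergraph_def
  by (simp add: inv_f_f[OF inj_lattice_vertex])

lemma undergraph_eq:
  "undergraph w = {(\<Sum>a\<in>UNIV. l a *\<^sub>R lattice_vertex a, s) | l s.
    (\<forall>a. 0 \<le> l a) \<and> sum l UNIV = 1 \<and> s \<le> (\<Sum>a\<in>UNIV. l a * w $ a)}" (is "_ = ?R")
proof
  have "convex ?R"
    unfolding convex_def
  proof (intro ballI allI impI)
    fix z z' and u v :: real assume "z \<in> ?R" "z' \<in> ?R" and uv: "0 \<le> u" "0 \<le> v" "u + v = 1"
    then obtain l s l' s' where z: "z = (\<Sum>a\<in>UNIV. l a *\<^sub>R lattice_vertex a, s)"
        "\<forall>a. 0 \<le> l a" "sum l UNIV = 1" "s \<le> (\<Sum>a\<in>UNIV. l a * w $ a)"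
      and z': "z' = (\<Sum>a\<in>UNIV. l' a *\<^sub>R lattice_vertex a, s')"
        "\<forall>a. 0 \<le> l' a" "sum l' UNIV = 1" "s' \<le> (\<Sum>a\<in>UNIV. l' a * w $ a)" by blast
    let ?l = "\<lambda>a. u * l a + v * l' a"
    have "u *\<^sub>R z + v *\<^sub>R z' = (\<Sum>a\<in>UNIV. ?l a *\<^sub>R lattice_vertex a, u * s + v * s')"
      unfolding z z' by (simp add: scaleR_sum_right sum.distrib algebra_simps)
    moreover have "\<forall>a. 0 \<le> ?l a" using uv z z' by simp
    moreover have "sum ?l UNIV = 1" using uv z z' by (simp add: sum.distrib flip: sum_distrib_left)
    moreover have "u * s + v * s' \<le> (\<Sum>a\<in>UNIV. ?l a * w $ a)"
    proof -
      have "u * s + v * s' \<le> u * (\<Sum>a\<in>UNIV. l a * w $ a) + v * (\<Sum>a\<in>UNIV. l' a * w $ a)"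
        using uv z z' by (intro add_mono mult_left_mono) auto
      then show ?thesis by (simp add: sum_distrib_left sum.distrib algebra_simps)
    qed
    ultimately show "u *\<^sub>R z + v *\<^sub>R z' \<in> ?R"
      by (intro CollectI exI[of _ ?l] exI[of _ "u * s + v * s'"] conjI)
  qed
  moreover have "(lattice_vertex a, s) \<in> ?R" if "s \<le> w $ a" for a s
    using that
    by (intro CollectI exI[of _ "\<lambda>b. of_bool (b = a)"] exI[of _ s])
      (auto simp: if_distrib[where f = "\<lambda>x. x *\<^sub>R _"] if_distrib[where f = "\<lambda>x. x * _"] of_bool_def cong: if_cong)
  ultimately show "undergraph w \<subseteq> ?R"
    unfolding undergraph_def by (intro hull_minimal) auto
  show "?R \<subseteq> undergraph w"
  proof
    fix z assume "z \<in> ?R"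
    then obtain l s where z: "z = (\<Sum>a\<in>UNIV. l a *\<^sub>R lattice_vertex a, s)"
        "\<forall>a. 0 \<le> l a" "sum l UNIV = 1" "s \<le> (\<Sum>a\<in>UNIV. l a * w $ a)" by blast
    \<comment> \<open>The slack is spread evenly: lowering every vertex by the same \<open>d\<close>
      lowers the combination by \<open>d\<close>, because the coefficients sum to 1.\<close>
    define d where "d = (\<Sum>a\<in>UNIV. l a * w $ a) - s"
    have "(\<Sum>a\<in>UNIV. l a * (w $ a - d)) = s"
      using z(3) by (simp add: right_diff_distrib sum_subtractf d_def flip: sum_distrib_right)
    then have "z = (\<Sum>a\<in>UNIV. l a *\<^sub>R (lattice_vertex a, w $ a - d))"
      unfolding z by (simp add: sum_prod)
    also have "\<dots> \<in> undergraph w"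
      unfolding undergraph_def using z by (intro convex_sum) (auto simp: d_def intro!: hull_inc)
    finally show "z \<in> undergraph w" .
  qed
qed

lemma chain_affine_sum:
  "sum l UNIV = 1 \<Longrightarrow> chain_affine w ps (\<Sum>a\<in>UNIV. l a *\<^sub>R lattice_vertex a)
    = (\<Sum>a\<in>UNIV. l a * chain_affine w ps (lattice_vertex a))"
proof -
  assume "sum l UNIV = 1"
  then have "w $ least_elem = (\<Sum>a\<in>UNIV. l a * w $ least_elem)"
    by (simp flip: sum_distrib_right)
  then show ?thesis
    unfolding chain_affine_def by (simp add: inner_sum_right distrib_left sum.distrib)
qed

lemma undergraph_le:
  assumes "supermodular w" "linext ps" "(x, s) \<in> undergraph w"
  shows "s \<le> chain_affine w ps x"
proof -
  obtain l where l: "x = (\<Sum>a\<in>UNIV. l a *\<^sub>R lattice_vertex a)" "\<forall>a. 0 \<le> l a" "sum l UNIV = 1"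
    "s \<le> (\<Sum>a\<in>UNIV. l a * w $ a)" using assms(3) unfolding undergraph_eq by blast
  note l(4)
  also have "(\<Sum>a\<in>UNIV. l a * w $ a) \<le> (\<Sum>a\<in>UNIV. l a * chain_affine w ps (lattice_vertex a))"
    using l(2) chain_affine_ge[OF assms(1,2)] by (intro sum_mono mult_left_mono) auto
  finally show ?thesis using chain_affine_sum[OF l(3)] l(1) by simp
qed

definition cell_face :: "real ^ 'a::{finite,distrib_lattice} \<Rightarrow> 'a list \<Rightarrow> ((real, 'a) vec \<times> real) set" where
  "cell_face w ps = {z \<in> undergraph w. snd z = chain_affine w ps (fst z)}"

lemma cell_face_face:
  assumes "supermodular w" "linext ps"
  shows "cell_face w ps face_of undergraph w"
proof -
  let ?a = "(- chain_vec w ps, 1 :: real)"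
  have "undergraph w \<inter> {z. ?a \<bullet> z = w $ least_elem} face_of undergraph w"
  proof (rule face_of_Int_supporting_hyperplane_le)
    show "convex (undergraph w)" by (simp add: undergraph_def convex_convex_hull)
    show "?a \<bullet> z \<le> w $ least_elem" if "z \<in> undergraph w" for z
      using undergraph_le[OF assms, of "fst z" "snd z"] that
      by (cases z) (simp add: chain_affine_def inner_prod_def)
  qed
  moreover have "undergraph w \<inter> {z. ?a \<bullet> z = w $ least_elem} = cell_face w ps"
    by (auto simp: cell_face_def chain_affine_def inner_prod_def)
  ultimately show ?thesis by simp
qed

text \<open>A convex combination on the supporting hyperplane gives positive coefficients only to
  vertices where \<open>w\<close> meets the affine function, since any other vertex would contribute
  a strict deficit.\<close>

lemma cell_face_eq:
  assumes "supermodular w" "linext ps"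
  shows "cell_face w ps = (\<lambda>x. (x, chain_affine w ps x)) ` (convex hull (lattice_vertex ` cell w ps))"
proof
  let ?V = "convex hull (lattice_vertex ` cell w ps)"
  show "cell_face w ps \<subseteq> (\<lambda>x. (x, chain_affine w ps x)) ` ?V"
  proof
    fix z assume z: "z \<in> cell_face w ps"
    then obtain l s where l: "z = (\<Sum>a\<in>UNIV. l a *\<^sub>R lattice_vertex a, s)" "\<forall>a. 0 \<le> l a" "sum l UNIV = 1"
      "s \<le> (\<Sum>a\<in>UNIV. l a * w $ a)" unfolding cell_face_def undergraph_eq by blast
    let ?d = "\<lambda>a. l a * (chain_affine w ps (lattice_vertex a) - w $ a)"
    have nn: "0 \<le> ?d a" for a using l(2) chain_affine_ge[OF assms] by (simp add: mult_nonneg_nonneg)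
    have "s = (\<Sum>a\<in>UNIV. l a * chain_affine w ps (lattice_vertex a))"
      using z l(1) chain_affine_sum[OF l(3)] by (simp add: cell_face_def)
    then have "sum ?d UNIV \<le> 0" using l(4) by (simp add: right_diff_distrib sum_subtractf)
    then have "sum ?d UNIV = 0" using nn by (simp add: order.antisym sum_nonneg)
    then have zero: "l a = 0" if "a \<notin> cell w ps" for a
      using nn that by (auto simp: sum_nonneg_eq_0_iff cell_def)
    have "fst z = (\<Sum>a\<in>cell w ps. l a *\<^sub>R lattice_vertex a)"
      unfolding l(1) fst_conv by (rule sum.mono_neutral_right) (auto simp: zero)
    also have "\<dots> \<in> ?V"
    proof (rule convex_sum)
      have "sum l (cell w ps) = sum l UNIV" by (rule sum.mono_neutral_left) (auto simp: zero)
      then show "sum l (cell w ps) = 1" using l(3) by simp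
    qed (use l in \<open>auto intro: hull_inc\<close>)
    finally show "z \<in> (\<lambda>x. (x, chain_affine w ps x)) ` ?V"
      using z by (auto simp: cell_face_def image_iff intro!: bexI[of _ "fst z"] prod_eqI)
  qed
  have "?V \<subseteq> {x. (x, chain_affine w ps x) \<in> undergraph w}"
  proof (rule hull_minimal)
    show "lattice_vertex ` cell w ps \<subseteq> {x. (x, chain_affine w ps x) \<in> undergraph w}"
      unfolding undergraph_def by (auto simp: cell_def intro!: hull_inc)
    show "convex {x. (x, chain_affine w ps x) \<in> undergraph w}"
      unfolding convex_def
    proof (intro ballI allI impI; simp)
      fix x y and u v :: real
      assume *: "(x, chain_affine w ps x) \<in> undergraph w" "(y, chain_affine w ps y) \<in> undergraph w"
        "0 \<le> u" "0 \<le> v" "u + v = 1"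
      have "convex (undergraph w)" by (simp add: undergraph_def convex_convex_hull)
      from convexD[OF this *]
      have "(u *\<^sub>R x + v *\<^sub>R y, u * chain_affine w ps x + v * chain_affine w ps y) \<in> undergraph w"
        by simp
      moreover have "u * chain_affine w ps x + v * chain_affine w ps y
          = (u + v) * w $ least_elem + chain_vec w ps \<bullet> (u *\<^sub>R x + v *\<^sub>R y)"
        by (simp add: chain_affine_def inner_add_right algebra_simps)
      ultimately show "(u *\<^sub>R x + v *\<^sub>R y, chain_affine w ps (u *\<^sub>R x + v *\<^sub>R y)) \<in> undergraph w"
        using \<open>u + v = 1\<close> by (simp add: chain_affine_def)
    qed
  qed
  then show "(\<lambda>x. (x, chain_affine w ps x)) ` ?V \<subseteq> cell_face w ps"
    by (auto simp: cell_face_def)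
qed

lemma undergraph_downward:
  assumes "(x, s) \<in> undergraph w" "t \<le> s"
  shows "(x, t) \<in> undergraph w"
  using assms unfolding undergraph_eq by force

lemma axis_mem_span_cell:
  assumes ps: "linext ps" and p: "p \<in> join_irreducibles"
  shows "axis p 1 \<in> span (lattice_vertex ` cell w ps)"
proof -
  have d: "distinct ps" "set ps = join_irreducibles" using ps by (auto simp: linext_def)
  then obtain i where i: "i < length ps" "p = ps ! i" using p by (metis in_set_conv_nth)
  have "ps ! i \<notin> set (take i ps)" using mem_set_take_iff[OF d(1) i(1), of i] by simp
  then have "axis p 1 = lattice_vertex (chain_elem ps (Suc i)) - lattice_vertex (chain_elem ps i)"
    by (auto simp: vec_eq_iff axis_def birkhoff_chain_elem[OF ps] set_take_Suc[OF i(1)] i(2))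
  also have "\<dots> \<in> span (lattice_vertex ` cell w ps)"
    using i(1) by (intro span_diff span_base imageI chain_elem_mem_cell[OF ps]) auto
  finally show ?thesis .
qed

text \<open>The dimensions are squeezed between \<open>card ?J\<close> for the cell face and
  \<open>card ?J + 1\<close> for the polyhedron, with a strict inequality in between. The lower
  bound holds because the zero vector is a vertex of the cell and the steps of the maximal chain
  yield all unit vectors of \<open>?J\<close>; the upper one because vertices vanish outside
  \<open>?J\<close>.\<close>

lemma aff_dim_cell_face:
  assumes w: "supermodular w" and ps: "linext ps"
  shows "aff_dim (cell_face w ps) = aff_dim (undergraph w) - 1"
proof -
  let ?V = "lattice_vertex ` cell w ps" and ?J = "join_irreducibles :: 'a set"
  let ?E = "(\<lambda>p. axis p 1 :: (real, 'a) vec) ` ?J"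
  have inj: "inj_on (\<lambda>p. axis p 1 :: (real, 'a) vec) ?J" by (auto simp: inj_on_def axis_eq_axis)
  have "least_elem \<in> cell w ps" using chain_elem_mem_cell[OF ps, of 0] chain_elem_0[OF ps] by simp
  moreover have "lattice_vertex (least_elem :: 'a) = (0 :: (real, 'a) vec)"
    by (simp add: vec_eq_iff birkhoff_least)
  ultimately have "0 \<in> ?V" by (metis imageI)
  then have "aff_dim (convex hull ?V) = int (dim ?V)"
    by (simp add: aff_dim_convex_hull aff_dim_zero hull_inc)
  moreover have "int (card ?J) \<le> int (dim ?V)"
  proof -
    have "?E \<subseteq> span ?V" using axis_mem_span_cell[OF ps] by blast
    moreover have "independent ?E"
      by (rule independent_mono[OF independent_Basis]) (auto simp: axis_in_Basis_iff)
    ultimately have "card ?E \<le> dim (span ?V)" by (rule independent_card_le_dim)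
    then show ?thesis using card_image[OF inj] by (simp add: dim_span)
  qed
  moreover have "fst ` cell_face w ps = convex hull ?V"
    unfolding cell_face_eq[OF w ps] by (simp add: image_image)
  then have "aff_dim (convex hull ?V) \<le> aff_dim (cell_face w ps)"
    using aff_dim_linear_image_le[OF linear_fst, of "cell_face w ps"] by simp
  moreover have "aff_dim (cell_face w ps) < aff_dim (undergraph w)"
  proof (rule face_of_aff_dim_lt)
    show "convex (undergraph w)" by (simp add: undergraph_def convex_convex_hull)
    show "cell_face w ps face_of undergraph w" by (rule cell_face_face[OF w ps])
    have "(lattice_vertex least_elem, w $ least_elem - 1) \<in> undergraph w"
      unfolding undergraph_def by (auto intro!: hull_inc)
    moreover have "(lattice_vertex least_elem, w $ least_elem - 1) \<notin> cell_face w ps"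
      using chain_affine_ge[OF w ps, of least_elem] by (auto simp: cell_face_def)
    ultimately show "cell_face w ps \<noteq> undergraph w" by blast
  qed
  moreover have "aff_dim (undergraph w) \<le> int (card ?J) + 1"
  proof -
    let ?B = "insert (0 :: (real, 'a) vec, 1 :: real) ((\<lambda>p. (axis p 1, 0)) ` ?J)"
    have "undergraph w \<subseteq> span ?B"
    proof (clarify)
      fix x s assume "(x, s) \<in> undergraph w"
      then obtain l where x: "x = (\<Sum>a\<in>UNIV. l a *\<^sub>R lattice_vertex a)" unfolding undergraph_eq by blast
      have "x $ p = 0" if "p \<notin> ?J" for p
      proof -
        have "p \<notin> birkhoff a" for a using that birkhoff_subset by blast
        then show ?thesis unfolding x by simp
      qed
      then have "x = (\<Sum>p\<in>?J. x $ p *\<^sub>R axis p 1)"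
        by (auto simp: vec_eq_iff axis_def if_distrib[where f = "\<lambda>x. _ * x"] cong: if_cong)
      then have "(x, s) = (\<Sum>p\<in>?J. x $ p *\<^sub>R (axis p 1, 0)) + s *\<^sub>R (0, 1)"
        by (simp add: sum_prod)
      also have "\<dots> \<in> span ?B" by (intro span_add span_sum span_scale span_base) auto
      finally show "(x, s) \<in> span ?B" .
    qed
    then have "aff_dim (undergraph w) \<le> aff_dim (span ?B)" by (rule aff_dim_subset)
    also have "\<dots> = int (dim ?B)" by (simp add: aff_dim_subspace)
    also have "dim ?B \<le> card ?B" by (rule dim_le_card) (auto intro: span_base)
    also have "card ?B \<le> Suc (card ((\<lambda>p. (axis p 1 :: (real, 'a) vec, 0 :: real)) ` ?J))"
      by (rule card_insert_le_m1) auto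
    also have "\<dots> \<le> Suc (card ?J)" by (simp add: card_image_le)
    finally show ?thesis by simp
  qed
  ultimately show ?thesis by linarith
qed

lemma cell_face_facet:
  assumes "supermodular w" "linext ps"
  shows "cell_face w ps facet_of undergraph w" "bounded (cell_face w ps)"
proof -
  have "least_elem \<in> cell w ps"
    using chain_elem_mem_cell[OF assms(2), of 0] chain_elem_0[OF assms(2)] by simp
  then have "cell_face w ps \<noteq> {}" unfolding cell_face_eq[OF assms] by auto
  then show "cell_face w ps facet_of undergraph w"
    using cell_face_face[OF assms] aff_dim_cell_face[OF assms] by (simp add: facet_of_def)
  have "compact (convex hull (lattice_vertex ` cell w ps))"
    by (simp add: finite_imp_compact_convex_hull)
  then have "compact (cell_face w ps)"
    unfolding cell_face_eq[OF assms] chain_affine_def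
    by (intro compact_continuous_image continuous_intros)
  then show "bounded (cell_face w ps)" by (rule compact_imp_bounded)
qed

text \<open>Above a relative interior point of \<open>G\<close>, the highest point of the polyhedron
  lies on the cell face of a chain whose simplex contains \<open>x\<close>. Were the given point
  lower, \<open>G\<close> would contain the whole ray below it and be unbounded. So the relative
  interior of \<open>G\<close> meets that cell face, which forces \<open>G\<close> into it, and
  equal dimensions finish the proof.\<close>

lemma bounded_facet_is_cell_face:
  assumes w: "supermodular w" and G: "G facet_of undergraph w" "bounded G"
  shows "\<exists>ps. linext ps \<and> G = cell_face w ps"
proof -
  have face: "G face_of undergraph w" and ne: "G \<noteq> {}" using G by (auto simp: facet_of_def)
  then have "rel_interior G \<noteq> {}" using face_of_imp_convex rel_interior_eq_empty by blast
  then obtain x s where z: "(x, s) \<in> rel_interior G" by auto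
  then have zG: "(x, s) \<in> G" using rel_interior_subset by blast
  then have zU: "(x, s) \<in> undergraph w" using face face_of_imp_subset by blast
  then obtain l where "x = (\<Sum>a\<in>UNIV. l a *\<^sub>R lattice_vertex a)" "\<forall>a. 0 \<le> l a" "sum l UNIV = 1"
    unfolding undergraph_eq by blast
  then have "x \<in> convex hull (range lattice_vertex)"
    using convex_sum[of UNIV "convex hull (range lattice_vertex)" l lattice_vertex]
    by (auto intro: hull_inc)
  then have "x \<in> order_polytope join_irreducibles (<)" by (simp add: order_polytope_eq_hull)
  from order_polytope_prefixes[OF is_order_on_less this]
  obtain ps where ps: "linext ps" "x \<in> convex hull ((\<lambda>i. ind_vec (set (take i ps))) ` {..length ps})"
    unfolding linext_def by blast
  have "(\<lambda>i. ind_vec (set (take i ps))) ` {..length ps} \<subseteq> lattice_vertex ` cell w ps"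
    using chain_elem_mem_cell[OF ps(1)]
    by (auto simp: lattice_vertex_eq simp flip: birkhoff_chain_elem[OF ps(1)])
  then have "x \<in> convex hull (lattice_vertex ` cell w ps)" using ps(2) hull_mono by blast
  then have top: "(x, chain_affine w ps x) \<in> cell_face w ps" unfolding cell_face_eq[OF w ps(1)] by blast
  then have topU: "(x, chain_affine w ps x) \<in> undergraph w" by (simp add: cell_face_def)
  have "s = chain_affine w ps x"
  proof (rule ccontr)
    assume "s \<noteq> chain_affine w ps x"
    then have lt: "s < chain_affine w ps x" using undergraph_le[OF w ps(1) zU] by simp
    have down: "(x, s - t) \<in> G" if "t > 0" for t
    proof -
      let ?S = "chain_affine w ps x"
      have "(x, s) \<in> open_segment (x, s - t) (x, ?S)"
        unfolding in_segment
      \<comment> \<open>The parameter at which the segment from height \<open>s - t\<close> to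
        height \<open>?S\<close> passes height \<open>s\<close>.\<close>
      proof (intro conjI exI[of _ "t / (?S - s + t)"])
        have pos: "0 < ?S - s + t" using lt that by simp
        then have "t / (?S - s + t) * (?S - s + t) = t" by simp
        moreover have "(1 - t / (?S - s + t)) * (s - t) + t / (?S - s + t) * ?S
            = s - t + t / (?S - s + t) * (?S - s + t)"
          by (simp only: left_diff_distrib right_diff_distrib distrib_left)
        ultimately have "s = (1 - t / (?S - s + t)) * (s - t) + t / (?S - s + t) * ?S" by simp
        then show "(x, s) = (1 - t / (?S - s + t)) *\<^sub>R (x, s - t) + (t / (?S - s + t)) *\<^sub>R (x, ?S)"
          by (simp add: scaleR_left_diff_distrib)
      qed (use lt that in auto)
      moreover have "(x, s - t) \<in> undergraph w" using undergraph_downward[OF zU] that by simp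
      ultimately show ?thesis using face zG topU unfolding face_of_def by blast
    qed
    obtain B where B: "\<And>z. z \<in> G \<Longrightarrow> norm z \<le> B" using G(2) by (auto simp: bounded_iff)
    \<comment> \<open>At this depth the height alone exceeds \<open>B\<close> in absolute
      value.\<close>
    have "norm (x, s - (\<bar>B\<bar> + \<bar>s\<bar> + 1)) \<le> B" by (intro B down) auto
    moreover have "norm (s - (\<bar>B\<bar> + \<bar>s\<bar> + 1)) \<le> norm (x, s - (\<bar>B\<bar> + \<bar>s\<bar> + 1))" by (rule norm_snd_le)
    ultimately show False by simp
  qed
  then have "(x, s) \<in> cell_face w ps \<inter> rel_interior G" using top z by simp
  then have sub: "G \<subseteq> cell_face w ps"
    using subset_of_face_of[OF cell_face_face[OF w ps(1)] face_of_imp_subset[OF face]] by blast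
  have cf: "cell_face w ps \<subseteq> undergraph w" by (auto simp: cell_face_def)
  have "G = cell_face w ps"
  proof (rule ccontr)
    assume "G \<noteq> cell_face w ps"
    moreover have "convex (cell_face w ps)" using cell_face_face[OF w ps(1)] face_of_imp_convex by blast
    ultimately have "aff_dim G < aff_dim (cell_face w ps)"
      using face_of_aff_dim_lt face_of_subset[OF face sub cf] by blast
    then show False using G(1) aff_dim_cell_face[OF w ps(1)] by (simp add: facet_of_def)
  qed
  then show ?thesis using ps(1) by blast
qed

lemma hibi_subdivision_cells:
  assumes w: "supermodular w"
  shows "hibi_subdivision w = (\<lambda>ps. convex hull (lattice_vertex ` cell w ps)) ` Collect linext"
proof -
  have "fst ` cell_face w ps = convex hull (lattice_vertex ` cell w ps)" if "linext ps" for ps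
    unfolding cell_face_eq[OF w that] by (simp add: image_image)
  moreover have "{G. G facet_of undergraph w \<and> bounded G} = cell_face w ` Collect linext"
    using cell_face_facet[OF w] bounded_facet_is_cell_face[OF w] by blast
  ultimately show ?thesis
    unfolding hibi_subdivision_undergraph setcompr_eq_image by (simp add: image_image)
qed

text \<open>A sublattice containing a maximal chain separates the join-irreducibles, so it is the lattice of ideals
  of the order in which \<open>q\<close> lies below \<open>p\<close> if every member above \<open>p\<close> is above \<open>q\<close>.\<close>

lemma sublattice_order_ideals:
  assumes ps: "linext ps" and chain: "\<And>i. i \<le> length ps \<Longrightarrow> chain_elem ps i \<in> M"
    and lat: "\<And>a b. a \<in> M \<Longrightarrow> b \<in> M \<Longrightarrow> sup a b \<in> M \<and> inf a b \<in> M"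
  shows "\<exists>lt. is_order_on join_irreducibles lt \<and> order_ideals join_irreducibles lt = birkhoff ` M"
proof -
  define lt where "lt = (\<lambda>q p. q \<noteq> p \<and> (\<forall>a\<in>M. p \<in> birkhoff a \<longrightarrow> q \<in> birkhoff a))"
  have d: "distinct ps" "set ps = join_irreducibles" using ps by (auto simp: linext_def)
  have sep: "\<exists>a\<in>M. (p \<in> birkhoff a) \<noteq> (q \<in> birkhoff a)"
    if pq: "p \<in> join_irreducibles" "q \<in> join_irreducibles" "p \<noteq> q" for p q
  proof -
    obtain i j where ij: "i < length ps" "p = ps ! i" "j < length ps" "q = ps ! j"
      using pq d(2) by (metis in_set_conv_nth)
    then have "i \<noteq> j" using pq(3) by blast
    have "chain_elem ps (Suc (min i j)) \<in> M" using ij by (intro chain) auto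
    moreover have "(p \<in> birkhoff (chain_elem ps (Suc (min i j)))) \<noteq> (q \<in> birkhoff (chain_elem ps (Suc (min i j))))"
      using \<open>i \<noteq> j\<close> ij unfolding birkhoff_chain_elem[OF ps] by (auto simp: mem_set_take_iff[OF d(1)])
    ultimately show ?thesis by blast
  qed
  have "is_order_on join_irreducibles lt"
    unfolding is_order_on_def
  proof
    show "irreflp_on join_irreducibles lt" by (auto simp: irreflp_on_def lt_def)
    show "transp_on join_irreducibles lt"
      unfolding transp_on_def
    proof (intro ballI impI)
      fix r q p assume J: "r \<in> join_irreducibles" "q \<in> join_irreducibles" "p \<in> join_irreducibles"
        and "lt r q" "lt q p"
      moreover have "r \<noteq> p" using sep[OF J(2,3)] \<open>lt r q\<close> \<open>lt q p\<close> unfolding lt_def by blast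
      ultimately show "lt r p" unfolding lt_def by blast
    qed
  qed
  moreover have "order_ideals join_irreducibles lt = birkhoff ` M"
  proof
    show "birkhoff ` M \<subseteq> order_ideals join_irreducibles lt"
      using birkhoff_subset unfolding order_ideals_def lt_def by auto
    have inter: "\<exists>a\<in>M. birkhoff a = join_irreducibles \<inter> (\<Inter>b\<in>B. birkhoff b)" if "finite B" "B \<subseteq> M" for B
      using that
    proof induction
      case empty
      have "birkhoff (chain_elem ps (length ps)) = join_irreducibles"
        using d(2) by (simp add: birkhoff_chain_elem[OF ps])
      then show ?case using chain[of "length ps"] by auto
    next
      case (insert b B)
      then obtain a where "a \<in> M" "birkhoff a = join_irreducibles \<inter> (\<Inter>b\<in>B. birkhoff b)" by auto
      then show ?case using lat[of a b] insert.prems by (intro bexI[of _ "inf a b"]) (auto simp: birkhoff_inf)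
    qed
    have union: "\<exists>a\<in>M. birkhoff a = (\<Union>b\<in>B. birkhoff b)" if "finite B" "B \<subseteq> M" for B
      using that
    proof induction
      case empty
      then show ?case
        using chain[of 0] by (intro bexI[of _ "chain_elem ps 0"]) (auto simp: birkhoff_chain_elem[OF ps])
    next
      case (insert b B)
      then obtain a where "a \<in> M" "birkhoff a = (\<Union>b\<in>B. birkhoff b)" by auto
      then show ?case using lat[of a b] insert.prems by (intro bexI[of _ "sup a b"]) (auto simp: birkhoff_sup)
    qed
    show "order_ideals join_irreducibles lt \<subseteq> birkhoff ` M"
    proof
      fix D assume "D \<in> order_ideals join_irreducibles lt"
      then have D: "D \<subseteq> join_irreducibles" "\<And>p q. p \<in> D \<Longrightarrow> q \<in> join_irreducibles \<Longrightarrow> lt q p \<Longrightarrow> q \<in> D"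
        unfolding order_ideals_def by blast+
      have "\<exists>a\<in>M. birkhoff a = join_irreducibles \<inter> (\<Inter>b\<in>{b \<in> M. p \<in> birkhoff b}. birkhoff b)" for p
        by (rule inter) auto
      then obtain f where f: "\<And>p. f p \<in> M"
        "\<And>p. birkhoff (f p) = join_irreducibles \<inter> (\<Inter>b\<in>{b \<in> M. p \<in> birkhoff b}. birkhoff b)"
        by metis
      have "\<exists>a\<in>M. birkhoff a = (\<Union>b\<in>f ` D. birkhoff b)" using f(1) by (intro union) auto
      moreover have "(\<Union>b\<in>f ` D. birkhoff b) = D"
      proof
        show "D \<subseteq> (\<Union>b\<in>f ` D. birkhoff b)" using D(1) f(2) by auto
        show "(\<Union>b\<in>f ` D. birkhoff b) \<subseteq> D"
        proof (clarify)
          fix p q assume "p \<in> D" "q \<in> birkhoff (f p)"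
          then have "q \<in> join_irreducibles" "q = p \<or> lt q p" unfolding f(2) lt_def by auto
          then show "q \<in> D" using D(2) \<open>p \<in> D\<close> by blast
        qed
      qed
      ultimately show "D \<in> birkhoff ` M" by (metis imageI)
    qed
  qed
  ultimately show ?thesis by blast
qed

lemma cell_order:
  assumes "supermodular w" "linext ps"
  shows "\<exists>lt. is_order_on join_irreducibles lt \<and> order_ideals join_irreducibles lt = birkhoff ` cell w ps \<and>
    convex hull (lattice_vertex ` cell w ps) = order_polytope join_irreducibles lt \<and>
    lattice_points (convex hull (lattice_vertex ` cell w ps)) = lattice_vertex ` cell w ps"
proof -
  obtain lt where lt: "is_order_on join_irreducibles lt"
    "order_ideals join_irreducibles lt = birkhoff ` cell w ps"
    using sublattice_order_ideals[of ps "cell w ps"] chain_elem_mem_cell[OF assms(2)]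
      cell_sublattice(1,2)[OF assms] assms(2) by metis
  then have "ind_vec ` order_ideals join_irreducibles lt = lattice_vertex ` cell w ps"
    by (simp add: image_image lattice_vertex_eq)
  then show ?thesis
    using lt order_polytope_hull[OF lt(1)] lattice_points_order_polytope[of join_irreducibles lt]
    by (intro exI[of _ lt]) simp
qed

section \<open>Supports of tight monomials and comparison of cells\<close>

lemma chain_monomial_linext:
  assumes "chain_monomial n"
  shows "\<exists>ps. linext ps \<and> Poly_Mapping.keys n \<subseteq> chain_elem ps ` {..length ps}"
proof -
  have mono: "real (height n p) \<le> real (height n q)" if "q < p" for p q
    unfolding height_def of_nat_le_iff using that by (intro sum_mono2) auto
  \<comment> \<open>Join-irreducibles are listed by decreasing height in \<open>n\<close>, so that
    the ideal of each variable of \<open>n\<close> becomes a prefix.\<close>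
  obtain ps where ps: "linext ps" "sorted_wrt (\<lambda>p q. real (height n q) \<le> real (height n p)) ps"
    using ex_linear_extension[of join_irreducibles "(<)" "\<lambda>p. real (height n p)"] mono
      is_order_on_less[of join_irreducibles]
    unfolding linext_def by auto
  have d: "distinct ps" "set ps = join_irreducibles" using ps(1) by (auto simp: linext_def)
  have "c \<in> chain_elem ps ` {..length ps}" if c: "c \<in> Poly_Mapping.keys n" for c
  proof -
    let ?k = "length (takeWhile (\<lambda>p. p \<in> birkhoff c) ps)"
    \<comment> \<open>A variable of \<open>n\<close> above \<open>q\<close> differs from
      \<open>c\<close> and, by the chain condition, lies above \<open>c\<close> and hence above
      \<open>p\<close>. The variable \<open>c\<close> itself counts for \<open>p\<close>
      only.\<close>
    have height_less: "height n q < height n p" if "p \<le> c" "\<not> q \<le> c" for p q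
    proof -
      have "d \<in> Poly_Mapping.keys n \<Longrightarrow> q \<le> d \<Longrightarrow> c \<le> d" for d
        using assms c that order.trans unfolding chain_monomial_def by blast
      then have sub: "{a. q \<le> a} \<inter> Poly_Mapping.keys n \<subseteq> {a. p \<le> a} - {c}"
        using that by (auto intro: order.trans)
      have "height n q = (\<Sum>a\<in>{a. q \<le> a} \<inter> Poly_Mapping.keys n. Poly_Mapping.lookup n a)"
        unfolding height_def by (rule sum.mono_neutral_right) (auto simp: in_keys_iff)
      also have "\<dots> \<le> (\<Sum>a\<in>{a. p \<le> a} - {c}. Poly_Mapping.lookup n a)"
        using sub by (intro sum_mono2) auto
      also have "\<dots> < (\<Sum>a\<in>{a. p \<le> a} - {c}. Poly_Mapping.lookup n a) + Poly_Mapping.lookup n c"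
        using c by (simp add: in_keys_iff)
      also have "\<dots> = height n p" unfolding height_def using that by (simp add: sum.remove[of _ c])
      finally show ?thesis .
    qed
    have "birkhoff c = set (take ?k ps)"
    proof
      have "set (take ?k ps) = set (takeWhile (\<lambda>p. p \<in> birkhoff c) ps)" by (simp flip: takeWhile_eq_take)
      then show "set (take ?k ps) \<subseteq> birkhoff c" using set_takeWhileD by fastforce
      show "birkhoff c \<subseteq> set (take ?k ps)"
      proof
        fix p assume p: "p \<in> birkhoff c"
        then obtain j where j: "j < length ps" "p = ps ! j"
          using d(2) birkhoff_subset by (metis in_set_conv_nth subsetD)
        have "j < ?k"
        proof (rule ccontr)
          assume "\<not> j < ?k"
          then have k: "?k < length ps" using j by simp
          then have q: "ps ! ?k \<notin> birkhoff c" using nth_length_takeWhile[of "\<lambda>p. p \<in> birkhoff c" ps] by blast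
          then have "?k \<noteq> j" using p j by auto
          then have "?k < j" using \<open>\<not> j < ?k\<close> by simp
          then have "height n (ps ! j) \<le> height n (ps ! ?k)"
            using sorted_wrt_nth_less[OF ps(2) _ j(1)] by simp
          moreover have "ps ! ?k \<in> join_irreducibles" using k d(2) nth_mem by blast
          ultimately show False
            using height_less[of p "ps ! ?k"] p q j(2) by (auto simp: birkhoff_def)
        qed
        then show "p \<in> set (take ?k ps)" using j mem_set_take_iff[OF d(1) j(1)] by simp
      qed
    qed
    then have "c = chain_elem ps ?k" using eq_birkhoff birkhoff_chain_elem[OF ps(1)] by metis
    then show ?thesis using length_takeWhile_le by blast
  qed
  then show ?thesis using ps(1) by blast
qed

text \<open>With the affine function as weight, the weight of a monomial depends on its heights only
  and is therefore constant on fibres.\<close>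

lemma grad_chain_affine:
  assumes ps: "linext ps"
  shows "(\<Sum>a\<in>UNIV. real (Poly_Mapping.lookup m a) * chain_affine w ps (lattice_vertex a))
    = real (height m least_elem) * w $ least_elem + (\<Sum>i<length ps. real (height m (ps ! i)) *
      (w $ chain_elem ps (Suc i) - w $ chain_elem ps i))"
proof -
  have J: "ps ! i \<in> join_irreducibles" if "i < length ps" for i
    using ps nth_mem[OF that] by (auto simp: linext_def)
  have h: "real (height m p) = (\<Sum>a\<in>UNIV. real (Poly_Mapping.lookup m a) * of_bool (p \<le> a))" for p
    unfolding height_def of_nat_sum by (rule sum.mono_neutral_cong_left) auto
  have "(\<Sum>a\<in>UNIV. real (Poly_Mapping.lookup m a) * chain_affine w ps (lattice_vertex a))
    = (\<Sum>a\<in>UNIV. real (Poly_Mapping.lookup m a) * w $ least_elem)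
      + (\<Sum>a\<in>UNIV. \<Sum>i<length ps. real (Poly_Mapping.lookup m a) * (of_bool (ps ! i \<le> a) *
          (w $ chain_elem ps (Suc i) - w $ chain_elem ps i)))"
    unfolding chain_affine_vertex distrib_left sum.distrib sum_distrib_left
    using J by (simp add: birkhoff_def)
  also have "(\<Sum>a\<in>UNIV. \<Sum>i<length ps. real (Poly_Mapping.lookup m a) * (of_bool (ps ! i \<le> a) *
          (w $ chain_elem ps (Suc i) - w $ chain_elem ps i)))
      = (\<Sum>i<length ps. real (height m (ps ! i)) * (w $ chain_elem ps (Suc i) - w $ chain_elem ps i))"
    by (subst sum.swap) (simp only: h sum_distrib_right mult.assoc)
  finally show ?thesis by (simp add: height_def sum_distrib_right)
qed

text \<open>Measured by the affine function, \<open>m\<close> and \<open>std m\<close> weigh the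
  same; measured by \<open>w\<close> they do so by tightness, and on \<open>std m\<close> both
  measures agree. Hence they agree on \<open>m\<close> in total and, as the affine function
  dominates \<open>w\<close>, at each variable of \<open>m\<close>.\<close>

lemma tight_keys_subset_cell:
  assumes w: "supermodular w" and m: "tight w m" and ps: "linext ps" "Poly_Mapping.keys (std m) \<subseteq> cell w ps"
  shows "Poly_Mapping.keys m \<subseteq> cell w ps"
proof -
  let ?A = "\<lambda>a. chain_affine w ps (lattice_vertex a)"
  have "w $ a = ?A a" if "a \<in> Poly_Mapping.keys (std m)" for a
    using that ps(2) by (auto simp: cell_def)
  then have "grad w (std m) = (\<Sum>a\<in>UNIV. real (Poly_Mapping.lookup (std m) a) * ?A a)"
    unfolding grad_def by (intro sum.cong) (auto simp: in_keys_iff)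
  also have "\<dots> = (\<Sum>a\<in>UNIV. real (Poly_Mapping.lookup m a) * ?A a)"
  proof -
    have "height (std m) p = height m p" if "p \<in> join_primes" for p
      using that same_fiber_std[of m] by (simp add: same_fiber_def)
    moreover have "ps ! i \<in> join_primes" if "i < length ps" for i
      using ps(1) nth_mem[OF that] join_irreducibles_subset by (auto simp: linext_def)
    ultimately show ?thesis unfolding grad_chain_affine[OF ps(1)] by (simp add: least_elem_join_prime)
  qed
  finally have "(\<Sum>a\<in>UNIV. real (Poly_Mapping.lookup m a) * (?A a - w $ a)) = 0"
    using m by (simp add: tight_def grad_def right_diff_distrib sum_subtractf)
  moreover have "0 \<le> real (Poly_Mapping.lookup m a) * (?A a - w $ a)" for a
    using chain_affine_ge[OF w ps(1), of a] by (intro mult_nonneg_nonneg) auto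
  ultimately have zero: "real (Poly_Mapping.lookup m a) * (?A a - w $ a) = 0" for a
    by (simp add: sum_nonneg_eq_0_iff)
  have "w $ a = ?A a" if "a \<in> Poly_Mapping.keys m" for a
    using that zero[of a] by (simp add: in_keys_iff)
  then show ?thesis by (auto simp: cell_def)
qed

lemma tight_support_subset_cell:
  assumes w: "supermodular w" and m: "tight w m"
  shows "\<exists>ps. linext ps \<and> Poly_Mapping.keys m \<subseteq> cell w ps"
proof -
  obtain ps where ps: "linext ps" "Poly_Mapping.keys (std m) \<subseteq> chain_elem ps ` {..length ps}"
    using chain_monomial_linext[OF chain_std] by blast
  then have "Poly_Mapping.keys (std m) \<subseteq> cell w ps" using chain_elem_mem_cell[OF ps(1)] by blast
  then show ?thesis using tight_keys_subset_cell[OF w m ps(1)] ps(1) by blast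
qed

text \<open>The affine function of \<open>ps'\<close> takes the values of \<open>w\<close> on the
  maximal chain of \<open>ps\<close>, and these values determine it on all vertices. So both cells
  are defined by the same function.\<close>

lemma cell_maximal:
  assumes "linext ps" "linext ps'" "cell w ps \<subseteq> cell w ps'"
  shows "cell w ps = cell w ps'"
proof -
  have el: "w $ chain_elem ps i = chain_affine w ps' (lattice_vertex (chain_elem ps i))" if "i \<le> length ps" for i
    using subsetD[OF assms(3) chain_elem_mem_cell[OF assms(1) that]] by (simp add: cell_def)
  have inner: "chain_vec w ps' \<bullet> axis (ps ! i) 1 = w $ chain_elem ps (Suc i) - w $ chain_elem ps i"
    if i: "i < length ps" for i
  proof -
    have "ps ! i \<notin> set (take i ps)"
      using mem_set_take_iff[of ps i i] i assms(1) by (simp add: linext_def)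
    then have "axis (ps ! i) 1 = lattice_vertex (chain_elem ps (Suc i)) - lattice_vertex (chain_elem ps i)"
      by (auto simp: vec_eq_iff axis_def birkhoff_chain_elem[OF assms(1)] set_take_Suc[OF i])
    then show ?thesis using el[of i] el[of "Suc i"] i by (simp add: chain_affine_def inner_diff_right)
  qed
  have "chain_affine w ps' (lattice_vertex a) = chain_affine w ps (lattice_vertex a)" for a
  proof -
    have "(lattice_vertex a :: (real, 'a) vec) $ p
        = (\<Sum>i<length ps. of_bool (ps ! i \<in> birkhoff a) * (axis (ps ! i) 1 :: (real, 'a) vec) $ p)" for p
    proof -
      have "(\<Sum>i<length ps. of_bool (ps ! i \<in> birkhoff a) * (axis (ps ! i) 1 :: (real, 'a) vec) $ p)
        = (\<Sum>q\<in>set ps. of_bool (q \<in> birkhoff a) * (axis q 1 :: (real, 'a) vec) $ p)"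
        using assms(1) unfolding linext_def
        by (intro sum.reindex_bij_betw bij_betw_nth) auto
      also have "\<dots> = (\<Sum>q\<in>set ps. if q = p then of_bool (p \<in> birkhoff a) else 0)"
        by (rule sum.cong) (auto simp: axis_def)
      finally show ?thesis using assms(1) birkhoff_subset[of a] by (auto simp: linext_def)
    qed
    then have "lattice_vertex a = (\<Sum>i<length ps. of_bool (ps ! i \<in> birkhoff a) *\<^sub>R axis (ps ! i) (1::real))"
      by (simp only: vec_eq_iff sum_component vector_scaleR_component real_scaleR_def simp_thms)
    then have "chain_vec w ps' \<bullet> lattice_vertex a
        = (\<Sum>i<length ps. of_bool (ps ! i \<in> birkhoff a) * (w $ chain_elem ps (Suc i) - w $ chain_elem ps i))"
      using inner by (simp only: inner_sum_right inner_scaleR_right) (rule sum.cong, auto)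
    then show ?thesis unfolding chain_affine_vertex[of w ps] by (simp add: chain_affine_def)
  qed
  then show ?thesis by (simp add: cell_def)
qed

text \<open>Membership in a cell is equality in an inequality that is linear in the weight and valid
  on \<open>F\<close>. For two points of the relative interior, the inclusions in both directions
  give equal cells.\<close>

lemma cell_constant:
  assumes F: "convex F" "F \<subseteq> Collect supermodular" "w \<in> rel_interior F" "w' \<in> F" and ps: "linext ps"
  shows "cell w ps \<subseteq> cell w' ps"
proof
  fix a assume a: "a \<in> cell w ps"
  define L where "L = (\<lambda>u. chain_affine u ps (lattice_vertex a) - u $ a)"
  define b :: "nat \<Rightarrow> real" where "b = (\<lambda>i. of_bool (ps ! i \<in> birkhoff a))"
  have "linear L"
    unfolding L_def chain_affine_vertex b_def[symmetric, THEN fun_cong]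
    by (intro linearI) (simp_all add: algebra_simps sum.distrib sum_subtractf scaleR_sum_right sum_distrib_left)
  moreover have "0 \<le> L u" if "u \<in> F" for u
    using chain_affine_ge[OF _ ps, of u a] that F(2) by (auto simp: L_def)
  moreover have "L w = 0" using a by (simp add: L_def cell_def)
  ultimately have "L w' = 0" using rel_interior_valid_inequality[OF F(1,3,4)] by blast
  then show "a \<in> cell w' ps" by (simp add: L_def cell_def)
qed

lemma tight_constant:
  assumes F: "convex F" "F \<subseteq> Collect supermodular" "w \<in> rel_interior F" "w' \<in> F" and m: "tight w m"
  shows "tight w' m"
proof -
  define L where "L = (\<lambda>u. grad u (std m) - grad u m)"
  have "linear L"
    unfolding L_def grad_def
    by (intro linearI) (simp_all add: algebra_simps sum.distrib sum_subtractf scaleR_sum_right sum_distrib_left)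
  moreover have "0 \<le> L u" if "u \<in> F" for u
    using grad_std_le[of u m] that F(2) by (auto simp: L_def)
  moreover have "L w = 0" using m by (simp add: L_def tight_def)
  ultimately have "L w' = 0" using rel_interior_valid_inequality[OF F(1,3,4)] by blast
  then show ?thesis by (simp add: L_def tight_def)
qed

section \<open>Irreducible components\<close>

definition proj_set :: "('b \<Rightarrow> complex) set \<Rightarrow> 'b ppoint set" where
  "proj_set C = {proj_point x | x. x \<in> C \<and> (\<exists>i. x i \<noteq> 0)}"

definition scale_closed :: "('b \<Rightarrow> complex) set \<Rightarrow> bool" where
  "scale_closed C \<longleftrightarrow> (\<forall>x\<in>C. \<forall>c. (\<lambda>i. c * x i) \<in> C)"

lemma mem_proj_point: "y \<in> proj_point x \<longleftrightarrow> (\<exists>c. y = (\<lambda>i. c * x i))"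
  by (auto simp: proj_point_def)

lemma self_mem_proj_point: "x \<in> proj_point x"
  unfolding mem_proj_point by (intro exI[of _ 1]) simp

lemma proj_point_mem_proj_set:
  assumes "scale_closed C" "\<exists>i. x i \<noteq> 0"
  shows "proj_point x \<in> proj_set C \<longleftrightarrow> x \<in> C"
proof
  assume "proj_point x \<in> proj_set C"
  then obtain y where y: "y \<in> C" "proj_point x = proj_point y" unfolding proj_set_def by blast
  then obtain c where "x = (\<lambda>i. c * y i)" using self_mem_proj_point[of x] by (auto simp: mem_proj_point)
  then show "x \<in> C" using assms(1) y(1) by (simp add: scale_closed_def)
qed (use assms in \<open>auto simp: proj_set_def\<close>)

lemma proj_zeros_eq_proj_set:
  "proj_zeros A S =
    proj_set {x. (\<forall>i. i \<notin> A \<longrightarrow> x i = 0) \<and> (\<forall>p\<in>S. \<forall>c. cpoly_eval p (\<lambda>i. c * x i) = 0)}"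
proof -
  have "(\<forall>y\<in>proj_point x. cpoly_eval p y = 0) \<longleftrightarrow> (\<forall>c. cpoly_eval p (\<lambda>i. c * x i) = 0)" for p x
    by (simp add: proj_point_def)
  then show ?thesis unfolding proj_zeros_def proj_space_def proj_set_def by blast
qed

lemma proj_zeros_ideal_generated: "proj_zeros A (ideal_generated S) = proj_zeros A S"
proof -
  interpret module "(*) :: 'a cpoly \<Rightarrow> 'a cpoly \<Rightarrow> 'a cpoly" by (rule module_mult)
  have "(\<forall>p\<in>ideal_generated S. cpoly_eval p x = 0) \<longleftrightarrow> (\<forall>p\<in>S. cpoly_eval p x = 0)" for x
  proof
    assume "\<forall>p\<in>S. cpoly_eval p x = 0"
    then have "span S \<subseteq> {p. cpoly_eval p x = 0}"
      by (intro span_minimal) (auto simp: subspace_def)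
    then show "\<forall>p\<in>ideal_generated S. cpoly_eval p x = 0" by (auto simp: ideal_generated_def)
  qed (auto simp: ideal_generated_def intro: span_base)
  then show ?thesis unfolding proj_zeros_def by blast
qed

definition sublattice :: "'a::lattice set \<Rightarrow> bool" where
  "sublattice M \<longleftrightarrow> (\<forall>a\<in>M. \<forall>b\<in>M. sup a b \<in> M \<and> inf a b \<in> M)"

definition hibi_affine_cone :: "'a::lattice set \<Rightarrow> ('a \<Rightarrow> complex) set" where
  "hibi_affine_cone M = {x. (\<forall>a. a \<notin> M \<longrightarrow> x a = 0) \<and> (\<forall>a\<in>M. \<forall>b\<in>M. x a * x b = x (sup a b) * x (inf a b))}"

lemma scale_closed_hibi_affine_cone: "scale_closed (hibi_affine_cone M)"
  unfolding scale_closed_def hibi_affine_cone_def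
proof (safe)
  fix x :: "'a \<Rightarrow> complex" and c a b
  assume "a \<in> M" "b \<in> M" "\<forall>a\<in>M. \<forall>b\<in>M. x a * x b = x (sup a b) * x (inf a b)"
  then have "x a * x b = x (sup a b) * x (inf a b)" by blast
  moreover have "c * x a * (c * x b) = c * c * (x a * x b)"
    "c * x (sup a b) * (c * x (inf a b)) = c * c * (x (sup a b) * x (inf a b))" by simp_all
  ultimately show "c * x a * (c * x b) = c * x (sup a b) * (c * x (inf a b))" by simp
qed simp

text \<open>The labelling \<open>g\<close> is kept general because two coordinate systems occur:
  vertices of the order polytope for toric varieties and order ideals for Hibi varieties.\<close>

lemma proj_zeros_hibi_relations:
  assumes g: "inj g"
  shows "proj_zeros (g ` M) {Xvar (g a) * Xvar (g b) - Xvar (g (sup a b)) * Xvar (g (inf a b)) | a b. a \<in> M \<and> b \<in> M}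
    = proj_set {x. (\<forall>i. i \<notin> g ` M \<longrightarrow> x i = 0) \<and> x \<circ> g \<in> hibi_affine_cone M}"
    (is "proj_zeros _ ?S = _")
proof -
  have "(\<forall>p\<in>?S. \<forall>c. cpoly_eval p (\<lambda>i. c * x i) = 0) \<longleftrightarrow> x \<circ> g \<in> hibi_affine_cone M"
    if x: "\<forall>i. i \<notin> g ` M \<longrightarrow> x i = 0" for x
  proof
    assume *: "\<forall>p\<in>?S. \<forall>c. cpoly_eval p (\<lambda>i. c * x i) = 0"
    have "x (g a) * x (g b) = x (g (sup a b)) * x (g (inf a b))" if "a \<in> M" "b \<in> M" for a b
    proof -
      have "Xvar (g a) * Xvar (g b) - Xvar (g (sup a b)) * Xvar (g (inf a b)) \<in> ?S" using that by blast
      then have "cpoly_eval (Xvar (g a) * Xvar (g b) - Xvar (g (sup a b)) * Xvar (g (inf a b))) (\<lambda>i. 1 * x i) = 0"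
        using * by blast
      then show ?thesis by simp
    qed
    moreover have "x (g a) = 0" if "a \<notin> M" for a
      using that x g by (auto dest: injD)
    ultimately show "x \<circ> g \<in> hibi_affine_cone M" by (simp add: hibi_affine_cone_def)
  next
    assume "x \<circ> g \<in> hibi_affine_cone M"
    then have "(\<lambda>i. c * x i) \<circ> g \<in> hibi_affine_cone M" for c
      using scale_closed_hibi_affine_cone[of M] by (simp add: scale_closed_def comp_def)
    then have "c * x (g a) * (c * x (g b)) = c * x (g (sup a b)) * (c * x (g (inf a b)))" if "a \<in> M" "b \<in> M" for a b c
      using that unfolding hibi_affine_cone_def comp_def by blast
    then show "\<forall>p\<in>?S. \<forall>c. cpoly_eval p (\<lambda>i. c * x i) = 0" by auto
  qed
  then show ?thesis unfolding proj_zeros_eq_proj_set by (intro arg_cong[where f = proj_set]) blast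
qed

lemma coord_embed_proj_set:
  assumes g: "inj g" and C: "\<And>x a. x \<in> C \<Longrightarrow> a \<notin> M \<Longrightarrow> x a = 0"
  shows "coord_embed g ` proj_set {x. (\<forall>i. i \<notin> g ` M \<longrightarrow> x i = 0) \<and> x \<circ> g \<in> C} = proj_set C"
proof -
  have embed: "coord_embed g (proj_point x) = proj_point (x \<circ> g)" for x
    unfolding coord_embed_def proj_point_def by (auto simp: image_image comp_def)
  show ?thesis
  proof
    show "coord_embed g ` proj_set {x. (\<forall>i. i \<notin> g ` M \<longrightarrow> x i = 0) \<and> x \<circ> g \<in> C} \<subseteq> proj_set C"
    proof (clarify)
      fix l assume "l \<in> proj_set {x. (\<forall>i. i \<notin> g ` M \<longrightarrow> x i = 0) \<and> x \<circ> g \<in> C}"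
      then obtain x i where x: "l = proj_point x" "\<forall>i. i \<notin> g ` M \<longrightarrow> x i = 0" "x \<circ> g \<in> C" "x i \<noteq> 0"
        unfolding proj_set_def by blast
      then obtain a where "i = g a" by blast
      then have "(x \<circ> g) a \<noteq> 0" using x(4) by simp
      then show "coord_embed g l \<in> proj_set C" using x(3) unfolding proj_set_def x(1) embed by blast
    qed
    show "proj_set C \<subseteq> coord_embed g ` proj_set {x. (\<forall>i. i \<notin> g ` M \<longrightarrow> x i = 0) \<and> x \<circ> g \<in> C}"
    proof
      fix l assume "l \<in> proj_set C"
      then obtain y a where y: "l = proj_point y" "y \<in> C" "y a \<noteq> 0" unfolding proj_set_def by blast
      define x where "x = (\<lambda>i. if i \<in> range g then y (inv g i) else 0)"
      have xg: "x \<circ> g = y" using g by (auto simp: x_def fun_eq_iff)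
      have "x i = 0" if i: "i \<notin> g ` M" for i
      proof (cases "i \<in> range g")
        case True
        then obtain b where b: "i = g b" by blast
        then have "b \<notin> M" using i by blast
        then show ?thesis using C[OF y(2)] b g by (simp add: x_def)
      qed (simp add: x_def)
      moreover have "x (g a) \<noteq> 0" using y(3) xg by (auto simp: fun_eq_iff)
      ultimately have "proj_point x \<in> proj_set {x. (\<forall>i. i \<notin> g ` M \<longrightarrow> x i = 0) \<and> x \<circ> g \<in> C}"
        unfolding proj_set_def using xg y(2) by blast
      then show "l \<in> coord_embed g ` proj_set {x. (\<forall>i. i \<notin> g ` M \<longrightarrow> x i = 0) \<and> x \<circ> g \<in> C}"
        unfolding y(1) xg[symmetric] embed[symmetric] by (rule imageI)
    qed
  qed
qed

lemma swap_keys: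
  assumes M: "sublattice M" and "swap m n" "Poly_Mapping.keys m \<subseteq> M"
  shows "Poly_Mapping.keys n \<subseteq> M"
    and "x \<in> hibi_affine_cone M \<Longrightarrow> mon x n = mon x m"
    and "(\<And>a b. a \<in> M \<Longrightarrow> b \<in> M \<Longrightarrow> w $ a + w $ b = w $ sup a b + w $ inf a b) \<Longrightarrow> grad w n = grad w m"
proof -
  obtain k a b where mn: "m = k + mvar a + mvar b" "n = k + mvar (sup a b) + mvar (inf a b)"
    using assms(2) by (auto elim: swap.cases)
  have keys: "a \<in> Poly_Mapping.keys m" "b \<in> Poly_Mapping.keys m" "Poly_Mapping.keys k \<subseteq> Poly_Mapping.keys m"
    unfolding mn by (auto simp: in_keys_iff lookup_add)
  then have ab: "a \<in> M" "b \<in> M" using assms(3) by auto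
  have "Poly_Mapping.keys n \<subseteq> Poly_Mapping.keys k \<union> {sup a b, inf a b}"
    unfolding mn by (auto simp: in_keys_iff lookup_add lookup_single when_def split: if_splits)
  moreover have "sup a b \<in> M" "inf a b \<in> M" using M ab by (auto simp: sublattice_def)
  ultimately show "Poly_Mapping.keys n \<subseteq> M" using keys(3) assms(3) by blast
  show "mon x n = mon x m" if "x \<in> hibi_affine_cone M"
  proof -
    have "x a * x b = x (sup a b) * x (inf a b)" using that ab by (simp add: hibi_affine_cone_def)
    then show ?thesis unfolding mn by (simp add: mult.assoc)
  qed
  show "grad w n = grad w m" if "\<And>a b. a \<in> M \<Longrightarrow> b \<in> M \<Longrightarrow> w $ a + w $ b = w $ sup a b + w $ inf a b"
    using that[OF ab] unfolding mn by simp
qed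

lemma std_keys:
  assumes M: "sublattice M" and m: "Poly_Mapping.keys m \<subseteq> M"
  shows "Poly_Mapping.keys (std m) \<subseteq> M"
    and "x \<in> hibi_affine_cone M \<Longrightarrow> mon x (std m) = mon x m"
    and "(\<And>a b. a \<in> M \<Longrightarrow> b \<in> M \<Longrightarrow> w $ a + w $ b = w $ sup a b + w $ inf a b) \<Longrightarrow> grad w (std m) = grad w m"
proof -
  have "Poly_Mapping.keys n \<subseteq> M \<and> (x \<in> hibi_affine_cone M \<longrightarrow> mon x n = mon x m) \<and>
    ((\<forall>a\<in>M. \<forall>b\<in>M. w $ a + w $ b = w $ sup a b + w $ inf a b) \<longrightarrow> grad w n = grad w m)"
    if "swap\<^sup>*\<^sup>* m n" for n
    using that
  proof induction
    case base
    then show ?case using m by simp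
  next
    case (step n n')
    then show ?case using swap_keys[OF M step.hyps(2)] by auto
  qed
  from this[OF swap_std]
  show "Poly_Mapping.keys (std m) \<subseteq> M"
    and "x \<in> hibi_affine_cone M \<Longrightarrow> mon x (std m) = mon x m"
    and "(\<And>a b. a \<in> M \<Longrightarrow> b \<in> M \<Longrightarrow> w $ a + w $ b = w $ sup a b + w $ inf a b) \<Longrightarrow> grad w (std m) = grad w m"
    by blast+
qed

lemma mon_eq_0: "a \<in> Poly_Mapping.keys m \<Longrightarrow> x a = 0 \<Longrightarrow> mon x m = 0"
  unfolding mon_def by (rule prod_zero) (auto simp: in_keys_iff)

section \<open>The zero set of an initial ideal\<close>

definition tight_cone :: "real ^ 'a::{finite,distrib_lattice} \<Rightarrow> ('a \<Rightarrow> complex) set" where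
  "tight_cone w = {x. \<forall>m. if tight w m then mon x m = mon x (std m) else mon x m = 0}"

lemma mon_scale:
  fixes m :: "'a::{finite,distrib_lattice} \<Rightarrow>\<^sub>0 nat"
  shows "mon (\<lambda>i. c * x i) m = c ^ height m least_elem * mon x m"
  by (simp add: mon_superset[of UNIV] height_def power_mult_distrib prod.distrib power_sum)

lemma scale_closed_tight_cone: "scale_closed (tight_cone w)"
proof -
  have "height (std m) least_elem = height m least_elem" for m :: "'a \<Rightarrow>\<^sub>0 nat"
    using same_fiber_std[of m] least_elem_join_prime unfolding same_fiber_def by metis
  then show ?thesis unfolding scale_closed_def tight_cone_def by (simp add: mon_scale)
qed

lemma proj_zeros_tight_ideal: "proj_zeros UNIV (tight_ideal w) = proj_set (tight_cone w)"
proof -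
  have "(\<forall>p\<in>tight_ideal w. \<forall>c. cpoly_eval p (\<lambda>i. c * x i) = 0) \<longleftrightarrow> x \<in> tight_cone w" for x
  proof
    assume *: "\<forall>p\<in>tight_ideal w. \<forall>c. cpoly_eval p (\<lambda>i. c * x i) = 0"
    have z: "cpoly_eval p x = 0" if "p \<in> tight_ideal w" for p using *[rule_format, OF that, of 1] by simp
    have "tight w m \<Longrightarrow> Poly_Mapping.single m 1 - Poly_Mapping.single (std m) 1 \<in> tight_ideal w"
      "\<not> tight w m \<Longrightarrow> Poly_Mapping.single m 1 \<in> tight_ideal w" for m
      unfolding tight_ideal_def by (auto simp: tight_def)
    then show "x \<in> tight_cone w" unfolding tight_cone_def using z by fastforce
  next
    assume x: "x \<in> tight_cone w"
    show "\<forall>p\<in>tight_ideal w. \<forall>c. cpoly_eval p (\<lambda>i. c * x i) = 0"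
    proof (intro ballI allI)
      fix p c assume p: "p \<in> tight_ideal w"
      let ?y = "\<lambda>i. c * x i"
      have y: "?y \<in> tight_cone w" using x scale_closed_tight_cone by (auto simp: scale_closed_def)
      have "p \<in> {p. cpoly_eval p ?y = 0}"
      proof (rule fiber_sum_decomposition[where T = "tight w" and s = std])
        show "Poly_Mapping.single m 1 \<in> {p. cpoly_eval p ?y = 0}" if "\<not> tight w m" for m
          using y that by (auto simp: tight_cone_def)
        show "Poly_Mapping.single m 1 - Poly_Mapping.single (std m) 1 \<in> {p. cpoly_eval p ?y = 0}"
          if "tight w m" for m using y that by (auto simp: tight_cone_def)
      qed (use p in \<open>auto simp: tight_ideal_def\<close>)
      then show "cpoly_eval p ?y = 0" by simp
    qed
  qed
  then show ?thesis unfolding proj_zeros_eq_proj_set by simp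
qed

lemma sublattice_cell: "supermodular w \<Longrightarrow> linext ps \<Longrightarrow> sublattice (cell w ps)"
  unfolding sublattice_def using cell_sublattice by blast

text \<open>A monomial supported in the cell is tight and straightens by Hibi relations within the
  cell. A monomial with a variable outside vanishes at \<open>x\<close>; if it is tight, its normal
  form also has a variable outside, by \<open>tight_keys_subset_cell\<close>, and vanishes as
  well.\<close>

lemma hibi_affine_cone_subset_tight_cone:
  assumes w: "supermodular w" and ps: "linext ps"
  shows "hibi_affine_cone (cell w ps) \<subseteq> tight_cone w"
proof
  fix x assume x: "x \<in> hibi_affine_cone (cell w ps)"
  note std = std_keys[OF sublattice_cell[OF w ps]]
  show "x \<in> tight_cone w"
    unfolding tight_cone_def
  proof (intro CollectI allI)
    fix m
    have zero: "mon x n = 0" if "\<not> Poly_Mapping.keys n \<subseteq> cell w ps" for n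
      using that x mon_eq_0[of _ n x] by (auto simp: hibi_affine_cone_def)
    show "if tight w m then mon x m = mon x (std m) else mon x m = 0"
    proof (cases "Poly_Mapping.keys m \<subseteq> cell w ps")
      case True
      then have "tight w m" unfolding tight_def using std(3) cell_sublattice(3)[OF w ps] by metis
      then show ?thesis using std(2)[OF True x] by simp
    next
      case False
      then show ?thesis using zero[of m] zero[of "std m"] tight_keys_subset_cell[OF w _ ps, of m] by auto
    qed
  qed
qed

lemma tight_cone_support:
  assumes w: "supermodular w" and x: "x \<in> tight_cone w"
  shows "\<exists>ps. linext ps \<and> {a. x a \<noteq> 0} \<subseteq> cell w ps"
proof -
  \<comment> \<open>The product of all nonzero coordinates does not vanish at \<open>x\<close>. So
    this monomial is tight, and it carries the whole support of \<open>x\<close>.\<close>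
  define m where "m = (\<Sum>a\<in>{a. x a \<noteq> 0}. mvar a)"
  have keys: "Poly_Mapping.keys m = {a. x a \<noteq> 0}"
    by (auto simp: m_def in_keys_iff lookup_sum lookup_single when_def)
  have "mon x m \<noteq> 0" unfolding mon_def keys by simp
  then have "tight w m" using x unfolding tight_cone_def by (auto split: if_splits)
  then show ?thesis using tight_support_subset_cell[OF w] keys by metis
qed

lemma tight_cone_mem_hibi_affine_cone:
  assumes w: "supermodular w" and ps: "linext ps" and x: "x \<in> tight_cone w" "{a. x a \<noteq> 0} \<subseteq> cell w ps"
  shows "x \<in> hibi_affine_cone (cell w ps)"
  unfolding hibi_affine_cone_def
proof (intro CollectI conjI allI ballI impI)
  fix a b assume "a \<in> cell w ps" "b \<in> cell w ps"
  then have "w $ a + w $ b = w $ sup a b + w $ inf a b" using cell_sublattice(3)[OF w ps] by blast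
  then have "tight w (mvar a + mvar b)" by (simp add: tight_def std_pair)
  then have "mon x (mvar a + mvar b) = mon x (std (mvar a + mvar b))"
    using x(1) unfolding tight_cone_def mem_Collect_eq by metis
  then show "x a * x b = x (sup a b) * x (inf a b)" by (simp add: std_pair)
qed (use x(2) in auto)

section \<open>Torus points and irreducibility\<close>

definition torus_point :: "'a::{finite,distrib_lattice} set \<Rightarrow> ('a \<Rightarrow> complex) \<Rightarrow> 'a \<Rightarrow> complex" where
  "torus_point M t a = (if a \<in> M then \<Prod>p\<in>join_primes. t p ^ of_bool (p \<le> a) else 0)"

text \<open>For a join prime \<open>p\<close> the truth value of \<open>p \<le> a\<close> is modular
  in \<open>a\<close>, which exponentiates to the Hibi relations. The parameter at
  \<open>least_elem\<close> enters every coordinate in \<open>M\<close> and acts as a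
  scalar.\<close>

lemma torus_point_mem:
  assumes "sublattice M"
  shows "torus_point M t \<in> hibi_affine_cone M"
proof -
  have "(of_bool (p \<le> a) :: nat) + of_bool (p \<le> b) = of_bool (p \<le> sup a b) + of_bool (p \<le> inf a b)"
    if "p \<in> join_primes" for p a b :: 'a
    using le_sup_iff_join_prime[OF that, of a b] by auto
  then have "(\<Prod>p\<in>join_primes. t p ^ of_bool (p \<le> a)) * (\<Prod>p\<in>join_primes. t p ^ of_bool (p \<le> b))
    = (\<Prod>p\<in>join_primes. t p ^ of_bool (p \<le> sup a b)) * (\<Prod>p\<in>join_primes. t p ^ of_bool (p \<le> inf a b))"
    for a b
    unfolding prod.distrib[symmetric] power_add[symmetric] by (intro prod.cong) simp_all
  then show ?thesis using assms unfolding hibi_affine_cone_def torus_point_def sublattice_def by auto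
qed

lemma mon_torus_point:
  assumes "Poly_Mapping.keys m \<subseteq> M"
  shows "mon (torus_point M t) m = (\<Prod>p\<in>join_primes. t p ^ height m p)"
proof -
  have "mon (torus_point M t) m
      = (\<Prod>a\<in>UNIV. (\<Prod>p\<in>join_primes. t p ^ of_bool (p \<le> a)) ^ Poly_Mapping.lookup m a)"
    unfolding mon_superset[of UNIV m, simplified]
  proof (intro prod.cong refl)
    fix a
    show "torus_point M t a ^ Poly_Mapping.lookup m a
        = (\<Prod>p\<in>join_primes. t p ^ of_bool (p \<le> a)) ^ Poly_Mapping.lookup m a"
    proof (cases "a \<in> M")
      case False
      then have "Poly_Mapping.lookup m a = 0" using assms by (auto simp: in_keys_iff)
      then show ?thesis by simp
    qed (simp add: torus_point_def)
  qed
  also have "\<dots> = (\<Prod>p\<in>join_primes. \<Prod>a\<in>UNIV. t p ^ (of_bool (p \<le> a) * Poly_Mapping.lookup m a))"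
    unfolding prod_power_distrib power_mult[symmetric] by (rule prod.swap)
  also have "\<dots> = (\<Prod>p\<in>join_primes. t p ^ height m p)"
  proof (rule prod.cong[OF refl])
    fix p
    have "height m p = (\<Sum>a\<in>UNIV. of_bool (p \<le> a) * Poly_Mapping.lookup m a)"
      unfolding height_def by (rule sum.mono_neutral_cong_left) auto
    then show "(\<Prod>a\<in>UNIV. t p ^ (of_bool (p \<le> a) * Poly_Mapping.lookup m a)) = t p ^ height m p"
      by (simp only: power_sum)
  qed
  finally show ?thesis .
qed

text \<open>Digits in a base exceeding all entries separate finitely many vectors of naturals.\<close>

lemma ex_separating_weights:
  fixes h :: "'m \<Rightarrow> 'i \<Rightarrow> nat"
  assumes "finite I" "finite A"
  shows "\<exists>N. \<forall>m\<in>A. \<forall>n\<in>A. (\<Sum>i\<in>I. N i * h m i) = (\<Sum>i\<in>I. N i * h n i) \<longrightarrow> (\<forall>i\<in>I. h m i = h n i)"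
  using assms(1)
proof induction
  case empty
  then show ?case by simp
next
  case (insert j I)
  then obtain N where N: "\<And>m n. m \<in> A \<Longrightarrow> n \<in> A \<Longrightarrow> (\<Sum>i\<in>I. N i * h m i) = (\<Sum>i\<in>I. N i * h n i) \<Longrightarrow> \<forall>i\<in>I. h m i = h n i"
    by blast
  define B where "B = Suc (Max (insert 0 ((\<lambda>m. h m j) ` A)))"
  have B: "h m j < B" if "m \<in> A" for m
    unfolding B_def less_Suc_eq_le using that assms(2) by (intro Max_ge) auto
  define N' where "N' = (\<lambda>i. if i = j then 1 else B * N i)"
  have N': "(\<Sum>i\<in>insert j I. N' i * h m i) = h m j + B * (\<Sum>i\<in>I. N i * h m i)" for m
  proof -
    have "(\<Sum>i\<in>I. N' i * h m i) = (\<Sum>i\<in>I. B * (N i * h m i))"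
      using insert.hyps by (intro sum.cong) (auto simp: N'_def)
    then show ?thesis using insert.hyps by (simp add: N'_def sum_distrib_left)
  qed
  show ?case
  proof (intro exI[of _ N'] ballI impI)
    fix m n i assume mn: "m \<in> A" "n \<in> A" and i: "i \<in> insert j I"
      and "(\<Sum>i\<in>insert j I. N' i * h m i) = (\<Sum>i\<in>insert j I. N' i * h n i)"
    then have eq: "h m j + B * (\<Sum>i\<in>I. N i * h m i) = h n j + B * (\<Sum>i\<in>I. N i * h n i)"
      unfolding N' by simp
    have "h m j = h n j" using arg_cong[OF eq, of "\<lambda>x. x mod B"] B[OF mn(1)] B[OF mn(2)] by simp
    moreover have "B > 0" by (simp add: B_def)
    ultimately have "(\<Sum>i\<in>I. N i * h m i) = (\<Sum>i\<in>I. N i * h n i)" using eq by simp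
    then show "h m i = h n i" using N[OF mn] i \<open>h m j = h n j\<close> by blast
  qed
qed

text \<open>The substitution \<open>t p = z ^ N p\<close> sends the fibres that occur to distinct
  powers of \<open>z\<close>. If \<open>f\<close> became the zero polynomial, its coefficients at
  monomials supported in \<open>M\<close> would sum to zero on every fibre, and \<open>f\<close>
  would vanish on the whole affine cone. The two-polynomial form gives irreducibility; the case
  \<open>f = g\<close> gives density of the torus.\<close>

lemma torus_point_common_nonzero:
  fixes f g :: "'a::{finite,distrib_lattice} cpoly"
  assumes M: "sublattice M" and x: "x \<in> hibi_affine_cone M" "cpoly_eval f x \<noteq> 0"
    and y: "y \<in> hibi_affine_cone M" "cpoly_eval g y \<noteq> 0"
  shows "\<exists>t. (\<forall>p. t p \<noteq> 0) \<and> cpoly_eval f (torus_point M t) \<noteq> 0 \<and> cpoly_eval g (torus_point M t) \<noteq> 0"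
proof -
  obtain N where N: "\<And>m n. m \<in> Poly_Mapping.keys f \<union> Poly_Mapping.keys g \<Longrightarrow> n \<in> Poly_Mapping.keys f \<union> Poly_Mapping.keys g
      \<Longrightarrow> (\<Sum>i\<in>join_primes. N i * height m i) = (\<Sum>i\<in>join_primes. N i * height n i)
      \<Longrightarrow> \<forall>i\<in>join_primes. height m i = height n i"
    using ex_separating_weights[of join_primes "Poly_Mapping.keys f \<union> Poly_Mapping.keys g" height] by auto
  define e where "e = (\<lambda>m. \<Sum>p\<in>join_primes. N p * height m p)"
  define G :: "'a cpoly \<Rightarrow> complex poly" where "G = (\<lambda>f. \<Sum>m | m \<in> Poly_Mapping.keys f \<and> Poly_Mapping.keys m \<subseteq> M. monom (Poly_Mapping.lookup f m) (e m))"
  have sum: "cpoly_eval f z = (\<Sum>m | m \<in> Poly_Mapping.keys f \<and> Poly_Mapping.keys m \<subseteq> M. Poly_Mapping.lookup f m * mon z m)"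
    if "z \<in> hibi_affine_cone M" for z and f :: "'a cpoly"
    unfolding cpoly_eval_lin lin_def
    using that by (intro sum.mono_neutral_right) (auto simp: hibi_affine_cone_def intro: mon_eq_0)
  have G: "cpoly_eval f (torus_point M (\<lambda>p. z ^ N p)) = poly (G f) z" for f z
    unfolding sum[OF torus_point_mem[OF M]] G_def poly_sum poly_monom
    by (intro sum.cong) (auto simp: mon_torus_point e_def power_sum power_mult)
  have nonzero: "G f \<noteq> 0" if x: "x \<in> hibi_affine_cone M" "cpoly_eval f x \<noteq> 0"
    and e: "\<And>m n. m \<in> Poly_Mapping.keys f \<Longrightarrow> n \<in> Poly_Mapping.keys f \<Longrightarrow> e m = e n \<Longrightarrow> std m = std n"
    for f x
  proof
    assume "G f = 0"
    let ?A = "{m \<in> Poly_Mapping.keys f. Poly_Mapping.keys m \<subseteq> M}"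
    have zero: "(\<Sum>m\<in>{m \<in> ?A. std m = n}. Poly_Mapping.lookup f m) = 0" if n: "n \<in> std ` ?A" for n
    proof -
      obtain k where k: "k \<in> ?A" "n = std k" using n by blast
      have e_std: "e m = e k" if "std m = std k" for m
        using that unfolding e_def std_eq_iff same_fiber_def by simp
      have iff: "std m = n \<longleftrightarrow> e m = e k" if "m \<in> ?A" for m
        using e_std[of m] e[of m k] k that by blast
      have finite: "finite ?A" by simp
      have "(\<Sum>m\<in>{m \<in> ?A. std m = n}. Poly_Mapping.lookup f m)
          = (\<Sum>m\<in>?A. if e m = e k then Poly_Mapping.lookup f m else 0)"
        unfolding sum.inter_filter[OF finite] using iff by (intro sum.cong) auto
      also have "\<dots> = coeff (G f) (e k)"
        unfolding G_def coeff_sum coeff_monom ..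
      finally show ?thesis using \<open>G f = 0\<close> by simp
    qed
    have "cpoly_eval f x = (\<Sum>m\<in>?A. Poly_Mapping.lookup f m * mon x (std m))"
      unfolding sum[OF x(1)] using std_keys(2)[OF M _ x(1)] by (intro sum.cong) auto
    also have "\<dots> = (\<Sum>n\<in>std ` ?A. \<Sum>m\<in>{m \<in> ?A. std m = n}. Poly_Mapping.lookup f m * mon x (std m))"
      by (rule sum.image_gen) simp
    also have "\<dots> = (\<Sum>n\<in>std ` ?A. (\<Sum>m\<in>{m \<in> ?A. std m = n}. Poly_Mapping.lookup f m) * mon x n)"
      unfolding sum_distrib_right by (intro sum.cong) auto
    also have "\<dots> = 0" using zero by simp
    finally show False using x(2) by simp
  qed
  have "std m = std n" if "m \<in> Poly_Mapping.keys f \<union> Poly_Mapping.keys g" "n \<in> Poly_Mapping.keys f \<union> Poly_Mapping.keys g" "e m = e n" for m n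
    using N that unfolding e_def std_eq_iff same_fiber_def by blast
  then have "G f \<noteq> 0" "G g \<noteq> 0" using nonzero[OF x] nonzero[OF y] by auto
  \<comment> \<open>The extra factor is the variable itself; it keeps \<open>z\<close> away from
    zero and thus the point in the torus.\<close>
  then have "monom 1 1 * (G f * G g) \<noteq> 0" by simp
  then obtain z where "poly (monom 1 1 * (G f * G g)) z \<noteq> 0"
    using poly_all_0_iff_0 by blast
  then have "z \<noteq> 0" "poly (G f) z \<noteq> 0" "poly (G g) z \<noteq> 0" by (auto simp: poly_monom)
  then show ?thesis
    using G by (intro exI[of _ "\<lambda>p. z ^ N p"]) auto
qed

lemma coord_embed_hibi_affine_cone:
  assumes "inj g"
  shows "coord_embed g ` proj_set {x. (\<forall>i. i \<notin> g ` M \<longrightarrow> x i = 0) \<and> x \<circ> g \<in> hibi_affine_cone M}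
    = proj_set (hibi_affine_cone M)"
  by (rule coord_embed_proj_set[OF assms]) (simp add: hibi_affine_cone_def)

lemma zariski_irreducible_hibi:
  fixes M :: "'a::{finite,distrib_lattice} set"
  assumes M: "sublattice M" "M \<noteq> {}"
  shows "zariski_irreducible UNIV (proj_set (hibi_affine_cone M))"
proof -
  let ?Z = "proj_set (hibi_affine_cone M)"
  have torus: "proj_point (torus_point M t) \<in> ?Z" if "\<forall>p. t p \<noteq> 0" for t
  proof -
    have "torus_point M t a \<noteq> 0" if "a \<in> M" for a using \<open>\<forall>p. t p \<noteq> 0\<close> that by (simp add: torus_point_def)
    then show ?thesis unfolding proj_set_def using M(2) torus_point_mem[OF M(1), of t] by blast
  qed
  have witness: "\<exists>p\<in>S. \<exists>x\<in>hibi_affine_cone M. cpoly_eval p x \<noteq> 0" if nsub: "\<not> ?Z \<subseteq> proj_zeros UNIV S" for S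
  proof -
    obtain l where l: "l \<in> ?Z" "l \<notin> proj_zeros UNIV S" using nsub by blast
    then obtain x where x: "l = proj_point x" "x \<in> hibi_affine_cone M" "\<exists>i. x i \<noteq> 0"
      unfolding proj_set_def by blast
    then obtain p c where "p \<in> S" "cpoly_eval p (\<lambda>i. c * x i) \<noteq> 0"
      using l(2) unfolding proj_zeros_eq_proj_set proj_set_def by blast
    then show ?thesis using x(2) scale_closed_hibi_affine_cone unfolding scale_closed_def by blast
  qed
  have "?Z \<subseteq> C \<or> ?Z \<subseteq> D" if CD: "zariski_closed UNIV C" "zariski_closed UNIV D" "?Z \<subseteq> C \<union> D" for C D
  proof (rule ccontr)
    assume n: "\<not> (?Z \<subseteq> C \<or> ?Z \<subseteq> D)"
    obtain S S' where S: "C = proj_zeros UNIV S" "D = proj_zeros UNIV S'"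
      using CD by (auto simp: zariski_closed_def)
    obtain f x where f: "f \<in> S" "x \<in> hibi_affine_cone M" "cpoly_eval f x \<noteq> 0"
      using witness[of S] n S(1) by blast
    obtain g y where g: "g \<in> S'" "y \<in> hibi_affine_cone M" "cpoly_eval g y \<noteq> 0"
      using witness[of S'] n S(2) by blast
    obtain t where t: "\<forall>p. t p \<noteq> 0" "cpoly_eval f (torus_point M t) \<noteq> 0" "cpoly_eval g (torus_point M t) \<noteq> 0"
      using torus_point_common_nonzero[OF M(1) f(2,3) g(2,3)] by blast
    have "proj_point (torus_point M t) \<notin> C" "proj_point (torus_point M t) \<notin> D"
      using f(1) g(1) t(2,3) self_mem_proj_point unfolding S proj_zeros_def by blast+
    then show False using torus[OF t(1)] CD(3) by blast
  qed
  moreover have "?Z \<noteq> {}" using torus[of "\<lambda>_. 1"] by auto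
  ultimately show ?thesis unfolding zariski_irreducible_def by blast
qed

text \<open>An irreducible set covered by finitely many closed sets lies in one of them. Each
  hyperplane \<open>x a = 0\<close> with \<open>a\<close> in \<open>T\<close> misses a point of
  \<open>Z\<close>, and the union of these hyperplanes is the zero set of a product of
  variables.\<close>

lemma irreducible_generic_support:
  assumes Z: "zariski_irreducible UNIV Z" "Z \<subseteq> proj_space UNIV" and T: "finite T" "\<And>a. a \<in> T \<Longrightarrow> \<exists>l\<in>Z. \<exists>x\<in>l. x a \<noteq> 0"
  shows "\<exists>x. proj_point x \<in> Z \<and> (\<forall>a\<in>T. x a \<noteq> 0)"
proof -
  have zeros: "proj_point x \<in> proj_zeros UNIV {\<Prod>a\<in>T. Xvar a} \<longleftrightarrow> (\<exists>a\<in>T. x a = 0)"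
    if "proj_point x \<in> Z" "finite T" for x T
  proof -
    have "proj_point x \<in> proj_zeros UNIV {\<Prod>a\<in>T. Xvar a} \<longleftrightarrow> (\<forall>c. \<exists>a\<in>T. c * x a = 0)"
      using that Z(2) by (auto simp: proj_zeros_def proj_point_def prod_zero_iff)
    also have "\<dots> \<longleftrightarrow> (\<exists>a\<in>T. x a = 0)"
      by (metis mult_1 mult_zero_right)
    finally show ?thesis .
  qed
  have dichotomy: "Z \<subseteq> proj_zeros UNIV S \<or> Z \<subseteq> proj_zeros UNIV S'"
    if "Z \<subseteq> proj_zeros UNIV S \<union> proj_zeros UNIV S'" for S S'
  proof -
    have "zariski_closed UNIV (proj_zeros UNIV S)" for S unfolding zariski_closed_def by blast
    then show ?thesis using Z(1) that unfolding zariski_irreducible_def by metis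
  qed
  have points: "\<exists>x. l = proj_point x" if "l \<in> Z" for l using that Z(2) by (auto simp: proj_space_def)
  have "\<not> Z \<subseteq> proj_zeros UNIV {\<Prod>a\<in>T. Xvar a}"
    using T
  proof induction
    case empty
    obtain l where "l \<in> Z" using Z(1) by (auto simp: zariski_irreducible_def)
    then obtain x where "l = proj_point x" using points by blast
    then show ?case using zeros[of x "{}"] \<open>l \<in> Z\<close> by blast
  next
    case (insert b T)
    have "\<not> Z \<subseteq> proj_zeros UNIV {\<Prod>a\<in>{b}. Xvar a}"
    proof
      assume sub: "Z \<subseteq> proj_zeros UNIV {\<Prod>a\<in>{b}. Xvar a}"
      obtain l y where l: "l \<in> Z" "y \<in> l" "y b \<noteq> 0" using insert.prems by blast
      then obtain x where x: "l = proj_point x" using points by blast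
      then have "x b = 0" using l(1) sub zeros[of x "{b}"] by auto
      then show False using l(2,3) unfolding x mem_proj_point by auto
    qed
    moreover have "\<not> Z \<subseteq> proj_zeros UNIV {\<Prod>a\<in>T. Xvar a}"
      by (rule insert.IH) (simp add: insert.prems)
    moreover have "Z \<subseteq> proj_zeros UNIV {\<Prod>a\<in>{b}. Xvar a} \<union> proj_zeros UNIV {\<Prod>a\<in>T. Xvar a}"
      if sub: "Z \<subseteq> proj_zeros UNIV {\<Prod>a\<in>insert b T. Xvar a}"
    proof
      fix l assume l: "l \<in> Z"
      then obtain x where x: "l = proj_point x" using points by blast
      then have "\<exists>a\<in>insert b T. x a = 0" using zeros[of x "insert b T"] insert.hyps(1) l sub by auto
      then show "l \<in> proj_zeros UNIV {\<Prod>a\<in>{b}. Xvar a} \<union> proj_zeros UNIV {\<Prod>a\<in>T. Xvar a}"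
        using zeros[of x "{b}"] zeros[of x T] insert.hyps(1) l unfolding x by auto
    qed
    ultimately show ?case using dichotomy by blast
  qed
  then obtain l where l: "l \<in> Z" "l \<notin> proj_zeros UNIV {\<Prod>a\<in>T. Xvar a}" by blast
  then obtain x where x: "l = proj_point x" using points by blast
  show ?thesis using l zeros[of x T, OF _ T(1)] unfolding x by blast
qed

text \<open>A point of \<open>Z\<close> with the largest possible support has this support in one
  cell, which then contains the supports of all points of \<open>Z\<close>.\<close>

lemma irreducible_subset_cell:
  assumes w: "supermodular w" and Z: "zariski_irreducible UNIV Z" "Z \<subseteq> proj_set (tight_cone w)"
  shows "\<exists>ps. linext ps \<and> Z \<subseteq> proj_set (hibi_affine_cone (cell w ps))"
proof -
  define T where "T = {a. \<exists>l\<in>Z. \<exists>x\<in>l. x a \<noteq> 0}"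
  have "Z \<subseteq> proj_space UNIV" using Z(2) by (auto simp: proj_set_def proj_space_def)
  then have "\<exists>x. proj_point x \<in> Z \<and> (\<forall>a\<in>T. x a \<noteq> 0)"
    by (rule irreducible_generic_support[OF Z(1)]) (simp_all add: T_def)
  then obtain x where x: "proj_point x \<in> Z" "\<forall>a\<in>T. x a \<noteq> 0" by blast
  obtain y where y: "proj_point x = proj_point y" "y \<in> tight_cone w" "\<exists>i. y i \<noteq> 0"
    using x(1) Z(2) unfolding proj_set_def by blast
  then obtain c where c: "x = (\<lambda>i. c * y i)" using self_mem_proj_point[of x] by (auto simp: mem_proj_point)
  then have "x \<in> tight_cone w" using y(2) scale_closed_tight_cone by (auto simp: scale_closed_def)
  then obtain ps where ps: "linext ps" "{a. x a \<noteq> 0} \<subseteq> cell w ps" using tight_cone_support[OF w] by blast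
  have "l \<in> proj_set (hibi_affine_cone (cell w ps))" if l: "l \<in> Z" for l
  proof -
    obtain z where z: "l = proj_point z" "z \<in> tight_cone w" "\<exists>i. z i \<noteq> 0"
      using l Z(2) unfolding proj_set_def by blast
    have "{a. z a \<noteq> 0} \<subseteq> T" using l self_mem_proj_point[of z] z(1) by (auto simp: T_def)
    then have "{a. z a \<noteq> 0} \<subseteq> cell w ps" using x(2) ps(2) by blast
    then have "z \<in> hibi_affine_cone (cell w ps)" by (rule tight_cone_mem_hibi_affine_cone[OF w ps(1) z(2)])
    then show ?thesis using z unfolding proj_set_def by blast
  qed
  then show ?thesis using ps(1) by blast
qed

lemma cell_nonempty: "linext ps \<Longrightarrow> cell w ps \<noteq> {}"
  using chain_elem_mem_cell[of ps 0 w] by auto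

text \<open>The point whose coordinates in \<open>M\<close> all equal 1 has support exactly
  \<open>M\<close>, so the variety remembers \<open>M\<close>.\<close>

lemma proj_set_hibi_subset:
  fixes M :: "'a::{finite,distrib_lattice} set"
  assumes "sublattice M" "M \<noteq> {}" "proj_set (hibi_affine_cone M) \<subseteq> proj_set (hibi_affine_cone M')"
  shows "M \<subseteq> M'"
proof -
  let ?x = "torus_point M (\<lambda>_. 1)"
  have nz: "?x a \<noteq> 0" if "a \<in> M" for a using that by (simp add: torus_point_def)
  then have "proj_point ?x \<in> proj_set (hibi_affine_cone M)"
    unfolding proj_set_def using assms(2) torus_point_mem[OF assms(1), of "\<lambda>_. 1"] by blast
  then have "proj_point ?x \<in> proj_set (hibi_affine_cone M')" using assms(3) by blast
  moreover have "\<exists>a. ?x a \<noteq> 0" using nz assms(2) by blast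
  ultimately have "?x \<in> hibi_affine_cone M'"
    using proj_point_mem_proj_set[OF scale_closed_hibi_affine_cone] by blast
  then show ?thesis using nz unfolding hibi_affine_cone_def by blast
qed

text \<open>Every irreducible subset lies in one piece. An inclusion of pieces gives an inclusion of
  cells, which is an equality by \<open>cell_maximal\<close>, so each piece is a component.\<close>

lemma irreducible_components_tight_cone:
  assumes w: "supermodular w"
  shows "irreducible_components UNIV (proj_set (tight_cone w))
    = (\<lambda>ps. proj_set (hibi_affine_cone (cell w ps))) ` Collect linext"
proof -
  let ?Z = "\<lambda>ps. proj_set (hibi_affine_cone (cell w ps))" and ?Y = "proj_set (tight_cone w)"
  have sub: "?Z ps \<subseteq> ?Y" if "linext ps" for ps
    using hibi_affine_cone_subset_tight_cone[OF w that] unfolding proj_set_def by blast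
  have irr: "zariski_irreducible UNIV (?Z ps)" if "linext ps" for ps
    using zariski_irreducible_hibi sublattice_cell[OF w that] cell_nonempty[OF that] by blast
  have max: "Z' = ?Z ps" if h: "linext ps" "?Z ps \<subseteq> Z'" "Z' \<subseteq> ?Y" "zariski_irreducible UNIV Z'" for ps Z'
  proof -
    obtain ps' where ps': "linext ps'" "Z' \<subseteq> ?Z ps'" using irreducible_subset_cell[OF w h(4,3)] by blast
    have "?Z ps \<subseteq> ?Z ps'" using h(2) ps'(2) by blast
    then have "cell w ps \<subseteq> cell w ps'"
      by (rule proj_set_hibi_subset[OF sublattice_cell[OF w h(1)] cell_nonempty[OF h(1)]])
    then have "cell w ps = cell w ps'" by (rule cell_maximal[OF h(1) ps'(1)])
    then show ?thesis using h(2) ps'(2) by auto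
  qed
  show ?thesis
  proof
    show "irreducible_components UNIV ?Y \<subseteq> ?Z ` Collect linext"
    proof
      fix Z assume "Z \<in> irreducible_components UNIV ?Y"
      then have Z: "Z \<subseteq> ?Y" "zariski_irreducible UNIV Z"
        "\<And>Z'. Z \<subseteq> Z' \<Longrightarrow> Z' \<subseteq> ?Y \<Longrightarrow> zariski_irreducible UNIV Z' \<Longrightarrow> Z' = Z"
        unfolding irreducible_components_def by blast+
      obtain ps where ps: "linext ps" "Z \<subseteq> ?Z ps" using irreducible_subset_cell[OF w Z(2,1)] by blast
      then have "?Z ps = Z" using Z(3) sub irr by blast
      then show "Z \<in> ?Z ` Collect linext" using ps(1) by blast
    qed
    show "?Z ` Collect linext \<subseteq> irreducible_components UNIV ?Y"
      unfolding irreducible_components_def using sub irr max by blast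
  qed
qed

section \<open>Toric varieties of the parts and Hibi varieties\<close>

lemma cpoly_pullback:
  assumes g: "inj g"
  shows "\<exists>q. \<forall>x. (\<forall>i. i \<notin> g ` M \<longrightarrow> x i = 0) \<longrightarrow> cpoly_eval p x = cpoly_eval q (x \<circ> g)"
proof -
  define v where "v = (\<lambda>i. if i \<in> g ` M then Xvar (inv g i) else 0)"
  define q where "q = (\<Sum>m\<in>Poly_Mapping.keys p. Poly_Mapping.single 0 (Poly_Mapping.lookup p m) *
    (\<Prod>i\<in>Poly_Mapping.keys m. v i ^ Poly_Mapping.lookup m i))"
  have "cpoly_eval p x = cpoly_eval q (x \<circ> g)" if x: "\<forall>i. i \<notin> g ` M \<longrightarrow> x i = 0" for x
  proof -
    have "cpoly_eval (v i) (x \<circ> g) = x i" for i using x g by (auto simp: v_def)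
    then show ?thesis by (simp add: q_def cpoly_eval_def[of p])
  qed
  then show ?thesis by blast
qed

text \<open>Torus points satisfy the Hibi relations, which gives one inclusion. The other is
  density: a polynomial that is nonzero somewhere on the cone is nonzero at a torus point.\<close>

lemma toric_variety_eq:
  assumes M: "sublattice M" "M \<noteq> {}" and Q: "lattice_points Q = lattice_vertex ` M"
  shows "toric_variety Q = proj_set {x. (\<forall>i. i \<notin> lattice_vertex ` M \<longrightarrow> x i = 0) \<and> x \<circ> lattice_vertex \<in> hibi_affine_cone M}"
    (is "_ = ?TV")
proof -
  define pt :: "('a \<Rightarrow> complex) \<Rightarrow> (real, 'a) vec \<Rightarrow> complex" where
    "pt = (\<lambda>t m. if m \<in> lattice_points Q then \<Prod>i\<in>UNIV. t i powi \<lfloor>m $ i\<rfloor> else 0)"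
  have toric: "toric_variety Q = zariski_closure (lattice_vertex ` M) {proj_point (pt t) | t. \<forall>i. t i \<noteq> 0}"
    unfolding toric_variety_def pt_def Q ..
  have supp: "pt t m = 0" if "m \<notin> lattice_vertex ` M" for t m using that by (simp add: pt_def Q)
  have pt: "t least_elem * (pt t \<circ> lattice_vertex) a = torus_point M t a" for t a
  proof (cases "a \<in> M")
    case True
    have "(pt t \<circ> lattice_vertex) a = (\<Prod>i\<in>UNIV. if i \<in> birkhoff a then t i else 1)"
      using True by (auto simp: pt_def Q intro!: prod.cong)
    also have "\<dots> = (\<Prod>i\<in>join_irreducibles. t i ^ of_bool (i \<le> a))"
      by (rule prod.mono_neutral_cong_right) (auto simp: birkhoff_def)
    finally show ?thesis
      using True by (simp add: torus_point_def join_primes_eq least_elem_not_join_irreducible)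
  next
    case False
    then have "lattice_vertex a \<notin> lattice_vertex ` M" using inj_lattice_vertex by (auto dest: injD)
    then show ?thesis using False supp by (simp add: torus_point_def)
  qed
  show ?thesis
  proof
    have "?TV = proj_zeros (lattice_vertex ` M) {Xvar (lattice_vertex a) * Xvar (lattice_vertex b)
        - Xvar (lattice_vertex (sup a b)) * Xvar (lattice_vertex (inf a b)) | a b. a \<in> M \<and> b \<in> M}"
      by (rule proj_zeros_hibi_relations[OF inj_lattice_vertex, symmetric])
    then have "zariski_closed (lattice_vertex ` M) ?TV" unfolding zariski_closed_def by blast
    moreover have "proj_point (pt t) \<in> ?TV" if t: "\<forall>i. t i \<noteq> 0" for t
    proof -
      \<comment> \<open>This change leaves \<open>pt t\<close> as it is and makes the scalar equal
        to 1.\<close>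
      let ?t = "t(least_elem := 1)"
      have "pt ?t m = pt t m" for m
      proof (cases "m \<in> lattice_points Q")
        case True
        then obtain a where "m = lattice_vertex a" using Q by auto
        then have "m $ least_elem = 0"
          using least_elem_not_join_irreducible birkhoff_subset by auto
        then show ?thesis by (auto simp: pt_def intro!: prod.cong)
      qed (simp add: pt_def)
      then have "pt t \<circ> lattice_vertex = torus_point M ?t"
        using pt[of ?t] by (simp add: fun_eq_iff)
      then have "pt t \<circ> lattice_vertex \<in> hibi_affine_cone M" using torus_point_mem[OF M(1)] by simp
      moreover obtain a where a: "a \<in> M" using M(2) by blast
      have "pt t (lattice_vertex a) \<noteq> 0" using a t by (simp add: pt_def Q)
      ultimately show ?thesis unfolding proj_set_def using supp[of _ t] by blast
    qed
    ultimately show "toric_variety Q \<subseteq> ?TV" unfolding toric zariski_closure_def by blast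
    show "?TV \<subseteq> toric_variety Q"
      unfolding toric zariski_closure_def
    proof (clarify)
      fix l C assume l: "l \<in> ?TV" and C: "zariski_closed (lattice_vertex ` M) C"
        "{proj_point (pt t) | t. \<forall>i. t i \<noteq> 0} \<subseteq> C"
      obtain S where S: "C = proj_zeros (lattice_vertex ` M) S" using C(1) by (auto simp: zariski_closed_def)
      obtain x where x: "l = proj_point x" "\<forall>i. i \<notin> lattice_vertex ` M \<longrightarrow> x i = 0"
        "x \<circ> lattice_vertex \<in> hibi_affine_cone M" "\<exists>i. x i \<noteq> 0"
        using l unfolding proj_set_def by blast
      have "cpoly_eval p (\<lambda>i. c * x i) = 0" if p: "p \<in> S" for p c
      proof (rule ccontr)
        assume nz: "cpoly_eval p (\<lambda>i. c * x i) \<noteq> 0"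
        obtain q where q: "\<And>y. (\<forall>i. i \<notin> lattice_vertex ` M \<longrightarrow> y i = 0) \<Longrightarrow> cpoly_eval p y = cpoly_eval q (y \<circ> lattice_vertex)"
          using cpoly_pullback[OF inj_lattice_vertex, of M p] by blast
        let ?y = "(\<lambda>i. c * x i) \<circ> lattice_vertex"
        have "?y \<in> hibi_affine_cone M"
          using x(3) scale_closed_hibi_affine_cone[of M] by (simp add: scale_closed_def comp_def)
        moreover have "cpoly_eval q ?y \<noteq> 0" using nz q[of "\<lambda>i. c * x i"] x(2) by simp
        ultimately obtain t where t: "\<forall>p. t p \<noteq> 0" "cpoly_eval q (torus_point M t) \<noteq> 0"
          using torus_point_common_nonzero[OF M(1), of ?y q ?y q] by blast
        let ?z = "\<lambda>i. t least_elem * pt t i"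
        have "?z \<circ> lattice_vertex = torus_point M t" using pt[of t] by (simp add: fun_eq_iff)
        then have "cpoly_eval p ?z \<noteq> 0" using q[of ?z] supp[of _ t] t(2) by simp
        moreover have "?z \<in> proj_point (pt t)" by (auto simp: mem_proj_point)
        moreover have "proj_point (pt t) \<in> proj_zeros (lattice_vertex ` M) S" using C(2) t(1) S by blast
        ultimately show False using p unfolding proj_zeros_def by blast
      qed
      then show "l \<in> C" unfolding S proj_zeros_eq_proj_set proj_set_def using x by blast
    qed
  qed
qed

lemma hibi_variety_eq:
  "hibi_variety (birkhoff ` M) = proj_set {x. (\<forall>i. i \<notin> birkhoff ` M \<longrightarrow> x i = 0) \<and>
    x \<circ> birkhoff \<in> hibi_affine_cone (M :: 'a::{finite,distrib_lattice} set)}"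
proof -
  have "{Xvar A * Xvar B - Xvar (sup A B) * Xvar (inf A B) | A B. A \<in> birkhoff ` M \<and> B \<in> birkhoff ` M}
    = {Xvar (birkhoff a) * Xvar (birkhoff b) - Xvar (birkhoff (sup a b)) * Xvar (birkhoff (inf a b)) | a b. a \<in> M \<and> b \<in> M}"
    by (auto simp: birkhoff_sup birkhoff_inf)
  then show ?thesis
    unfolding hibi_variety_def hibi_ideal_def proj_zeros_ideal_generated
    by (simp only: proj_zeros_hibi_relations[OF inj_birkhoff])
qed

text \<open>Applying \<open>tight_constant\<close> in both directions shows that all relative
  interior points have the same tight monomials, hence the same initial ideal. This also makes the
  description in \<open>face_ideal\<close> well defined.\<close>

lemma face_variety_eq:
  assumes F: "F face_of hibi_cone" and w: "w \<in> rel_interior F"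
  shows "face_variety F = proj_set (tight_cone w)"
proof -
  have conv: "convex F" and sub: "F \<subseteq> Collect supermodular"
    using F face_of_imp_convex face_of_imp_subset hibi_cone_eq by blast+
  have "initial_ideal w' (hibi_ideal UNIV) = tight_ideal w" if w': "w' \<in> rel_interior F" for w'
  proof -
    have mem: "w \<in> F" "w' \<in> F" using w w' rel_interior_subset by blast+
    then have "tight w' = tight w"
      using tight_constant[OF conv sub w mem(2)] tight_constant[OF conv sub w' mem(1)] by blast
    then show ?thesis using initial_ideal_hibi[of w'] mem(2) sub by (auto simp: tight_ideal_def)
  qed
  then have "face_ideal F = tight_ideal w"
    unfolding face_ideal_def using w by (intro the_equality) auto
  then show ?thesis by (simp add: face_variety_def proj_zeros_tight_ideal)
qed

theorem theoremA:
  fixes F :: "(real ^ 'a::{finite,distrib_lattice}) set" and w :: "(real, 'a) vec"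
  assumes "F face_of hibi_cone" and "w \<in> rel_interior F"
  shows "(\<forall>w'\<in>rel_interior F. hibi_subdivision w' = hibi_subdivision w) \<and>
    (\<forall>Q\<in>hibi_subdivision w. \<exists>lt. is_order_on join_irreducibles lt \<and>
      Q = order_polytope join_irreducibles lt) \<and>
    bij_betw (\<lambda>Q. coord_embed lattice_vertex ` toric_variety Q)
      (hibi_subdivision w) (irreducible_components UNIV (face_variety F)) \<and>
    (\<forall>Z\<in>irreducible_components UNIV (face_variety F). \<exists>lt. is_order_on join_irreducibles lt \<and>
      order_polytope join_irreducibles lt \<in> hibi_subdivision w \<and>
      Z = coord_embed birkhoff ` hibi_variety (order_ideals join_irreducibles lt))"
proof -
  have conv: "convex F" and sub: "F \<subseteq> Collect supermodular"
    using assms(1) face_of_imp_convex face_of_imp_subset hibi_cone_eq by blast+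
  have wF: "w \<in> F" using assms(2) rel_interior_subset by blast
  then have w: "supermodular w" using sub by blast
  let ?Q = "\<lambda>ps. convex hull (lattice_vertex ` cell w ps)"
  let ?Z = "\<lambda>ps. proj_set (hibi_affine_cone (cell w ps))"
  let ?f = "\<lambda>Q. coord_embed lattice_vertex ` toric_variety Q"
  have 1: "hibi_subdivision w' = hibi_subdivision w" if w': "w' \<in> rel_interior F" for w'
  proof -
    have w'F: "w' \<in> F" using w' rel_interior_subset by blast
    have "cell w' ps = cell w ps" if "linext ps" for ps
      using cell_constant[OF conv sub assms(2) w'F that] cell_constant[OF conv sub w' wF that] by blast
    moreover have "supermodular w'" using w'F sub by blast
    ultimately show ?thesis by (simp add: hibi_subdivision_cells w)
  qed
  have comps: "irreducible_components UNIV (face_variety F) = ?Z ` Collect linext"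
    unfolding face_variety_eq[OF assms] by (rule irreducible_components_tight_cone[OF w])
  have subd: "hibi_subdivision w = ?Q ` Collect linext" by (rule hibi_subdivision_cells[OF w])
  have f: "?f (?Q ps) = ?Z ps" if ps: "linext ps" for ps
  proof -
    have "lattice_points (?Q ps) = lattice_vertex ` cell w ps" using cell_order[OF w ps] by blast
    note toric_variety_eq[OF sublattice_cell[OF w ps] cell_nonempty[OF ps] this]
    then show ?thesis by (simp only: coord_embed_hibi_affine_cone[OF inj_lattice_vertex])
  qed
  have 3: "bij_betw ?f (hibi_subdivision w) (irreducible_components UNIV (face_variety F))"
    unfolding bij_betw_def
  proof
    \<comment> \<open>The variety recovers its cell through the supports of its points, and the cell
      determines the part.\<close>
    show "inj_on ?f (hibi_subdivision w)"
    proof (rule inj_onI)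
      fix Q Q' assume "Q \<in> hibi_subdivision w" "Q' \<in> hibi_subdivision w" and eq: "?f Q = ?f Q'"
      then obtain ps ps' where ps: "linext ps" "Q = ?Q ps" "linext ps'" "Q' = ?Q ps'"
        unfolding subd by blast
      then have "?Z ps = ?Z ps'" using eq f by simp
      then have "cell w ps \<subseteq> cell w ps'"
        by (intro proj_set_hibi_subset sublattice_cell[OF w ps(1)] cell_nonempty[OF ps(1)]) simp
      then have "cell w ps = cell w ps'" by (rule cell_maximal[OF ps(1,3)])
      then show "Q = Q'" using ps by simp
    qed
    show "?f ` hibi_subdivision w = irreducible_components UNIV (face_variety F)"
      unfolding subd comps image_image using f by auto
  qed
  have 4: "\<exists>lt. is_order_on join_irreducibles lt \<and> order_polytope join_irreducibles lt \<in> hibi_subdivision w \<and>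
      Z = coord_embed birkhoff ` hibi_variety (order_ideals join_irreducibles lt)"
    if Z: "Z \<in> irreducible_components UNIV (face_variety F)" for Z
  proof -
    obtain ps where ps: "linext ps" "Z = ?Z ps" using Z unfolding comps by blast
    obtain lt where lt: "is_order_on join_irreducibles lt" "order_ideals join_irreducibles lt = birkhoff ` cell w ps"
      "?Q ps = order_polytope join_irreducibles lt" using cell_order[OF w ps(1)] by blast
    have "Z = coord_embed birkhoff ` hibi_variety (order_ideals join_irreducibles lt)"
      unfolding lt(2) hibi_variety_eq ps(2) by (simp only: coord_embed_hibi_affine_cone[OF inj_birkhoff])
    moreover have "order_polytope join_irreducibles lt \<in> hibi_subdivision w"
      unfolding subd lt(3)[symmetric] using ps(1) by blast
    ultimately show ?thesis using lt(1) by blast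
  qed
  have 2: "\<exists>lt. is_order_on join_irreducibles lt \<and> Q = order_polytope join_irreducibles lt"
    if "Q \<in> hibi_subdivision w" for Q
    using that cell_order[OF w] unfolding subd by blast
  show ?thesis using 1 2 3 4 by blast
qed

end
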